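(* Let $d\ge 1$ and let $(A_1,A_2,\dots)$ be random $d\times d$ nonnegative matrices with $N:=\#\{i\ge 1: A_i\neq 0\}<\infty$ a.s., $A_i\neq 0$ for $1\le i\le N$ and $A_i=0$ for $i>N$. Consider the fixed-point equation $Z\overset{\mathcal L}{=}\sum_{i=1}^N A_iZ_i$, where $(Z_i)_{i\ge1}$ are i.i.d. copies of the $\mathbb R_+^d$-valued random vector $Z$, independent of $(N,A_1,A_2,\dots)$. Assume: (i) $N\ge 1$ a.s., $\mathbb E[N]\in(1,\infty)$, and the $A_i$ are nonnegative; (ii) with $\mu$ the probability measure on nonnegative matrices defined by $\int f\,d\mu=\frac{1}{\mathbb E[N]}\mathbb E[\sum_{i=1}^N f(A_i)]$ and $\Gamma$ the multiplicative semigroup generated by $\mathrm{supp}(\mu)$ (including the identity), every matrix in $\Gamma$ has at least one strictly positive entry in each row and each column, and $\Gamma$ contains a strictly positive matrix; (iii) there exist two cover sets $U_1,U_2\subset\mathbb U$ of finite level and two realizations $\{(a^{(i)}_{v1},a^{(i)}_{v2},\dots)\}_{v\in\mathbb U}\subset\mathrm{supp}(A_1,A_2,\dots)$ such that $l_i:=\sum_{u\in U_i}a^{(i)}_{u|1}\cdots a^{(i)}_{u||u|}$ ($i=1,2$) satisfy $l_1>0$, $l_2>0$, $r(l_1)<1<r(l_2)$. Suppose that $Z$ is a solution with $\mathbb P[Z=0]=0$. Then: 1. For any cover set $U\subset\mathbb U$ with finite level and any realizations $\{(a_{u1},a_{u2},\dots)\}_{u\in\mathbb U}\subset\mathrm{supp}(A_1,A_2,\dots)$,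 $$\mathrm{supp}(Z)\supset\sum_{V\subset U,\ g_V>0}\mathbb R_+ v(g_V),\qquad g_V:=\sum_{u\in V}a_{u|1}\cdots a_{u||u|}.$$ 2. If additionally there exists $\alpha\in(0,1]\cap\mathrm{int}(I_\mu)$ with $m(\alpha)=1$ and $m'(\alpha)<0$, this holds with $\alpha=1$, and $\mathbb E[|Z|]<\infty$, then $$\mathrm{supp}(Z)\subset H=H_d,$$ where $H:=\{s_1v_1+\dots+s_nv_n: n\in\mathbb N^*, s_i\ge 0, v_i\in\Lambda\}$ and $H_d:=\{s_1v_1+\dots+s_dv_d: s_i\ge0, v_i\in\Lambda\}$.
   Context: Notation: $|x|$ is the $L^1$ norm; $r(a)$ is the spectral radius; $a>0$ means all entries strictly positive; for $a>0$, $v(a)$ is its Perron–Frobenius right eigenvector with $|v(a)|=1$; $\Lambda:=\overline{\{v(a): a\in\Gamma, a>0\}}$; $\mathbb R_+v=\{sv:s\ge0\}$. $\mathbb U=\bigcup_{n\ge0}(\mathbb N^* )^n$ is the Ulam–Harris tree, $u|k$ is the truncation of $u$ to its first $k$ letters; $U\subset\mathbb U$ is a cover set if every infinite sequence $u$ has a unique $k\ge0$ with $u|k\in U$, and it has finite level if $\sup\{|u|:u\in U\}<\infty$. $I_\mu=\{s\ge0:\int\|a\|^s\mu(da)<\infty\}$, $\kappa(s)=\lim_n\mathbb E[\|M_n\cdots M_1\|^s]^{1/n}$ for i.i.d. $M_i$ with law $\mu$, and $m(s)=\mathbb E[N]\kappa(s)$. *)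

theory Defs
  imports "HOL-Probability.Probability"
begin

(* Matrices: real^'d^'d, vectors: real^'d, for a fixed finite index type 'd (dimension d = CARD('d)).
   Indices i >= 1 of the paper are shifted to i >= 0 here (letter k of the paper <-> k - 1). *)

definition l1norm :: "real^'d \<Rightarrow> real" where
  "l1norm x = (\<Sum>i\<in>UNIV. \<bar>x $ i\<bar>)"

definition nonneg_vec :: "real^'d \<Rightarrow> bool" where
  "nonneg_vec x \<longleftrightarrow> (\<forall>i. x $ i \<ge> 0)"

definition nonneg_mat :: "real^'d^'d \<Rightarrow> bool" where
  "nonneg_mat a \<longleftrightarrow> (\<forall>i j. a $ i $ j \<ge> 0)"

definition pos_mat :: "real^'d^'d \<Rightarrow> bool" where
  "pos_mat a \<longleftrightarrow> (\<forall>i j. a $ i $ j > 0)"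

definition spec_rad :: "real^'d^'d \<Rightarrow> real" where
  "spec_rad a = Max {cmod z | z. det (mat z - (\<chi> i j. complex_of_real (a $ i $ j))) = 0}"

text \<open>Perron-Frobenius right eigenvector normalised by |v| = 1 (meaningful for a > 0).\<close>
definition perron_vec :: "real^'d^'d \<Rightarrow> real^'d" where
  "perron_vec a = (THE v. nonneg_vec v \<and> l1norm v = 1 \<and> a *v v = spec_rad a *\<^sub>R v)"

fun mprod :: "(real^'d^'d) list \<Rightarrow> real^'d^'d" where
  "mprod [] = mat 1"
| "mprod (x # xs) = x ** mprod xs"

definition supp_measure :: "'a::topological_space measure \<Rightarrow> 'a set" where
  "supp_measure \<nu> = {x. \<forall>S. open S \<longrightarrow> x \<in> S \<longrightarrow> emeasure \<nu> S > 0}"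

definition numN :: "('w \<Rightarrow> nat \<Rightarrow> real^'d^'d) \<Rightarrow> 'w \<Rightarrow> nat" where
  "numN A \<omega> = card {i. A \<omega> i \<noteq> 0}"

definition mu_meas :: "'w measure \<Rightarrow> ('w \<Rightarrow> nat \<Rightarrow> real^'d^'d) \<Rightarrow> (real^'d^'d) measure" where
  "mu_meas M A = measure_of UNIV (sets borel)
     (\<lambda>S. (\<integral>\<^sup>+\<omega>. of_nat (card {i. i < numN A \<omega> \<and> A \<omega> i \<in> S}) \<partial>M)
          / (\<integral>\<^sup>+\<omega>. of_nat (numN A \<omega>) \<partial>M))"

inductive_set semigrp :: "(real^'d^'d) set \<Rightarrow> (real^'d^'d) set" for S where
  one: "mat 1 \<in> semigrp S"
| mult: "a \<in> semigrp S \<Longrightarrow> b \<in> S \<Longrightarrow> a ** b \<in> semigrp S"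

text \<open>Ulam-Harris tree: words are nat lists (letter k stands for k+1 in N* ).\<close>
definition cover_set :: "nat list set \<Rightarrow> bool" where
  "cover_set U \<longleftrightarrow> (\<forall>u::nat \<Rightarrow> nat. \<exists>!k. map u [0..<k] \<in> U)"

definition finite_level :: "nat list set \<Rightarrow> bool" where
  "finite_level U \<longleftrightarrow> (\<exists>L. \<forall>u\<in>U. length u \<le> L)"

text \<open>For a realization a (a v i is the (i+1)-st matrix at node v), the weight of the word u is
  a_{u|1} ... a_{u||u|}, where a_{u|(k+1)} = a (u|k) (u!k).\<close>
definition weight :: "(nat list \<Rightarrow> nat \<Rightarrow> real^'d^'d) \<Rightarrow> nat list \<Rightarrow> real^'d^'d" where
  "weight a u = mprod (map (\<lambda>k. a (take k u) (u ! k)) [0..<length u])"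

definition gsum :: "(nat list \<Rightarrow> nat \<Rightarrow> real^'d^'d) \<Rightarrow> nat list set \<Rightarrow> real^'d^'d" where
  "gsum a V = infsum (weight a) V"

definition cone_sum :: "(real^'d) set \<Rightarrow> (real^'d) set" where
  "cone_sum W = {\<Sum>w\<in>F. s w *\<^sub>R w | F s. finite F \<and> F \<subseteq> W \<and> (\<forall>w\<in>F. s w \<ge> 0)}"

definition I_mu :: "(real^'d^'d) measure \<Rightarrow> real set" where
  "I_mu \<mu> = {s. s \<ge> 0 \<and> (\<integral>\<^sup>+a. ennreal (norm a powr s) \<partial>\<mu>) < \<infinity>}"

definition kappa :: "(real^'d^'d) measure \<Rightarrow> real \<Rightarrow> real" where
  "kappa \<mu> s = lim (\<lambda>n. (\<integral>m. norm (mprod (map m (rev [0..<n]))) powr s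
                              \<partial>(PiM {..<n} (\<lambda>_. \<mu>))) powr (1 / real n))"

definition Lambda_set :: "(real^'d^'d) set \<Rightarrow> (real^'d) set" where
  "Lambda_set \<Gamma> = closure {perron_vec a | a. a \<in> \<Gamma> \<and> pos_mat a}"

definition H_set :: "(real^'d) set \<Rightarrow> (real^'d) set" where
  "H_set \<Lambda> = {\<Sum>i<n. s i *\<^sub>R v i | (n::nat) s v. n \<ge> 1 \<and> (\<forall>i<n. s i \<ge> 0 \<and> v i \<in> \<Lambda>)}"

definition Hd_set :: "(real^'d) set \<Rightarrow> (real^'d) set" where
  "Hd_set \<Lambda> = {\<Sum>i\<in>(UNIV::'d set). s i *\<^sub>R v i | s v. \<forall>i. s i \<ge> 0 \<and> v i \<in> \<Lambda>}"

end

theory Submission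
  imports Defs "HOL-Computational_Algebra.Polynomial"
begin

text \<open>
  Let \<open>S\<close> be the support of \<open>Z\<close>. By independence, \<open>S\<close> is mapped into itself by
  \<open>z \<mapsto> \<Sum>i<N. A\<^sub>i z\<^sub>i\<close> for almost every \<open>(A\<^sub>i)\<close>; once \<open>0 \<in> S\<close> is known, the same holds for all partial
  sums over realizations in the support and over trees of them. That \<open>0 \<in> S\<close> follows by contradiction:
  otherwise the Laplace transform of \<open>Z\<close> has a maximiser among the functionals that are at least \<open>1\<close> on
  \<open>S\<close>, and the equality case of Jensen's inequality makes some functional constant on \<open>S\<close>, which is
  incompatible with the contracting tree in (iii).

  For part 1, combining the two trees in (iii) with a step that has at least two summands yields families of
  small matrices with prescribed total size, so \<open>psi \<bullet> y\<close> for \<open>y \<in> S\<close> comes arbitrarily close to every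
  positive value; powers of \<open>g\<^sub>V\<close> then put \<open>\<real>\<^sub>+ v(g\<^sub>V)\<close> into \<open>S\<close>. Sums over several \<open>V\<close> are obtained by
  distributing long words over the different \<open>V\<close>.

  For part 2, the cone \<open>H\<close> is \<open>\<Gamma>\<close>-invariant because \<open>a v(b)\<close> is proportional to the limit of
  \<open>v(a b\<^sup>n)\<close>. Measured with the left eigenvector of \<open>E (\<Sum>i. A\<^sub>i)\<close>, the expected distance of \<open>Z\<close> from \<open>H\<close> is
  not increased by the equation and is strictly contracted near a positive matrix of \<open>\<Gamma>\<close>, so it vanishes.
\<close>

section \<open>Nonnegative vectors and matrices\<close>

text \<open>Part 1 assumes no moments of \<open>Z\<close>, so \<open>0 \<in> S\<close> is not
  reached by comparing means; bounded quantities, \<open>P (psi \<bullet> Z = 0)\<close> and Laplace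
  transforms, take their place. Once \<open>0 \<in> S\<close> holds, unwanted branches can be fed
  the vector 0, so any finite subfamily of matrices may be used alone. Realizations lie in the
  support of a random sequence for the product topology. If \<open>N\<close> is unbounded, such a
  limit may have infinitely many nonzero entries, so weights over a cover set form infinite sums:
  closed conditions are transferred through finitely many coordinates at a time, and infinite sums
  are reached from finite parts by continuity of Perron vector and spectral radius. Hitting the
  values of a single functional suffices for whole rays because a high power of a positive matrix
  remembers of its argument only the value under the left eigenvector. In part 2 only nonnegative
  corrections count as distance from the cone; this lets a positive matrix turn part of a correction
  into a cone vector. The finite mean makes the contraction force the value 0.\<close>

lemma nonneg_vec_iff: "nonneg_vec x \<longleftrightarrow> 0 \<le> x"
  by (simp add: nonneg_vec_def less_eq_vec_def)

lemma l1norm_nonneg [simp]: "0 \<le> l1norm x"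
  by (simp add: l1norm_def sum_nonneg)

lemma l1norm_eq_inner: "0 \<le> x \<Longrightarrow> l1norm x = 1 \<bullet> x"
  by (simp add: l1norm_def inner_vec_def less_eq_vec_def)

lemma l1norm_eq_0_iff [simp]: "l1norm x = 0 \<longleftrightarrow> x = 0"
  by (simp add: l1norm_def sum_nonneg_eq_0_iff vec_eq_iff)

lemma l1norm_0 [simp]: "l1norm 0 = 0"
  by simp

lemma l1norm_pos: "x \<noteq> 0 \<Longrightarrow> 0 < l1norm x"
  using l1norm_nonneg[of x] l1norm_eq_0_iff[of x] by linarith

lemma l1norm_scaleR [simp]: "l1norm (c *\<^sub>R x) = \<bar>c\<bar> * l1norm x"
  by (simp add: l1norm_def abs_mult sum_distrib_left)

lemma norm_le_l1norm: "norm x \<le> l1norm x"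
  by (simp add: l1norm_def norm_le_l1_cart)

lemma continuous_on_l1norm [continuous_intros]:
  "continuous_on S f \<Longrightarrow> continuous_on S (\<lambda>x. l1norm (f x))"
  unfolding l1norm_def by (intro continuous_intros)

lemma tendsto_l1norm [tendsto_intros]:
  "(f \<longlongrightarrow> x) F \<Longrightarrow> ((\<lambda>y. l1norm (f y)) \<longlongrightarrow> l1norm x) F"
  unfolding l1norm_def by (intro tendsto_intros)

lemma inner_vec_nonneg: "0 \<le> (x::real^'d) \<Longrightarrow> 0 \<le> y \<Longrightarrow> 0 \<le> x \<bullet> y"
  by (auto simp: inner_vec_def less_eq_vec_def intro!: sum_nonneg)

lemma inner_vec_mono: "0 \<le> (x::real^'d) \<Longrightarrow> y \<le> z \<Longrightarrow> x \<bullet> y \<le> x \<bullet> z"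
  using inner_vec_nonneg[of x "z - y"] by (simp add: inner_diff_right)

lemma inner_vec_pos:
  assumes "\<And>i. 0 < (x::real^'d) $ i" "0 \<le> y" "y \<noteq> 0"
  shows "0 < x \<bullet> y"
proof -
  obtain j where "y $ j \<noteq> 0" using assms(3) by (auto simp: vec_eq_iff)
  then have "0 < y $ j" using assms(2) by (metis less_eq_vec_def order_le_less zero_index)
  then have "0 < x $ j * y $ j" using assms(1) by simp
  also have "\<dots> \<le> (\<Sum>i\<in>UNIV. x $ i * y $ i)"
    using assms(1,2) by (intro member_le_sum mult_nonneg_nonneg) (auto simp: less_eq_vec_def intro: less_imp_le)
  finally show ?thesis by (simp add: inner_vec_def)
qed

lemma inner_vec_pos_iff:
  assumes "0 \<le> (x::real^'d)" "\<And>i. 0 < y $ i"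
  shows "0 < x \<bullet> y \<longleftrightarrow> x \<noteq> 0"
  using inner_vec_pos[of y x] assms by (auto simp: inner_commute)

lemma pos_vec_dominates:
  assumes "\<And>i. 0 < (v::real^'d) $ i"
  obtains t where "t > 0" "x \<le> t *\<^sub>R v"
proof
  define t where "t = (\<Sum>i\<in>UNIV. \<bar>x $ i\<bar> / v $ i) + 1"
  have "0 \<le> (\<Sum>i\<in>UNIV. \<bar>x $ i\<bar> / v $ i)"
    using assms by (intro sum_nonneg divide_nonneg_nonneg) (auto intro: less_imp_le)
  then show "t > 0" by (simp add: t_def)
  show "x \<le> t *\<^sub>R v"
    unfolding less_eq_vec_def
  proof
    fix i
    have "\<bar>x $ i\<bar> / v $ i \<le> (\<Sum>i\<in>UNIV. \<bar>x $ i\<bar> / v $ i)"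
      using assms by (intro member_le_sum divide_nonneg_nonneg) (auto intro: less_imp_le)
    then have "\<bar>x $ i\<bar> / v $ i \<le> t" by (simp add: t_def)
    then have "\<bar>x $ i\<bar> \<le> t * v $ i" using assms by (simp add: pos_divide_le_eq)
    then show "x $ i \<le> (t *\<^sub>R v) $ i" by simp
  qed
qed

lemma nonneg_mat_vec: "nonneg_mat a \<Longrightarrow> 0 \<le> x \<Longrightarrow> 0 \<le> a *v x"
  by (auto simp: nonneg_mat_def less_eq_vec_def matrix_vector_mult_def intro!: sum_nonneg)

lemma nonneg_mat_vec': "nonneg_mat a \<Longrightarrow> 0 \<le> x \<Longrightarrow> 0 \<le> x v* a"
  by (auto simp: nonneg_mat_def less_eq_vec_def vector_matrix_mult_def intro!: sum_nonneg)

lemma nonneg_mat_vec_mono: "nonneg_mat a \<Longrightarrow> x \<le> y \<Longrightarrow> a *v x \<le> a *v y"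
  using nonneg_mat_vec[of a "y - x"] by (simp add: matrix_vector_mult_diff_distrib)

lemma nonneg_mat_vec_mono': "nonneg_mat (b - a) \<Longrightarrow> 0 \<le> x \<Longrightarrow> a *v x \<le> b *v x"
  using nonneg_mat_vec[of "b - a" x] by (simp add: matrix_vector_mult_diff_rdistrib)

lemma nonneg_mat_mult: "nonneg_mat a \<Longrightarrow> nonneg_mat b \<Longrightarrow> nonneg_mat (a ** b)"
  by (auto simp: nonneg_mat_def matrix_matrix_mult_def intro!: sum_nonneg)

lemma nonneg_mat_mat_1 [simp]: "nonneg_mat (mat 1)"
  by (simp add: nonneg_mat_def mat_def)

lemma nonneg_mat_sum: "(\<And>i. i \<in> I \<Longrightarrow> nonneg_mat (b i)) \<Longrightarrow> nonneg_mat (sum b I)"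
  by (auto simp: nonneg_mat_def intro!: sum_nonneg)

lemma nonneg_mat_transpose [simp]: "nonneg_mat (transpose a) \<longleftrightarrow> nonneg_mat a"
  by (auto simp: nonneg_mat_def transpose_def)

lemma pos_mat_transpose [simp]: "pos_mat (transpose a) \<longleftrightarrow> pos_mat a"
  by (auto simp: pos_mat_def transpose_def)

lemma pos_mat_imp_nonneg: "pos_mat a \<Longrightarrow> nonneg_mat a"
  by (auto simp: pos_mat_def nonneg_mat_def intro: less_imp_le)

lemma pos_mat_vec: "pos_mat a \<Longrightarrow> 0 \<le> x \<Longrightarrow> x \<noteq> 0 \<Longrightarrow> 0 < (a *v x) $ i"
  by (simp add: matrix_vector_mul_component pos_mat_def inner_vec_pos)

lemma pos_mat_mult:
  assumes "\<forall>i. \<exists>j. a $ i $ j > 0" "nonneg_mat a" "pos_mat b"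
  shows "pos_mat (a ** b)"
  unfolding pos_mat_def
proof (intro allI)
  fix i k
  obtain j where "a $ i $ j > 0" using assms(1) by auto
  then have "0 < a $ i $ j * b $ j $ k" using assms(3) by (simp add: pos_mat_def)
  also have "\<dots> \<le> (\<Sum>j\<in>UNIV. a $ i $ j * b $ j $ k)"
    using assms(2,3) by (intro member_le_sum mult_nonneg_nonneg) (auto simp: nonneg_mat_def pos_mat_def intro: less_imp_le)
  finally show "0 < (a ** b) $ i $ k" by (simp add: matrix_matrix_mult_def)
qed

lemma sum_matrix_vector_mult:
  fixes b :: "'i \<Rightarrow> real^'n^'m"
  shows "sum b I *v x = (\<Sum>i\<in>I. b i *v x)"
  by (induction I rule: infinite_finite_induct) (auto simp: matrix_vector_mult_add_rdistrib)

lemma matrix_vector_mult_sum: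
  fixes a :: "real^'n^'m"
  shows "a *v (\<Sum>i\<in>I. x i) = (\<Sum>i\<in>I. a *v x i)"
  by (induction I rule: infinite_finite_induct) (auto simp: matrix_vector_right_distrib)

lemma bounded_bilinear_matrix_vector_mult: "bounded_bilinear ((*v) :: real^'n^'m \<Rightarrow> real^'n \<Rightarrow> real^'m)"
proof -
  have "norm (a *v x) \<le> norm a * norm x * real CARD('m)" for a :: "real^'n^'m" and x :: "real^'n"
  proof -
    have "norm (a *v x) \<le> (\<Sum>i\<in>UNIV. \<bar>(a *v x) $ i\<bar>)" by (rule norm_le_l1_cart)
    also have "\<dots> \<le> (\<Sum>i\<in>(UNIV::'m set). norm a * norm x)"
    proof (rule sum_mono)
      fix i
      have "\<bar>(a *v x) $ i\<bar> \<le> norm (a $ i) * norm x"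
        by (simp add: matrix_vector_mul_component Cauchy_Schwarz_ineq2)
      also have "\<dots> \<le> norm a * norm x" by (simp add: Finite_Cartesian_Product.norm_nth_le mult_right_mono)
      finally show "\<bar>(a *v x) $ i\<bar> \<le> norm a * norm x" .
    qed
    finally show ?thesis by (simp add: mult.commute)
  qed
  then have "\<exists>K. \<forall>(a :: real^'n^'m) (x :: real^'n). norm (a *v x) \<le> norm a * norm x * K" by blast
  then show ?thesis
    by unfold_locales (auto simp: matrix_vector_mult_add_rdistrib matrix_vector_right_distrib
        matrix_vector_mult_scaleR scaleR_matrix_vector_assoc)
qed

lemmas tendsto_matrix_vector_mult [tendsto_intros] =
  bounded_bilinear.tendsto[OF bounded_bilinear_matrix_vector_mult]
lemmas continuous_on_matrix_vector_mult [continuous_intros] =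
  bounded_bilinear.continuous_on[OF bounded_bilinear_matrix_vector_mult]

lemma continuous_on_matrix_mult [continuous_intros]:
  fixes f :: "'a::topological_space \<Rightarrow> real^'n^'m" and g :: "'a \<Rightarrow> real^'k^'n"
  assumes "continuous_on S f" "continuous_on S g"
  shows "continuous_on S (\<lambda>x. f x ** g x)"
  unfolding matrix_matrix_mult_def
  by (intro continuous_on_vec_lambda continuous_intros assms)

lemma nonneg_vec_eq_Collect: "{x::real^'d. 0 \<le> x} = {x. \<forall>i. 0 \<le> x $ i}"
  by (simp add: less_eq_vec_def)

lemma closed_nonneg_vec [simp]: "closed {x::real^'d. 0 \<le> x}"
  unfolding nonneg_vec_eq_Collect by (intro closed_Collect_all closed_Collect_le continuous_intros)

lemma compact_l1_simplex: "compact {x::real^'d. 0 \<le> x \<and> l1norm x = 1}"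
proof (rule compact_eq_bounded_closed[THEN iffD2], intro conjI)
  show "bounded {x::real^'d. 0 \<le> x \<and> l1norm x = 1}"
    unfolding bounded_iff using norm_le_l1norm by (metis (mono_tags, lifting) mem_Collect_eq)
  have "closed ({x::real^'d. 0 \<le> x} \<inter> {x. l1norm x = 1})"
    by (intro closed_Int closed_nonneg_vec closed_Collect_eq continuous_intros)
  then show "closed {x::real^'d. 0 \<le> x \<and> l1norm x = 1}" by (simp add: Collect_conj_eq)
qed

section \<open>Perron--Frobenius theory for positive matrices\<close>

text \<open>Brouwer's theorem for the normalised map \<open>x \<mapsto> a x / |a x|\<close> on the
  unit simplex; \<open>nz\<close> keeps the denominator nonzero. Entries may vanish, so the lemma
  also serves the transposed mean matrix in \<open>left_harmonic\<close>.\<close>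

lemma nonneg_eigenvector:
  fixes a :: "real^'d^'d"
  assumes "nonneg_mat a" and nz: "\<And>x. 0 \<le> x \<Longrightarrow> x \<noteq> 0 \<Longrightarrow> a *v x \<noteq> 0"
  obtains v r where "0 \<le> v" "l1norm v = 1" "r > 0" "a *v v = r *\<^sub>R v"
proof -
  define D where "D = {x::real^'d. 0 \<le> x \<and> l1norm x = 1}"
  define f where "f = (\<lambda>x. (1 / l1norm (a *v x)) *\<^sub>R (a *v x))"
  have nz': "a *v x \<noteq> 0" "0 \<le> a *v x" if "x \<in> D" for x
    using that nz[of x] nonneg_mat_vec[OF assms(1), of x] unfolding D_def
    by (metis (mono_tags, lifting) l1norm_0 mem_Collect_eq zero_neq_one)+
  have "convex D"
  proof (rule convexI)
    fix x y :: "real^'d" and u v :: real assume *: "x \<in> D" "y \<in> D" "0 \<le> u" "0 \<le> v" "u + v = 1"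
    then have "0 \<le> u *\<^sub>R x + v *\<^sub>R y" by (auto simp: D_def intro!: add_nonneg_nonneg scaleR_nonneg_nonneg)
    with * show "u *\<^sub>R x + v *\<^sub>R y \<in> D"
      by (auto simp: D_def l1norm_eq_inner inner_add_right)
  qed
  moreover have "axis undefined 1 \<in> D"
    by (auto simp: D_def less_eq_vec_def axis_def l1norm_def if_distrib cong: if_cong)
  then have "D \<noteq> {}" by blast
  moreover have "continuous_on D f"
    unfolding f_def using nz' by (intro continuous_intros) auto
  moreover have "f \<in> D \<rightarrow> D"
  proof
    fix x assume x: "x \<in> D"
    then have "0 < l1norm (a *v x)" using nz' by (intro l1norm_pos)
    then show "f x \<in> D" using nz'[OF x] by (simp add: f_def D_def scaleR_nonneg_nonneg)
  qed
  ultimately obtain v where v: "v \<in> D" "f v = v"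
    using brouwer[of D f] compact_l1_simplex unfolding D_def by blast
  have "a *v v = l1norm (a *v v) *\<^sub>R f v" using nz'[OF v(1)] by (simp add: f_def)
  then have "a *v v = l1norm (a *v v) *\<^sub>R v" unfolding v(2) .
  moreover have "0 < l1norm (a *v v)" using nz'(1)[OF v(1)] by (rule l1norm_pos)
  ultimately show ?thesis using v(1) that[of v "l1norm (a *v v)"] unfolding D_def by blast
qed

text \<open>Subtract from \<open>v\<close> the largest admissible multiple of \<open>w\<close>: the difference has a zero
  coordinate, which positivity of \<open>g\<close> rules out unless the difference vanishes.\<close>

lemma pos_mat_superharmonic:
  fixes g :: "real^'d^'d"
  assumes "pos_mat g" and v: "\<And>i. 0 < v $ i" "g *v v = r *\<^sub>R v"
    and w: "0 \<le> w" "w \<noteq> 0" "r *\<^sub>R w \<le> g *v w"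
  obtains t where "t > 0" "w = t *\<^sub>R v"
proof -
  define t where "t = (MAX i. w $ i / v $ i)"
  have t: "w $ i / v $ i \<le> t" for i unfolding t_def by (rule Max_ge) auto
  have "t \<in> range (\<lambda>i. w $ i / v $ i)" unfolding t_def by (rule Max_in) auto
  then obtain j where j: "t = w $ j / v $ j" by auto
  obtain k where "w $ k \<noteq> 0" using w(2) by (auto simp: vec_eq_iff)
  then have "0 < w $ k" using w(1) by (metis less_eq_vec_def order_le_less zero_index)
  then have tpos: "t > 0" using t[of k] v(1)[of k] by (meson divide_pos_pos less_le_trans)
  define u where "u = t *\<^sub>R v - w"
  have u: "0 \<le> u" using t v(1) by (auto simp: u_def less_eq_vec_def pos_divide_le_eq)
  have uj: "u $ j = 0" using j v(1)[of j] by (simp add: u_def)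
  have "(g *v u) $ j = t * r * v $ j - (g *v w) $ j"
    using v(2) by (simp add: u_def matrix_vector_mult_diff_distrib matrix_vector_mult_scaleR)
  also have "\<dots> \<le> t * r * v $ j - r * w $ j" using w(3) by (simp add: less_eq_vec_def)
  also have "\<dots> = r * u $ j" by (simp add: u_def algebra_simps)
  finally have "\<not> 0 < (g *v u) $ j" using uj by simp
  then have "u = 0" using pos_mat_vec[OF assms(1) u] by blast
  then show ?thesis using that[of t] tpos by (simp add: u_def)
qed

text \<open>Measure \<open>x\<close> in the maximum norm weighted by \<open>v\<close>. In the row
  \<open>j\<close> where the maximum \<open>t\<close> is attained, the triangle inequality bounds
  \<open>cmod z * t * v_j\<close> by \<open>t * (a v)_j = r * t * v_j\<close>.\<close>

lemma pos_eigenvector_bounds_spectrum: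
  fixes a :: "real^'d^'d" and x :: "complex^'d"
  assumes "nonneg_mat a" and v: "\<And>i. 0 < v $ i" "a *v v = r *\<^sub>R v"
    and x: "x \<noteq> 0" "(\<chi> i j. complex_of_real (a $ i $ j)) *v x = z *s x"
  shows "cmod z \<le> r"
proof -
  define t where "t = (MAX i. cmod (x $ i) / v $ i)"
  have t: "cmod (x $ i) \<le> t * v $ i" for i
  proof -
    have "cmod (x $ i) / v $ i \<le> t" unfolding t_def by (rule Max_ge) auto
    then show ?thesis using v(1) by (simp add: pos_divide_le_eq)
  qed
  have "t \<in> range (\<lambda>i. cmod (x $ i) / v $ i)" unfolding t_def by (rule Max_in) auto
  then obtain j where j: "t = cmod (x $ j) / v $ j" by auto
  obtain k where "x $ k \<noteq> 0" using x(1) by (auto simp: vec_eq_iff)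
  then have "t * v $ k > 0" using t[of k] by (smt (verit) zero_less_norm_iff)
  then have tpos: "t > 0" using v(1)[of k] by (simp add: zero_less_mult_iff)
  have "cmod z * (t * v $ j) = cmod ((z *s x) $ j)" using j v(1)[of j] by (simp add: norm_mult)
  also have "\<dots> = cmod (\<Sum>i\<in>UNIV. complex_of_real (a $ j $ i) * x $ i)"
    by (simp add: x(2)[symmetric] matrix_vector_mult_def)
  also have "\<dots> \<le> (\<Sum>i\<in>UNIV. a $ j $ i * (t * v $ i))"
  proof (rule sum_norm_le)
    fix i show "cmod (complex_of_real (a $ j $ i) * x $ i) \<le> a $ j $ i * (t * v $ i)"
      using assms(1) t[of i] by (simp add: norm_mult nonneg_mat_def mult_left_mono)
  qed
  also have "\<dots> = t * (a *v v) $ j"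
    by (simp add: matrix_vector_mult_def sum_distrib_left mult_ac)
  also have "\<dots> = r * (t * v $ j)" by (simp add: v(2))
  finally show ?thesis using tpos v(1)[of j] by (simp add: mult_le_cancel_right)
qed

text \<open>\<open>spec_rad\<close> is a \<open>Max\<close>, which is meaningful only over a finite
  set. \<open>p\<close> is the characteristic polynomial in Leibniz form; the bound on the
  eigenvalues supplies a point, \<open>|r| + 1\<close>, where it does not vanish.\<close>

lemma finite_eigenvalues:
  fixes a :: "complex^'d^'d"
  assumes "\<And>z. det (mat z - a) = 0 \<Longrightarrow> cmod z \<le> r"
  shows "finite {z. det (mat z - a) = 0}"
proof -
  define p where "p = (\<Sum>q\<in>{q. q permutes (UNIV::'d set)}. of_int (sign q) *
      (\<Prod>i\<in>UNIV. [:- (a $ i $ q i), if i = q i then 1 else 0:]))"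
  have p: "poly p z = det (mat z - a)" for z
    unfolding p_def det_def poly_sum poly_mult poly_prod
    by (intro sum.cong arg_cong2[where f = "(*)"] prod.cong) (auto simp: mat_def)
  have "poly p (complex_of_real (\<bar>r\<bar> + 1)) \<noteq> 0"
    using assms[of "complex_of_real (\<bar>r\<bar> + 1)"] unfolding p by (auto simp del: of_real_add)
  then have "p \<noteq> 0" by auto
  then show ?thesis using poly_roots_finite[of p] by (simp add: p)
qed

lemma det_eq_0_iff_kernel: "det (a :: 'a::field^'d^'d) = 0 \<longleftrightarrow> (\<exists>x. x \<noteq> 0 \<and> a *v x = 0)"
proof -
  have "det a \<noteq> 0 \<longleftrightarrow> inj ((*v) a)"
    by (simp add: invertible_det_nz[symmetric] matrix_left_invertible_injective invertible_left_inverse)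
  also have "\<dots> \<longleftrightarrow> (\<forall>x. a *v x = 0 \<longrightarrow> x = 0)"
    using matrix_left_invertible_injective[of a] matrix_left_invertible_ker[of a] by metis
  finally show ?thesis by blast
qed

text \<open>Recognises Perron roots: a positive eigenvector bounds all complex eigenvalues by its
  own eigenvalue, which is itself one of them.\<close>

lemma spec_rad_eqI:
  fixes a :: "real^'d^'d"
  assumes "nonneg_mat a" "\<And>i. 0 < v $ i" "a *v v = r *\<^sub>R v"
  shows "spec_rad a = r"
proof -
  let ?a = "\<chi> i j. complex_of_real (a $ i $ j)"
  have kernel: "det (mat z - ?a) = 0 \<longleftrightarrow> (\<exists>x. x \<noteq> 0 \<and> ?a *v x = z *s x)" for z
  proof -
    have "(mat z - ?a) *v x = z *s x - ?a *v x" for x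
      by (simp add: vec_eq_iff matrix_vector_mult_def mat_def left_diff_distrib sum_subtractf
          if_distrib[of "\<lambda>u. u * _"] cong: if_cong)
    then show ?thesis by (simp add: det_eq_0_iff_kernel) metis
  qed
  have le: "cmod z \<le> r" if "det (mat z - ?a) = 0" for z
    using that pos_eigenvector_bounds_spectrum[OF assms] unfolding kernel by blast
  let ?w = "\<chi> i. complex_of_real (v $ i)"
  have "?a *v ?w = complex_of_real r *s ?w"
  proof -
    have "(\<Sum>j\<in>UNIV. a $ i $ j * v $ j) = r * v $ i" for i
      using arg_cong[OF assms(3), of "\<lambda>x. x $ i"] by (simp add: matrix_vector_mult_def)
    then show ?thesis
      by (simp add: vec_eq_iff matrix_vector_mult_def flip: of_real_mult of_real_sum)
  qed
  moreover have "?w \<noteq> 0" using assms(2) by (simp add: vec_eq_iff) (metis less_irrefl)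
  ultimately have root: "det (mat (complex_of_real r) - ?a) = 0" unfolding kernel by blast
  \<comment> \<open>Any coordinate will do; it shows \<open>0 \<le> r\<close>, so that
    \<open>r\<close> is its own modulus.\<close>
  obtain i :: 'd where True by simp
  have "0 \<le> (a *v v) $ i"
    using nonneg_mat_vec[OF assms(1), of v] assms(2) by (auto simp: less_eq_vec_def intro: less_imp_le)
  then have "0 \<le> r" using assms(2)[of i] by (simp add: assms(3) zero_le_mult_iff)
  show ?thesis unfolding spec_rad_def
  proof (rule Max_eqI)
    show "finite {cmod z |z. det (mat z - ?a) = 0}"
    proof -
      have "finite {z. det (mat z - ?a) = 0}" by (rule finite_eigenvalues) (rule le)
      then show ?thesis by (simp add: setcompr_eq_image)
    qed
    show "r \<in> {cmod z |z. det (mat z - ?a) = 0}"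
      using root \<open>0 \<le> r\<close> by (auto intro!: exI[of _ "complex_of_real r"])
  qed (use le in auto)
qed

text \<open>Existence comes from \<open>nonneg_eigenvector\<close>, uniqueness from
  \<open>pos_mat_superharmonic\<close>. In the uniqueness clause \<open>s\<close> is arbitrary: a
  nonnegative eigenvector of a positive matrix is automatically positive, hence \<open>s\<close> is
  the spectral radius.\<close>

lemma perron_vec_props:
  fixes g :: "real^'d^'d"
  assumes "pos_mat g"
  shows perron_vec_pos: "0 < perron_vec g $ i"
    and l1norm_perron_vec: "l1norm (perron_vec g) = 1"
    and perron_vec_eigen: "g *v perron_vec g = spec_rad g *\<^sub>R perron_vec g"
    and spec_rad_pos: "spec_rad g > 0"
    and perron_vec_unique: "0 \<le> u \<Longrightarrow> l1norm u = 1 \<Longrightarrow> g *v u = s *\<^sub>R u \<Longrightarrow> u = perron_vec g"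
proof -
  have posvec: "g *v x \<noteq> 0" if "0 \<le> x" "x \<noteq> 0" for x
    using pos_mat_vec[OF assms that] by (metis less_irrefl zero_index)
  have pos: "0 < u $ i" "s > 0" if "0 \<le> u" "l1norm u = 1" "g *v u = s *\<^sub>R u" for u s i
  proof -
    have u: "u \<noteq> 0" using that(2) by (metis l1norm_eq_0_iff zero_neq_one)
    have *: "0 < s * u $ i" for i using pos_mat_vec[OF assms that(1) u, of i] that(3) by simp
    obtain k :: 'd where True by simp
    have "0 \<le> u $ i" for i using that(1) by (simp add: less_eq_vec_def)
    then show "0 < u $ i" "s > 0" using *[of i] *[of k] by (smt (verit) zero_less_mult_iff)+
  qed
  have ng: "nonneg_mat g" using assms by (rule pos_mat_imp_nonneg)
  obtain v r where v: "0 \<le> v" "l1norm v = 1" "r > 0" "g *v v = r *\<^sub>R v"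
    using nonneg_eigenvector[OF ng posvec] by blast
  have r: "spec_rad g = r" using spec_rad_eqI[OF ng pos(1)[OF v(1,2,4)] v(4)] .
  have uniq: "u = v" if u: "0 \<le> u" "l1norm u = 1" "g *v u = s *\<^sub>R u" for u s
  proof -
    have "spec_rad g = s" using spec_rad_eqI[OF ng pos(1)[OF u] u(3)] .
    then have "r *\<^sub>R u \<le> g *v u" "u \<noteq> 0" using u r by auto
    then obtain t where "t > 0" "u = t *\<^sub>R v"
      using pos_mat_superharmonic[OF assms pos(1)[OF v(1,2,4)] v(4) u(1)] by blast
    with u(2) v(2) show ?thesis by simp
  qed
  have pv: "perron_vec g = v"
    unfolding perron_vec_def nonneg_vec_iff r
  proof (rule the_equality)
    show "0 \<le> v \<and> l1norm v = 1 \<and> g *v v = r *\<^sub>R v" using v by simp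
    show "u = v" if "0 \<le> u \<and> l1norm u = 1 \<and> g *v u = r *\<^sub>R u" for u
      using uniq[of u r] that by simp
  qed
  show "0 < perron_vec g $ i" "l1norm (perron_vec g) = 1"
    "g *v perron_vec g = spec_rad g *\<^sub>R perron_vec g" "spec_rad g > 0"
    using v r pos(1)[OF v(1,2,4)] unfolding pv by auto
  show "u = perron_vec g" if "0 \<le> u" "l1norm u = 1" "g *v u = s *\<^sub>R u"
    using uniq[OF that] pv by simp
qed

lemma perron_vec_nonneg: "pos_mat g \<Longrightarrow> 0 \<le> perron_vec g"
  by (simp add: less_eq_vec_def perron_vec_pos less_imp_le)

lemma spec_rad_eq_l1norm: "pos_mat g \<Longrightarrow> spec_rad g = l1norm (g *v perron_vec g)"
  using spec_rad_pos[of g] by (simp add: perron_vec_eigen l1norm_perron_vec)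

text \<open>The Perron vector of the transpose, rescaled. Evaluating \<open>k g v\<close> from both
  sides, with \<open>k \<bullet> v > 0\<close>, shows that \<open>g\<close> and its transpose have
  the same spectral radius.\<close>

lemma left_perron_vec:
  fixes g :: "real^'d^'d"
  assumes "pos_mat g"
  obtains l where "\<And>i. 0 < l $ i" "l v* g = spec_rad g *\<^sub>R l" "l \<bullet> perron_vec g = 1"
proof -
  have pt: "pos_mat (transpose g)" using assms by simp
  let ?v = "perron_vec g"
  define k where "k = perron_vec (transpose g)"
  have k: "\<And>i. 0 < k $ i" "k v* g = spec_rad (transpose g) *\<^sub>R k"
    using perron_vec_pos[OF pt] perron_vec_eigen[OF pt] by (auto simp: k_def)
  have "?v \<noteq> 0" using l1norm_perron_vec[OF assms] by (metis l1norm_eq_0_iff zero_neq_one)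
  then have kv: "0 < k \<bullet> ?v" by (intro inner_vec_pos k perron_vec_nonneg assms)
  have "spec_rad (transpose g) * (k \<bullet> ?v) = (k v* g) \<bullet> ?v" by (simp add: k(2))
  also have "\<dots> = spec_rad g * (k \<bullet> ?v)"
    by (simp add: dot_lmul_matrix perron_vec_eigen[OF assms])
  finally have "spec_rad (transpose g) = spec_rad g" using kv by simp
  with k kv show ?thesis
    by (intro that[of "(1 / (k \<bullet> ?v)) *\<^sub>R k"])
      (auto simp: vec_eq_iff vector_matrix_mult_def sum_divide_distrib[symmetric])
qed

text \<open>Closed graph theorem with the compact simplex as target. Writing the eigenvalue as
  \<open>l1norm (g *v v)\<close> describes the graph by a continuous equation in
  \<open>(g, v)\<close> alone, without \<open>spec_rad\<close>.\<close>

lemma perron_vec_continuous_on: "continuous_on {g :: real^'d^'d. pos_mat g} perron_vec"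
proof -
  let ?P = "{g :: real^'d^'d. pos_mat g}" and ?T = "{x::real^'d. 0 \<le> x \<and> l1norm x = 1}"
  let ?E = "{(g::real^'d^'d, v). g *v v = l1norm (g *v v) *\<^sub>R v}"
  have "(\<lambda>g. (g, perron_vec g)) ` ?P = (?P \<times> ?T) \<inter> ?E"
  proof (intro set_eqI iffI)
    fix x assume "x \<in> (\<lambda>g. (g, perron_vec g)) ` ?P"
    then show "x \<in> (?P \<times> ?T) \<inter> ?E"
      by (auto simp: perron_vec_nonneg l1norm_perron_vec simp flip: spec_rad_eq_l1norm)
         (simp add: perron_vec_eigen)
  next
    fix x assume "x \<in> (?P \<times> ?T) \<inter> ?E"
    then show "x \<in> (\<lambda>g. (g, perron_vec g)) ` ?P"
      by (auto simp: image_iff intro: perron_vec_unique)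
  qed
  moreover have "closed ?E"
    unfolding case_prod_beta by (intro closed_Collect_eq continuous_intros)
  then have "closedin (top_of_set (?P \<times> ?T)) ((?P \<times> ?T) \<inter> ?E)" by (rule closedin_closed_Int)
  moreover have "perron_vec \<in> ?P \<rightarrow> ?T" by (auto simp: perron_vec_nonneg l1norm_perron_vec)
  ultimately show ?thesis
    by (intro continuous_closed_graph_eq[OF compact_l1_simplex, THEN iffD2]) simp_all
qed

lemma open_pos_mat: "open {g :: real^'d^'d. pos_mat g}"
proof -
  have "{g :: real^'d^'d. pos_mat g} = (\<Inter>i. \<Inter>j. {g. 0 < g $ i $ j})" by (auto simp: pos_mat_def)
  then show ?thesis by (auto intro!: open_INT open_Collect_less continuous_intros)
qed

lemma tendsto_perron_vec:
  assumes "(G \<longlongrightarrow> g) F" "pos_mat g"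
  shows "((\<lambda>x. perron_vec (G x)) \<longlongrightarrow> perron_vec g) F"
  using perron_vec_continuous_on assms open_pos_mat
  by (metis continuous_on_eq_continuous_at isCont_tendsto_compose mem_Collect_eq)

lemma tendsto_spec_rad:
  assumes G: "(G \<longlongrightarrow> g) F" and g: "pos_mat g"
  shows "((\<lambda>x. spec_rad (G x)) \<longlongrightarrow> spec_rad g) F"
proof -
  have "\<forall>\<^sub>F x in F. pos_mat (G x)" using topological_tendstoD[OF G open_pos_mat] g by simp
  then have "\<forall>\<^sub>F x in F. l1norm (G x *v perron_vec (G x)) = spec_rad (G x)"
    by eventually_elim (simp add: spec_rad_eq_l1norm)
  moreover have "((\<lambda>x. l1norm (G x *v perron_vec (G x))) \<longlongrightarrow> spec_rad g) F"
    unfolding spec_rad_eq_l1norm[OF g] by (intro tendsto_intros tendsto_perron_vec G g)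
  ultimately show ?thesis by (rule Lim_transform_eventually[rotated])
qed

section \<open>Powers of positive matrices\<close>

abbreviation mpow :: "real^'d^'d \<Rightarrow> nat \<Rightarrow> real^'d^'d" where
  "mpow g n \<equiv> mprod (replicate n g)"

lemma mprod_append: "mprod (xs @ ys) = mprod xs ** mprod ys"
  by (induction xs) (auto simp: matrix_mul_assoc)

lemma mpow_Suc_right: "mpow g (Suc n) = mpow g n ** g"
  using mprod_append[of "replicate n g" "[g]"] by (simp add: replicate_append_same)

lemma nonneg_mat_mprod: "(\<And>b. b \<in> set bs \<Longrightarrow> nonneg_mat b) \<Longrightarrow> nonneg_mat (mprod bs)"
  by (induction bs) (auto intro: nonneg_mat_mult)

lemma mpow_eigen: "g *v v = r *\<^sub>R v \<Longrightarrow> mpow g n *v v = r ^ n *\<^sub>R v"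
  by (induction n) (auto simp: matrix_vector_mul_assoc[symmetric] matrix_vector_mult_scaleR mult.commute)

text \<open>With \<open>v\<close> and \<open>l\<close> the right and left eigenvectors normalised by \<open>l \<bullet> v = 1\<close>, the matrix
  \<open>g / r\<close> dominates \<open>c v l\<^sup>T\<close> for some \<open>c > 0\<close>, and the remainder multiplies \<open>l\<close> by \<open>1 - c\<close>.\<close>

lemma perron_convergence:
  fixes g :: "real^'d^'d"
  assumes g: "pos_mat g" and l: "\<And>i. 0 < l $ i" "l v* g = spec_rad g *\<^sub>R l" "l \<bullet> perron_vec g = 1"
  obtains C q where "0 \<le> q" "q < 1"
    "\<And>n y. 0 \<le> y \<Longrightarrow>
       norm (mpow g n *v y - (spec_rad g ^ n * (l \<bullet> y)) *\<^sub>R perron_vec g) \<le> C * q ^ n * (spec_rad g ^ n * (l \<bullet> y))"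
proof -
  define r v where "r = spec_rad g" and "v = perron_vec g"
  have r: "r > 0" and gv: "g *v v = r *\<^sub>R v" and vpos: "\<And>i. 0 < v $ i"
    using perron_vec_props[OF g] by (auto simp: r_def v_def)
  have gpos: "\<And>i j. 0 < g $ i $ j" using g by (simp add: pos_mat_def)
  have "\<exists>e>0. \<forall>i j. e * (v $ i * l $ j) \<le> g $ i $ j"
  proof -
    define e where "e = (MIN p. g $ fst p $ snd p / (v $ fst p * l $ snd p))"
    have "e \<in> range (\<lambda>p. g $ fst p $ snd p / (v $ fst p * l $ snd p))"
      unfolding e_def by (rule Min_in) auto
    then have "e > 0" using gpos vpos l(1) by auto
    moreover have "e * (v $ i * l $ j) \<le> g $ i $ j" for i j
    proof -
      have "e \<le> g $ i $ j / (v $ i * l $ j)"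
        unfolding e_def by (rule Min_le) (auto intro!: image_eqI[of _ _ "(i, j)"])
      then show ?thesis using vpos l(1) by (simp add: pos_le_divide_eq)
    qed
    ultimately show ?thesis by blast
  qed
  then obtain e where e: "e > 0" "\<And>i j. e * (v $ i * l $ j) \<le> g $ i $ j" by blast
  \<comment> \<open>\<open>d \<le> e\<close> keeps \<open>Q\<close> nonnegative on nonnegative
    vectors; \<open>0 < d < r\<close> puts the ratio \<open>(r - d) / r\<close> strictly between 0
    and 1.\<close>
  define d where "d = min e r / 2"
  have d: "0 < d" "d < r" "d \<le> e" using e(1) r by (auto simp: d_def)
  define Q where "Q = (\<lambda>y. g *v y - (d * (l \<bullet> y)) *\<^sub>R v)"
  have Qnn: "0 \<le> Q y" if "0 \<le> y" for y
    unfolding less_eq_vec_def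
  proof
    fix i
    have "(d * (l \<bullet> y)) * v $ i = (\<Sum>j\<in>UNIV. d * (v $ i * l $ j) * y $ j)"
      by (simp add: inner_vec_def sum_distrib_left sum_distrib_right mult_ac)
    also have "\<dots> \<le> (\<Sum>j\<in>UNIV. g $ i $ j * y $ j)"
    proof (intro sum_mono mult_right_mono)
      fix j
      have "d * (v $ i * l $ j) \<le> e * (v $ i * l $ j)"
        using d(3) vpos l(1) by (intro mult_right_mono mult_nonneg_nonneg) (auto intro: less_imp_le)
      also have "\<dots> \<le> g $ i $ j" by (rule e(2))
      finally show "d * (v $ i * l $ j) \<le> g $ i $ j" .
      show "0 \<le> y $ j" using that by (simp add: less_eq_vec_def)
    qed
    finally show "(0::real^'d) $ i \<le> Q y $ i" by (simp add: Q_def matrix_vector_mult_def)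
  qed
  have lQ: "l \<bullet> Q y = (r - d) * (l \<bullet> y)" for y
  proof -
    have "l \<bullet> (g *v y) = r * (l \<bullet> y)" using l(2) by (simp add: dot_lmul_matrix[symmetric] r_def)
    then show ?thesis using l(3) by (simp add: Q_def inner_diff_right v_def algebra_simps)
  qed
  \<comment> \<open>Each step moves the share \<open>d / r\<close> of the remaining mass, measured
    by \<open>l\<close>, onto the ray of \<open>v\<close>.\<close>
  have iter: "0 \<le> (Q ^^ n) y \<and> l \<bullet> (Q ^^ n) y = (r - d) ^ n * (l \<bullet> y) \<and>
      mpow g n *v y = ((r ^ n - (r - d) ^ n) * (l \<bullet> y)) *\<^sub>R v + (Q ^^ n) y" if "0 \<le> y" for n y
  proof (induction n)
    case (Suc n)
    have "mpow g (Suc n) *v y = g *v (((r ^ n - (r - d) ^ n) * (l \<bullet> y)) *\<^sub>R v + (Q ^^ n) y)"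
      using Suc by (simp add: matrix_vector_mul_assoc[symmetric])
    also have "\<dots> = ((r ^ n - (r - d) ^ n) * (l \<bullet> y) * r) *\<^sub>R v + g *v (Q ^^ n) y"
      by (simp add: matrix_vector_right_distrib matrix_vector_mult_scaleR gv)
    also have "g *v (Q ^^ n) y = (d * ((r - d) ^ n * (l \<bullet> y))) *\<^sub>R v + (Q ^^ Suc n) y"
      using Suc by (simp add: Q_def)
    also have "((r ^ n - (r - d) ^ n) * (l \<bullet> y) * r) *\<^sub>R v + ((d * ((r - d) ^ n * (l \<bullet> y))) *\<^sub>R v + (Q ^^ Suc n) y)
        = ((r ^ Suc n - (r - d) ^ Suc n) * (l \<bullet> y)) *\<^sub>R v + (Q ^^ Suc n) y"
      by (simp add: algebra_simps flip: scaleR_add_left)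
    finally have "mpow g (Suc n) *v y = ((r ^ Suc n - (r - d) ^ Suc n) * (l \<bullet> y)) *\<^sub>R v + (Q ^^ Suc n) y" .
    then show ?case using Suc Qnn lQ by auto
  qed (use that in auto)
  define m where "m = (MIN i. l $ i)"
  have "m \<in> range (($) l)" unfolding m_def by (rule Min_in) auto
  then have m: "m > 0" using l(1) by auto
  have mle: "m \<le> l $ i" for i unfolding m_def by (rule Min_le) auto
  have normle: "norm x \<le> (l \<bullet> x) / m" if "0 \<le> x" for x
  proof -
    have "m * l1norm x \<le> l \<bullet> x"
      using that mle by (simp add: l1norm_def inner_vec_def sum_distrib_left less_eq_vec_def)
        (intro sum_mono mult_right_mono, auto)
    then have "l1norm x \<le> (l \<bullet> x) / m" using m by (simp add: pos_le_divide_eq mult.commute)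
    then show ?thesis using norm_le_l1norm[of x] by linarith
  qed
  show ?thesis
  proof (rule that[of "(r - d) / r" "norm v + 1 / m"])
    show "0 \<le> (r - d) / r" "(r - d) / r < 1" using d r by (auto simp: divide_simps)
    fix n and y :: "real^'d" assume y: "0 \<le> y"
    have ly: "0 \<le> l \<bullet> y" using y l(1) by (intro inner_vec_nonneg) (auto simp: less_eq_vec_def intro: less_imp_le)
    have "mpow g n *v y - (r ^ n * (l \<bullet> y)) *\<^sub>R v = (Q ^^ n) y - ((r - d) ^ n * (l \<bullet> y)) *\<^sub>R v"
      using iter[OF y, of n] by (simp add: algebra_simps)
    also have "norm \<dots> \<le> norm ((Q ^^ n) y) + (r - d) ^ n * (l \<bullet> y) * norm v"
      using d ly by (intro order.trans[OF norm_triangle_ineq4]) (simp add: abs_mult)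
    also have "norm ((Q ^^ n) y) \<le> ((r - d) ^ n * (l \<bullet> y)) / m"
      using iter[OF y, of n] normle[of "(Q ^^ n) y"] by simp
    also have "((r - d) ^ n * (l \<bullet> y)) / m + (r - d) ^ n * (l \<bullet> y) * norm v
        = (norm v + 1 / m) * ((r - d) / r) ^ n * (r ^ n * (l \<bullet> y))"
      using r by (simp add: power_divide field_simps)
    finally show "norm (mpow g n *v y - (spec_rad g ^ n * (l \<bullet> y)) *\<^sub>R perron_vec g)
        \<le> (norm v + 1 / m) * ((r - d) / r) ^ n * (spec_rad g ^ n * (l \<bullet> y))"
      by (simp add: r_def v_def)
  qed
qed

text \<open>The error in \<open>perron_convergence\<close> is relative to
  \<open>r ^ n * (l \<bullet> y)\<close>, so the starting vector may change with \<open>n\<close> as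
  long as this product converges.\<close>

lemma perron_limit:
  fixes g :: "real^'d^'d"
  assumes g: "pos_mat g" and l: "\<And>i. 0 < l $ i" "l v* g = spec_rad g *\<^sub>R l" "l \<bullet> perron_vec g = 1"
    and y: "\<And>n. 0 \<le> y n" "(\<lambda>n. spec_rad g ^ n * (l \<bullet> y n)) \<longlonglongrightarrow> s"
  shows "(\<lambda>n. mpow g n *v y n) \<longlonglongrightarrow> s *\<^sub>R perron_vec g"
proof -
  obtain C q where q: "0 \<le> q" "q < 1" and bound: "\<And>n y. 0 \<le> y \<Longrightarrow>
       norm (mpow g n *v y - (spec_rad g ^ n * (l \<bullet> y)) *\<^sub>R perron_vec g) \<le> C * q ^ n * (spec_rad g ^ n * (l \<bullet> y))"
    using perron_convergence[OF g l] by metis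
  have "(\<lambda>n. C * q ^ n * (spec_rad g ^ n * (l \<bullet> y n))) \<longlonglongrightarrow> C * 0 * s"
    using q by (intro tendsto_intros y LIMSEQ_power_zero) auto
  then have "(\<lambda>n. mpow g n *v y n - (spec_rad g ^ n * (l \<bullet> y n)) *\<^sub>R perron_vec g) \<longlonglongrightarrow> 0"
    unfolding mult_zero_right mult_zero_left by (rule Lim_null_comparison[OF always_eventually[OF allI[OF bound[OF y(1)]]]])
  from tendsto_add[OF this tendsto_scaleR[OF y(2) tendsto_const[of "perron_vec g"]]] show ?thesis by simp
qed

text \<open>By \<open>h v \<le> g v = r v\<close> the rescaled vectors decrease, so they converge to
  some \<open>w\<close> with \<open>r w = h w \<le> g w\<close>. By
  \<open>pos_mat_superharmonic\<close> a nonzero \<open>w\<close> would be a multiple of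
  \<open>v\<close>, giving \<open>(g - h) v = 0\<close> and, as \<open>v\<close> is positive,
  \<open>g = h\<close>.\<close>

lemma submatrix_power_negligible:
  fixes g h :: "real^'d^'d"
  assumes g: "pos_mat g" and h: "nonneg_mat h" "nonneg_mat (g - h)" "g \<noteq> h"
  shows "(\<lambda>n. (1 / spec_rad g ^ n) *\<^sub>R (mpow h n *v perron_vec g)) \<longlonglongrightarrow> 0"
proof -
  define r v where "r = spec_rad g" and "v = perron_vec g"
  define x where "x = (\<lambda>n. (1 / r ^ n) *\<^sub>R (mpow h n *v v))"
  have r: "r > 0" and gv: "g *v v = r *\<^sub>R v" and vpos: "\<And>i. 0 < v $ i"
    using perron_vec_props[OF g] by (auto simp: r_def v_def)
  have v0: "0 \<le> v" "v \<noteq> 0"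
    using perron_vec_nonneg[OF g] l1norm_perron_vec[OF g] by (auto simp: v_def)
  have hv: "h *v v \<le> r *\<^sub>R v" using nonneg_mat_vec_mono'[OF h(2) v0(1)] gv by simp
  have xnn: "0 \<le> x n" for n
    unfolding x_def using r by (intro scaleR_nonneg_nonneg nonneg_mat_vec nonneg_mat_mprod v0) (auto simp: h)
  have xSuc: "x (Suc n) = (1 / r) *\<^sub>R (h *v x n)" for n
    by (simp add: x_def matrix_vector_mul_assoc[symmetric] matrix_vector_mult_scaleR)
  have xdec: "x (Suc n) \<le> x n" for n
  proof -
    have "mpow h n *v (h *v v) \<le> mpow h n *v (r *\<^sub>R v)"
      by (intro nonneg_mat_vec_mono nonneg_mat_mprod hv) (auto simp: h)
    then have "(1 / r ^ Suc n) *\<^sub>R (mpow h n *v (h *v v)) \<le> (1 / r ^ Suc n) *\<^sub>R (mpow h n *v (r *\<^sub>R v))"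
      using r by (intro scaleR_left_mono) auto
    then show ?thesis
      using r by (simp only: x_def mpow_Suc_right matrix_vector_mul_assoc[symmetric])
        (simp add: matrix_vector_mult_scaleR)
  qed
  have "\<exists>w. x \<longlonglongrightarrow> w"
  proof -
    have "convergent (\<lambda>n. x n $ i)" for i
    proof (rule Bseq_monoseq_convergent)
      have "decseq (\<lambda>n. x n $ i)" using xdec by (intro decseq_SucI) (auto simp: less_eq_vec_def)
      then show "monoseq (\<lambda>n. x n $ i)" by (rule decseq_imp_monoseq)
      show "Bseq (\<lambda>n. x n $ i)"
        using \<open>decseq (\<lambda>n. x n $ i)\<close> xnn
        by (intro decseq_bounded[of _ 0]) (auto simp: less_eq_vec_def)
    qed
    then have "\<forall>i. \<exists>l. (\<lambda>n. x n $ i) \<longlonglongrightarrow> l" by (simp add: convergent_def)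
    then obtain l where "\<And>i. (\<lambda>n. x n $ i) \<longlonglongrightarrow> l i" by metis
    then have "x \<longlonglongrightarrow> (\<chi> i. l i)" by (intro vec_tendstoI) simp
    then show ?thesis by blast
  qed
  then obtain w where w: "x \<longlonglongrightarrow> w" by blast
  have hw: "h *v w = r *\<^sub>R w"
  proof -
    have "(\<lambda>n. (1 / r) *\<^sub>R (h *v x n)) \<longlonglongrightarrow> (1 / r) *\<^sub>R (h *v w)" by (intro tendsto_intros w)
    moreover have "(\<lambda>n. (1 / r) *\<^sub>R (h *v x n)) \<longlonglongrightarrow> w"
      using LIMSEQ_Suc[OF w] unfolding xSuc .
    ultimately have "(1 / r) *\<^sub>R (h *v w) = w" by (rule LIMSEQ_unique)
    then have "r *\<^sub>R ((1 / r) *\<^sub>R (h *v w)) = r *\<^sub>R w" by simp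
    then show ?thesis using r by simp
  qed
  have wnn: "0 \<le> w" using closed_sequentially[OF closed_nonneg_vec _ w] xnn by simp
  have "w = 0"
  proof (rule ccontr)
    assume "w \<noteq> 0"
    moreover have "r *\<^sub>R w \<le> g *v w" using nonneg_mat_vec_mono'[OF h(2) wnn] hw by simp
    ultimately obtain t where t: "t > 0" "w = t *\<^sub>R v"
      using pos_mat_superharmonic[OF g vpos gv wnn] by blast
    then have "t *\<^sub>R (h *v v) = t *\<^sub>R (r *\<^sub>R v)"
      using hw by (simp add: matrix_vector_mult_scaleR mult.commute)
    then have "h *v v = r *\<^sub>R v" using t(1) by (metis real_vector.scale_left_imp_eq less_irrefl)
    then have "(g - h) *v v = 0" using gv by (simp add: matrix_vector_mult_diff_rdistrib)
    then have "(g - h) $ i \<bullet> v = 0" for i by (metis matrix_vector_mul_component zero_index)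
    moreover have "0 \<le> (g - h) $ i" for i using h(2) by (simp add: nonneg_mat_def less_eq_vec_def)
    ultimately have "(g - h) $ i = 0" for i
      using inner_vec_pos[OF vpos, of "(g - h) $ i"] by (metis inner_commute less_irrefl)
    then have "g - h = 0" by (simp add: vec_eq_iff)
    with h(3) show False by simp
  qed
  then show ?thesis using w unfolding x_def r_def v_def by simp
qed

section \<open>Admissible families\<close>

text \<open>Every matrix of the family gets its own vector: this is what independence of the copies
  leaves behind once only supports are considered.\<close>

definition admissible :: "(real^'d) set \<Rightarrow> 'i set \<Rightarrow> ('i \<Rightarrow> real^'d^'d) \<Rightarrow> bool" where
  "admissible S I b \<longleftrightarrow> finite I \<and> (\<forall>z. (\<forall>i\<in>I. z i \<in> S) \<longrightarrow> (\<Sum>i\<in>I. b i *v z i) \<in> S)"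

lemma admissibleD: "admissible S I b \<Longrightarrow> (\<And>i. i \<in> I \<Longrightarrow> z i \<in> S) \<Longrightarrow> (\<Sum>i\<in>I. b i *v z i) \<in> S"
  by (simp add: admissible_def)

lemma admissible_sum_vec: "admissible S I b \<Longrightarrow> z \<in> S \<Longrightarrow> sum b I *v z \<in> S"
  using admissibleD[of S I b "\<lambda>_. z"] by (simp add: sum_matrix_vector_mult)

lemma admissible_mpow_vec: "admissible S I b \<Longrightarrow> z \<in> S \<Longrightarrow> mpow (sum b I) n *v z \<in> S"
  by (induction n) (auto simp: matrix_vector_mul_assoc[symmetric] intro: admissible_sum_vec)

text \<open>The indices outside \<open>J\<close> are fed the vector 0; this is why
  \<open>0 \<in> S\<close> has to come first.\<close>

lemma admissible_subset:
  assumes "admissible S I b" "0 \<in> S" "J \<subseteq> I"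
  shows "admissible S J b"
  unfolding admissible_def
proof (intro conjI allI impI)
  have fin: "finite I" using assms(1) by (simp add: admissible_def)
  then show "finite J" using assms(3) finite_subset by blast
  fix z assume z: "\<forall>i\<in>J. z i \<in> S"
  define z' where "z' = (\<lambda>i. if i \<in> J then z i else 0)"
  have "(\<Sum>i\<in>I. b i *v z' i) \<in> S"
    by (rule admissibleD[OF assms(1)]) (use z assms(2) in \<open>auto simp: z'_def\<close>)
  also have "(\<Sum>i\<in>I. b i *v z' i) = (\<Sum>i\<in>J. b i *v z i)"
    using fin assms(3) by (intro sum.mono_neutral_cong_right) (auto simp: z'_def)
  finally show "(\<Sum>i\<in>J. b i *v z i) \<in> S" .
qed

lemma admissible_times:
  assumes "admissible S I b" "admissible S J c"
  shows "admissible S (I \<times> J) (\<lambda>p. b (fst p) ** c (snd p))"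
  unfolding admissible_def
proof (intro conjI allI impI)
  show "finite (I \<times> J)" using assms by (simp add: admissible_def)
  fix z assume z: "\<forall>p\<in>I \<times> J. z p \<in> S"
  have "(\<Sum>i\<in>I. b i *v (\<Sum>j\<in>J. c j *v z (i, j))) \<in> S"
    using z by (intro admissibleD[OF assms(1)] admissibleD[OF assms(2)]) auto
  also have "(\<Sum>i\<in>I. b i *v (\<Sum>j\<in>J. c j *v z (i, j))) = (\<Sum>p\<in>I \<times> J. (b (fst p) ** c (snd p)) *v z p)"
    by (simp add: matrix_vector_mult_sum matrix_vector_mul_assoc sum.cartesian_product case_prod_beta)
  finally show "(\<Sum>p\<in>I \<times> J. (b (fst p) ** c (snd p)) *v z p) \<in> S" .
qed

section \<open>Words over a family and powers of its sum\<close>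

definition words :: "'i set \<Rightarrow> nat \<Rightarrow> 'i list set" where
  "words I n = {xs. set xs \<subseteq> I \<and> length xs = n}"

lemma finite_words: "finite I \<Longrightarrow> finite (words I n)"
  unfolding words_def by (rule finite_lists_length_eq)

lemma words_0 [simp]: "words I 0 = {[]}"
  by (auto simp: words_def)

lemma words_Int: "words I n \<inter> words J n = words (I \<inter> J) n"
  by (auto simp: words_def)

lemma words_mono: "I \<subseteq> J \<Longrightarrow> words I n \<subseteq> words J n"
  by (auto simp: words_def)

lemma sum_words_Suc:
  fixes f :: "'i list \<Rightarrow> 'a::comm_monoid_add"
  shows "(\<Sum>xs\<in>words I (Suc n). f xs) = (\<Sum>i\<in>I. \<Sum>xs\<in>words I n. f (i # xs))"
proof -
  have "(\<Sum>xs\<in>words I (Suc n). f xs) = (\<Sum>p\<in>I \<times> words I n. f (fst p # snd p))"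
    by (rule sum.reindex_bij_witness[where i = "\<lambda>p. fst p # snd p" and j = "\<lambda>xs. (hd xs, tl xs)"])
      (auto simp: words_def length_Suc_conv)
  then show ?thesis by (simp add: sum.cartesian_product case_prod_beta)
qed

lemma matrix_mult_sum_right:
  fixes a :: "real^'n^'m"
  shows "a ** (\<Sum>i\<in>I. b i) = (\<Sum>i\<in>I. a ** b i)"
  by (induction I rule: infinite_finite_induct) (auto simp: matrix_add_ldistrib)

lemma matrix_mult_sum_left:
  fixes a :: "real^'n^'m"
  shows "(\<Sum>i\<in>I. b i) ** a = (\<Sum>i\<in>I. b i ** a)"
  by (simp add: vec_eq_iff matrix_matrix_mult_def sum_distrib_right) (simp add: sum.swap[of _ I])

lemma sum_words_mprod: "(\<Sum>xs\<in>words I n. mprod (map b xs)) = mpow (sum b I) n"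
  by (induction n) (simp_all add: sum_words_Suc matrix_mult_sum_right[symmetric] matrix_mult_sum_left[symmetric])

lemma sum_words_mprod_vec: "(\<Sum>xs\<in>words I n. mprod (map b xs) *v z) = mpow (sum b I) n *v z"
  by (simp add: sum_words_mprod[symmetric] sum_matrix_vector_mult)

lemma admissible_words:
  assumes "admissible S I b"
  shows "admissible S (words I n) (\<lambda>xs. mprod (map b xs))"
  unfolding admissible_def
proof (intro conjI allI impI)
  show "finite (words I n)" using assms by (simp add: admissible_def finite_words)
  show "(\<Sum>xs\<in>words I n. mprod (map b xs) *v z xs) \<in> S" if "\<forall>xs\<in>words I n. z xs \<in> S" for z
    using that
  proof (induction n arbitrary: z)
    case (Suc n)
    have "(\<Sum>i\<in>I. b i *v (\<Sum>xs\<in>words I n. mprod (map b xs) *v z (i # xs))) \<in> S"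
      using Suc.prems by (intro admissibleD[OF assms] Suc.IH) (auto simp: words_def)
    then show ?case
      by (simp add: sum_words_Suc matrix_vector_mult_sum matrix_vector_mul_assoc)
  qed simp
qed

section \<open>Families indexed by trees\<close>

lemma weight_Nil [simp]: "weight a [] = mat 1"
  by (simp add: weight_def)

lemma weight_Cons: "weight a (i # u) = a [] i ** weight (\<lambda>v. a (i # v)) u"
  by (simp add: weight_def upt_conv_Cons map_Suc_upt[symmetric] comp_def del: upt_Suc)

lemma nonneg_mat_weight:
  assumes "\<And>v i. nonneg_mat (a v i)"
  shows "nonneg_mat (weight a u)"
  using assms by (auto simp: weight_def intro!: nonneg_mat_mprod)

text \<open>Induction on the maximal length, splitting off the first letter: below the letter
  \<open>i\<close> the realization is \<open>\<lambda>v. a (i # v)\<close>. Finite antichains are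
  the right generality because finite parts of cover sets are what gets used.\<close>

lemma admissible_tree:
  assumes "0 \<in> S" and step: "\<And>a I. a \<in> A \<Longrightarrow> finite I \<Longrightarrow> admissible S I a"
    and "finite V" "\<And>u w. u \<in> V \<Longrightarrow> u @ w \<in> V \<Longrightarrow> w = []" "\<And>v. a v \<in> A"
  shows "admissible S V (weight a)"
proof -
  have "admissible S V (weight a)"
    if "finite V" "\<And>u w. u \<in> V \<Longrightarrow> u @ w \<in> V \<Longrightarrow> w = []" "\<And>v. a v \<in> A" "\<And>u. u \<in> V \<Longrightarrow> length u \<le> L"
    for V a L
    using that
  proof (induction L arbitrary: V a)
    case 0
    then have "V \<subseteq> {[]}" by auto
    then have "V = {} \<or> V = {[]}" by auto
    then show ?case using assms(1) by (auto simp: admissible_def)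
  next
    case (Suc L)
    show ?case
    proof (cases "[] \<in> V")
      case True
      then have "V = {[]}" using Suc.prems(2)[of "[]"] by auto
      then show ?thesis by (simp add: admissible_def)
    next
      case False
      define I where "I = hd ` V"
      define T where "T = (\<lambda>i. {u. i # u \<in> V})"
      have fin: "finite I" "finite (T i)" for i
        using finite_vimageI[OF Suc.prems(1), of "(#) i"] Suc.prems(1) by (auto simp: I_def T_def vimage_def inj_on_def)
      have adm: "admissible S (T i) (weight (\<lambda>v. a (i # v)))" for i
      proof (rule Suc.IH)
        show "length u \<le> L" if "u \<in> T i" for u
          using Suc.prems(4)[of "i # u"] that by (simp add: T_def)
      qed (use Suc.prems fin(2)[of i] in \<open>auto simp: T_def\<close>)
      show ?thesis unfolding admissible_def
      proof (intro conjI allI impI)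
        fix z assume z: "\<forall>u\<in>V. z u \<in> S"
        have "(\<Sum>i\<in>I. a [] i *v (\<Sum>u\<in>T i. weight (\<lambda>v. a (i # v)) u *v z (i # u))) \<in> S"
          using z by (intro admissibleD[OF step] admissibleD[OF adm] Suc.prems fin) (auto simp: T_def)
        also have "(\<Sum>i\<in>I. a [] i *v (\<Sum>u\<in>T i. weight (\<lambda>v. a (i # v)) u *v z (i # u)))
            = (\<Sum>p\<in>Sigma I T. weight a (fst p # snd p) *v z (fst p # snd p))"
          using fin by (simp add: matrix_vector_mult_sum matrix_vector_mul_assoc weight_Cons sum.Sigma case_prod_beta)
        also have "\<dots> = (\<Sum>u\<in>V. weight a u *v z u)"
        proof (rule sum.reindex_bij_witness[where j = "\<lambda>p. fst p # snd p" and i = "\<lambda>xs. (hd xs, tl xs)"])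
          fix u assume u: "u \<in> V"
          then have "hd u # tl u = u" using False by (metis list.collapse)
          with u show "fst (hd u, tl u) # snd (hd u, tl u) = u" "(hd u, tl u) \<in> Sigma I T"
            by (auto simp: I_def T_def)
        qed (auto simp: T_def)
        finally show "(\<Sum>u\<in>V. weight a u *v z u) \<in> S" .
      qed (rule Suc.prems)
    qed
  qed
  moreover obtain L where "\<And>u. u \<in> V \<Longrightarrow> length u \<le> L"
    using finite_imageI[OF assms(3), of length] finite_nat_set_iff_bounded_le[of "length ` V"] by blast
  ultimately show ?thesis using assms by blast
qed

text \<open>Adding the terms one at a time, the partial sums cannot jump over an interval of length
  \<open>e\<close>.\<close>

lemma subset_sum_between:
  fixes x :: "'i \<Rightarrow> real"
  assumes "finite I" "\<And>i. i \<in> I \<Longrightarrow> 0 \<le> x i" "\<And>i. i \<in> I \<Longrightarrow> x i \<le> e" "0 < T" "T \<le> sum x I"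
  obtains J where "J \<subseteq> I" "T \<le> sum x J" "sum x J \<le> T + e"
proof -
  have "\<exists>J\<subseteq>I. T \<le> sum x J \<and> sum x J \<le> T + e"
    using assms
  proof (induction I rule: finite_induct)
    case (insert i I)
    show ?case
    proof (cases "T \<le> sum x I")
      case True
      then have "\<exists>J\<subseteq>I. T \<le> sum x J \<and> sum x J \<le> T + e" using insert by (intro insert.IH) auto
      then show ?thesis by blast
    next
      case False
      then have "sum x (insert i I) \<le> T + e" using insert by simp (smt (verit) insertI1)
      then show ?thesis using insert.prems by blast
    qed
  qed simp
  then show ?thesis using that by blast
qed

text \<open>Starting above \<open>T\<close>, multiply by \<open>p\<close> as long as the value stays
  at least \<open>T\<close>; starting below, multiply by \<open>q\<close> until \<open>T\<close> is
  reached. The overshoot is at most one factor. The ratios will be the spectral radii of the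
  contracting and of the expanding tree.\<close>

lemma power_hits_interval:
  fixes x T p q :: real
  assumes "x > 0" "T > 0" "0 < p" "p < 1" "1 < q"
  shows "(\<exists>k. T \<le> x * p ^ k \<and> x * p ^ k \<le> T / p) \<or> (\<exists>k. T \<le> x * q ^ k \<and> x * q ^ k \<le> T * q)"
proof (cases "T \<le> x")
  case True
  obtain k where k: "p ^ k < T / x" using real_arch_pow_inv[of "T / x" p] assms by auto
  have ex: "x * p ^ k < T" using k assms(1) by (simp add: pos_less_divide_eq mult.commute)
  define m where "m = (LEAST k. x * p ^ k < T)"
  have m: "x * p ^ m < T" unfolding m_def by (rule LeastI[of _ k]) (rule ex)
  then have "m \<noteq> 0" using True by (intro notI) simp
  then obtain j where j: "m = Suc j" using not0_implies_Suc by blast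
  have "\<not> x * p ^ j < T" using not_less_Least[of j "\<lambda>k. x * p ^ k < T"] j by (simp add: m_def)
  moreover have "x * p ^ j \<le> T / p" using m assms(3) j by (simp add: pos_le_divide_eq mult_ac)
  ultimately show ?thesis by (meson not_less)
next
  case False
  obtain k where k: "T / x < q ^ k" using real_arch_pow[OF assms(5)] by blast
  have ex: "T \<le> x * q ^ k" using k assms(1) by (simp add: pos_divide_less_eq mult.commute)
  define m where "m = (LEAST k. T \<le> x * q ^ k)"
  have m: "T \<le> x * q ^ m" unfolding m_def by (rule LeastI[of _ k]) (rule ex)
  then have "m \<noteq> 0" using False by (intro notI) simp
  then obtain j where j: "m = Suc j" using not0_implies_Suc by blast
  have "\<not> T \<le> x * q ^ j" using not_less_Least[of j "\<lambda>k. T \<le> x * q ^ k"] j by (simp add: m_def)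
  then have "x * q ^ j * q \<le> T * q" using assms(5) by (intro mult_right_mono) auto
  then have "x * q ^ m \<le> T * q" using j by (simp add: mult_ac)
  then show ?thesis using m by blast
qed

lemma nonneg_mat_sum_eq_0:
  assumes "finite I" "\<And>i. i \<in> I \<Longrightarrow> nonneg_mat (b i)" "sum b I = 0" "i \<in> I"
  shows "b i = 0"
proof -
  have "(\<Sum>i\<in>I. b i $ j $ k) = 0" for j k using assms(3) by (simp flip: sum_component)
  then have "b i $ j $ k = 0" for j k
    using assms by (subst (asm) sum_nonneg_eq_0_iff) (auto simp: nonneg_mat_def)
  then show ?thesis by (simp add: vec_eq_iff)
qed

lemma vec_sandwich_null:
  fixes x y :: "nat \<Rightarrow> real^'d"
  assumes "\<And>n. 0 \<le> x n" "\<And>n. x n \<le> y n" "y \<longlonglongrightarrow> 0"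
  shows "x \<longlonglongrightarrow> 0"
proof (rule Lim_null_comparison[of _ "\<lambda>n. norm (y n)"])
  show "\<forall>\<^sub>F n in sequentially. norm (x n) \<le> norm (y n)"
    using assms(1,2) by (intro always_eventually allI norm_le_componentwise_cart)
      (simp add: less_eq_vec_def, smt (verit))
  show "(\<lambda>n. norm (y n)) \<longlonglongrightarrow> 0" using assms(3) by (rule tendsto_norm_zero)
qed

text \<open>Turns the net of finite partial sums into a sequence. Terms of value 0 are dropped
  because \<open>perron_cone_finite\<close> tells index sets apart by nonzero matrices.\<close>

lemma has_sum_finite_approx:
  fixes w :: "'u \<Rightarrow> 'a::real_normed_vector"
  assumes "w summable_on V"
  obtains X where "\<And>n. finite (X n)" "\<And>n. X n \<subseteq> V" "\<And>n u. u \<in> X n \<Longrightarrow> w u \<noteq> 0"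
    "(\<lambda>n. sum w (X n)) \<longlonglongrightarrow> infsum w V"
proof -
  have lim: "(sum w \<longlongrightarrow> infsum w V) (finite_subsets_at_top V)"
    using assms by (simp add: has_sum_def[symmetric])
  have "\<exists>Y. finite Y \<and> Y \<subseteq> V \<and> dist (sum w Y) (infsum w V) < 1 / real (Suc n)" for n
  proof -
    have "\<forall>\<^sub>F Y in finite_subsets_at_top V. dist (sum w Y) (infsum w V) < 1 / real (Suc n)"
      by (rule tendstoD[OF lim]) simp
    then show ?thesis unfolding eventually_finite_subsets_at_top by blast
  qed
  then obtain Y where Y: "\<And>n. finite (Y n)" "\<And>n. Y n \<subseteq> V"
    "\<And>n. dist (sum w (Y n)) (infsum w V) < 1 / real (Suc n)" by metis
  define X where "X = (\<lambda>n. {u\<in>Y n. w u \<noteq> 0})"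
  have eq: "sum w (X n) = sum w (Y n)" for n
    unfolding X_def using Y(1) by (intro sum.mono_neutral_left) auto
  have "(\<lambda>n. sum w (X n)) \<longlonglongrightarrow> infsum w V"
  proof (rule tendstoI)
    fix e :: real assume "e > 0"
    then obtain N where N: "1 / real (Suc N) < e" using nat_approx_posE by blast
    have "dist (sum w (X n)) (infsum w V) < e" if "n \<ge> N" for n
    proof -
      have "1 / real (Suc n) \<le> 1 / real (Suc N)" using that by (intro divide_left_mono) auto
      then show ?thesis using Y(3)[of n] N eq[of n] by simp
    qed
    then show "\<forall>\<^sub>F n in sequentially. dist (sum w (X n)) (infsum w V) < e"
      unfolding eventually_sequentially by blast
  qed
  moreover have "finite (X n)" "X n \<subseteq> V" for n using Y(1,2)[of n] by (auto simp: X_def)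
  moreover have "w u \<noteq> 0" if "u \<in> X n" for u n using that by (simp add: X_def)
  ultimately show ?thesis by (rule that[rotated 3])
qed

text \<open>Part 1 with the probability removed. \<open>c\<close> is one step with two positive
  summands, which cuts vectors into many small pieces; \<open>b1\<close> and \<open>b2\<close> stand
  for finite parts of the two trees and scale the total down or up. \<open>z0\<close> is a positive
  starting vector.\<close>

locale scaled_family_set =
  fixes S :: "(real^'d) set" and z0 :: "real^'d" and c :: "bool \<Rightarrow> real^'d^'d"
    and I1 I2 :: "'i set" and b1 b2 :: "'i \<Rightarrow> real^'d^'d"
  assumes closed_S: "closed S" and S_nonneg: "\<And>z. z \<in> S \<Longrightarrow> 0 \<le> z" and zero_S: "0 \<in> S"
    and z0: "z0 \<in> S" "\<And>i. 0 < z0 $ i"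
    and c_adm: "admissible S UNIV c" and c_pos: "\<And>i. pos_mat (c i)"
    and adm1: "admissible S I1 b1" and nn1: "\<And>i. i \<in> I1 \<Longrightarrow> nonneg_mat (b1 i)"
    and pos1: "pos_mat (sum b1 I1)" and rad1: "spec_rad (sum b1 I1) < 1"
    and adm2: "admissible S I2 b2" and nn2: "\<And>i. i \<in> I2 \<Longrightarrow> nonneg_mat (b2 i)"
    and pos2: "pos_mat (sum b2 I2)" and rad2: "1 < spec_rad (sum b2 I2)"
begin

abbreviation "G \<equiv> c True + c False"
abbreviation "vG \<equiv> perron_vec G"
abbreviation "rG \<equiv> spec_rad G"

section \<open>From fine families to rays and cones inside \<open>S\<close>\<close>

lemma G_pos: "pos_mat G"
  using c_pos by (simp add: pos_mat_def add_pos_pos)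

lemma G_eq: "sum c UNIV = G"
  by (simp add: UNIV_bool add.commute)

text \<open>Each of the two summands of \<open>G\<close> carries only a fraction of the Perron eigenvalue of \<open>G\<close>,
  so a single word of length \<open>n\<close> is exponentially smaller than \<open>G ^ n\<close>.\<close>

lemma word_small:
  obtains e where "0 < e" "e < 1"
    "\<And>n xs. xs \<in> words UNIV n \<Longrightarrow> mprod (map c xs) *v vG \<le> (e * rG) ^ n *\<^sub>R vG"
proof -
  have v: "0 \<le> vG" "vG \<noteq> 0" using perron_vec_nonneg[OF G_pos] l1norm_perron_vec[OF G_pos] by auto
  have cv: "0 < (c i *v vG) $ j" for i j by (rule pos_mat_vec[OF c_pos v])
  obtain t1 where t1: "t1 > 0" "vG \<le> t1 *\<^sub>R (c True *v vG)" using pos_vec_dominates[OF cv] by blast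
  obtain t2 where t2: "t2 > 0" "vG \<le> t2 *\<^sub>R (c False *v vG)" using pos_vec_dominates[OF cv] by blast
  \<comment> \<open>\<open>t1\<close> and \<open>t2\<close> make \<open>vG \<le> t c_i vG\<close>
    for both summands; the third entry gives \<open>t * rG \<ge> 2\<close>, hence
    \<open>e > 0\<close> below.\<close>
  define t where "t = Max {t1, t2, 2 / rG}"
  have tge: "t1 \<le> t" "t2 \<le> t" "2 / rG \<le> t" unfolding t_def by (rule Max_ge; simp)+
  have r: "rG > 0" by (rule spec_rad_pos[OF G_pos])
  have tpos: "t > 0" using t1(1) tge by linarith
  have dom: "(1 / t) *\<^sub>R vG \<le> c i *v vG" for i
  proof -
    have "vG \<le> t *\<^sub>R (c i *v vG)"
    proof (cases i)
      case True
      have "vG \<le> t1 *\<^sub>R (c i *v vG)" using t1 True by simp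
      also have "\<dots> \<le> t *\<^sub>R (c i *v vG)"
        using tge cv by (intro scaleR_right_mono) (auto simp: less_eq_vec_def intro: less_imp_le)
      finally show ?thesis .
    next
      case False
      have "vG \<le> t2 *\<^sub>R (c i *v vG)" using t2 False by simp
      also have "\<dots> \<le> t *\<^sub>R (c i *v vG)"
        using tge cv by (intro scaleR_right_mono) (auto simp: less_eq_vec_def intro: less_imp_le)
      finally show ?thesis .
    qed
    then have "(1 / t) *\<^sub>R vG \<le> (1 / t) *\<^sub>R (t *\<^sub>R (c i *v vG))"
      using tpos by (intro scaleR_left_mono) auto
    then show ?thesis using tpos by simp
  qed
  define e where "e = 1 - 1 / (t * rG)"
  have rt: "2 \<le> t * rG" using tge(3) r by (simp add: pos_divide_le_eq)
  have e: "0 < e" "e < 1" using rt r tpos by (auto simp: e_def pos_divide_less_eq)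
  have one: "c i *v vG \<le> (e * rG) *\<^sub>R vG" for i
  proof -
    have "c i *v vG + c (\<not> i) *v vG = rG *\<^sub>R vG"
      using perron_vec_eigen[OF G_pos] by (cases i) (simp_all add: matrix_vector_mult_add_rdistrib add.commute)
    then have "c i *v vG = rG *\<^sub>R vG - c (\<not> i) *v vG" by (simp add: eq_diff_eq)
    also have "\<dots> \<le> rG *\<^sub>R vG - (1 / t) *\<^sub>R vG" by (rule diff_left_mono[OF dom])
    also have "\<dots> = (e * rG) *\<^sub>R vG" 
    proof -
      have "e * rG = rG - 1 / t" using r tpos by (simp add: e_def left_diff_distrib)
      then show ?thesis by (simp add: scaleR_diff_left)
    qed
    finally show ?thesis .
  qed
  have "mprod (map c xs) *v vG \<le> (e * rG) ^ n *\<^sub>R vG" if "xs \<in> words UNIV n" for n xs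
    using that
  proof (induction xs arbitrary: n)
    case (Cons x xs)
    then obtain m where m: "n = Suc m" "xs \<in> words UNIV m" by (auto simp: words_def)
    have "mprod (map c (x # xs)) *v vG = c x *v (mprod (map c xs) *v vG)"
      by (simp add: matrix_vector_mul_assoc)
    also have "\<dots> \<le> c x *v ((e * rG) ^ m *\<^sub>R vG)"
      by (intro nonneg_mat_vec_mono Cons.IH m pos_mat_imp_nonneg c_pos)
    also have "\<dots> \<le> (e * rG) ^ m *\<^sub>R ((e * rG) *\<^sub>R vG)"
      unfolding matrix_vector_mult_scaleR using one e r by (intro scaleR_left_mono) auto
    finally show ?case by (simp add: m mult.commute)
  qed (simp add: words_def)
  then show ?thesis using that e by blast
qed

text \<open>\<open>n\<close> controls the fineness and \<open>k\<close> the size. Up to the factor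
  \<open>t\<close>, which depends on neither, the whole family has at least the value
  \<open>rG ^ n * r ^ k\<close> under \<open>psi\<close> (with \<open>r\<close> the spectral radius
  of \<open>sum b I\<close>), while each member has at most the fraction \<open>e ^ n\<close> of
  it.\<close>

lemma fine_family:
  fixes I :: "'i set" and b :: "'i \<Rightarrow> real^'d^'d"
  assumes b: "finite I" "\<And>i. i \<in> I \<Longrightarrow> nonneg_mat (b i)" "pos_mat (sum b I)"
    and e: "0 < e" "\<And>n xs. xs \<in> words UNIV n \<Longrightarrow> mprod (map c xs) *v vG \<le> (e * rG) ^ n *\<^sub>R vG"
    and psi: "0 \<le> psi" "psi \<noteq> 0"
  obtains t where "t > 0"
    "\<And>n k p. p \<in> words UNIV n \<times> words I k \<Longrightarrow>
      psi \<bullet> ((mprod (map c (fst p)) ** mprod (map b (snd p))) *v z0) \<le> t * e ^ n * (rG ^ n * spec_rad (sum b I) ^ k)"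
    "\<And>n k. rG ^ n * spec_rad (sum b I) ^ k / t \<le>
      (\<Sum>p\<in>words UNIV n \<times> words I k. psi \<bullet> ((mprod (map c (fst p)) ** mprod (map b (snd p))) *v z0))"
proof -
  let ?l = "sum b I" let ?v = "perron_vec ?l" let ?r = "spec_rad ?l"
  have v: "\<And>i. 0 < ?v $ i" "\<And>i. 0 < vG $ i" "0 \<le> ?v" "0 \<le> vG" "vG \<noteq> 0"
    using perron_vec_pos[OF b(3)] perron_vec_pos[OF G_pos] perron_vec_nonneg b(3) G_pos
      l1norm_perron_vec[OF G_pos] by auto
  have r: "0 < rG" "0 < ?r" using spec_rad_pos G_pos b(3) by auto
  \<comment> \<open>Positive vectors dominate one another: \<open>t1\<close>, \<open>t3\<close> lead
    from \<open>z0\<close> through \<open>?v\<close> to \<open>vG\<close> in the upper bound,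
    \<open>t4\<close>, \<open>t2\<close> from \<open>vG\<close> through \<open>?v\<close> back to
    \<open>z0\<close> in the lower bound.\<close>
  obtain t1 where t1: "t1 > 0" "z0 \<le> t1 *\<^sub>R ?v" using pos_vec_dominates[OF v(1)] by blast
  obtain t2 where t2: "t2 > 0" "?v \<le> t2 *\<^sub>R z0" using pos_vec_dominates[OF z0(2)] by blast
  obtain t3 where t3: "t3 > 0" "?v \<le> t3 *\<^sub>R vG" using pos_vec_dominates[OF v(2)] by blast
  obtain t4 where t4: "t4 > 0" "vG \<le> t4 *\<^sub>R ?v" using pos_vec_dominates[OF v(1)] by blast
  have pv: "0 < psi \<bullet> vG" using inner_vec_pos_iff[OF psi(1) v(2)] psi(2) by blast
  define t where "t = max (t1 * t3 * (psi \<bullet> vG)) (t2 * t4 / (psi \<bullet> vG))"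
  have tge: "t1 * t3 * (psi \<bullet> vG) \<le> t" "t2 * t4 / (psi \<bullet> vG) \<le> t" by (auto simp: t_def)
  have tpos: "t > 0" using tge(1) t1(1) t3(1) pv by (meson less_le_trans mult_pos_pos)
  have nnc: "nonneg_mat (mprod (map c xs))" for xs
    by (intro nonneg_mat_mprod) (auto simp: pos_mat_imp_nonneg[OF c_pos])
  have nnb: "nonneg_mat (mprod (map b xs))" if "xs \<in> words I k" for xs k
    using that b(2) by (intro nonneg_mat_mprod) (auto simp: words_def)
  show ?thesis
  proof (rule that[OF tpos])
    fix n k and p :: "bool list \<times> 'i list"
    assume p: "p \<in> words UNIV n \<times> words I k"
    let ?C = "mprod (map c (fst p))" let ?B = "mprod (map b (snd p))"
    have fin: "finite (words I k)" using b(1) by (rule finite_words)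
    \<comment> \<open>A single word is one of the nonnegative summands in the expansion of
      \<open>mpow ?l k\<close>.\<close>
    have "nonneg_mat (mpow ?l k - ?B)"
    proof -
      have "mpow ?l k - ?B = (\<Sum>xs\<in>words I k - {snd p}. mprod (map b xs))"
        using p fin by (subst sum_words_mprod[symmetric]) (subst sum.remove[of _ "snd p"], auto)
      then show ?thesis using nnb by (auto intro!: nonneg_mat_sum)
    qed
    then have "?B *v ?v \<le> ?r ^ k *\<^sub>R ?v"
      using nonneg_mat_vec_mono'[of "mpow ?l k" ?B ?v] v mpow_eigen[OF perron_vec_eigen[OF b(3)]] by simp
    also have "\<dots> \<le> ?r ^ k *\<^sub>R (t3 *\<^sub>R vG)" using t3 r by (intro scaleR_left_mono) auto
    finally have "?C *v (?B *v ?v) \<le> ?C *v (?r ^ k *\<^sub>R (t3 *\<^sub>R vG))" by (rule nonneg_mat_vec_mono[OF nnc])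
    also have "\<dots> = (?r ^ k * t3) *\<^sub>R (?C *v vG)" by (simp add: matrix_vector_mult_scaleR)
    also have "\<dots> \<le> (?r ^ k * t3) *\<^sub>R ((e * rG) ^ n *\<^sub>R vG)"
      using e p r t3 by (intro scaleR_left_mono) auto
    finally have CB: "?C *v (?B *v ?v) \<le> (?r ^ k * t3 * (e * rG) ^ n) *\<^sub>R vG" by simp
    have "(?C ** ?B) *v z0 \<le> (?C ** ?B) *v (t1 *\<^sub>R ?v)"
      using p by (intro nonneg_mat_vec_mono nonneg_mat_mult nnc nnb t1) auto
    also have "\<dots> = t1 *\<^sub>R (?C *v (?B *v ?v))" by (simp add: matrix_vector_mult_scaleR matrix_vector_mul_assoc)
    also have "\<dots> \<le> t1 *\<^sub>R ((?r ^ k * t3 * (e * rG) ^ n) *\<^sub>R vG)" using CB t1 by (intro scaleR_left_mono) auto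
    finally have "psi \<bullet> ((?C ** ?B) *v z0) \<le> psi \<bullet> (t1 *\<^sub>R ((?r ^ k * t3 * (e * rG) ^ n) *\<^sub>R vG))"
      by (rule inner_vec_mono[OF psi(1)])
    also have "\<dots> = (t1 * t3 * (psi \<bullet> vG)) * (e ^ n * (rG ^ n * ?r ^ k))" by (simp add: power_mult_distrib)
    also have "\<dots> \<le> t * (e ^ n * (rG ^ n * ?r ^ k))" using tge(1) e r by (intro mult_right_mono) auto
    finally show "psi \<bullet> ((?C ** ?B) *v z0) \<le> t * e ^ n * (rG ^ n * ?r ^ k)" by (simp add: mult.assoc)
  next
    fix n k
    have nl: "nonneg_mat (mpow ?l k)" and nG: "nonneg_mat (mpow G n)"
      by (intro nonneg_mat_mprod; simp add: pos_mat_imp_nonneg b(3) G_pos)+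
    have "(?r ^ k * rG ^ n) *\<^sub>R vG = ?r ^ k *\<^sub>R (mpow G n *v vG)"
      by (simp add: mpow_eigen[OF perron_vec_eigen[OF G_pos]])
    also have "\<dots> \<le> ?r ^ k *\<^sub>R (mpow G n *v (t4 *\<^sub>R ?v))"
      using r t4 nG by (intro scaleR_left_mono nonneg_mat_vec_mono) auto
    also have "\<dots> = t4 *\<^sub>R (mpow G n *v (mpow ?l k *v ?v))"
      by (simp add: mpow_eigen[OF perron_vec_eigen[OF b(3)]] matrix_vector_mult_scaleR)
    also have "\<dots> \<le> t4 *\<^sub>R (mpow G n *v (mpow ?l k *v (t2 *\<^sub>R z0)))"
      using t2 t4 nG nl by (intro scaleR_left_mono nonneg_mat_vec_mono) auto
    also have "\<dots> = (t2 * t4) *\<^sub>R ((mpow G n ** mpow ?l k) *v z0)"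
      by (simp add: matrix_vector_mult_scaleR matrix_vector_mul_assoc)
    finally have "psi \<bullet> ((?r ^ k * rG ^ n) *\<^sub>R vG) \<le> psi \<bullet> ((t2 * t4) *\<^sub>R ((mpow G n ** mpow ?l k) *v z0))"
      by (rule inner_vec_mono[OF psi(1)])
    then have *: "(?r ^ k * rG ^ n) * (psi \<bullet> vG) \<le> (t2 * t4) * (psi \<bullet> ((mpow G n ** mpow ?l k) *v z0))" by simp
    have "mpow G n ** mpow ?l k = (\<Sum>xs\<in>words UNIV n. \<Sum>ys\<in>words I k. mprod (map c xs) ** mprod (map b ys))"
      by (simp add: sum_words_mprod[symmetric] G_eq[symmetric] matrix_mult_sum_left matrix_mult_sum_right)
         (rule sum.swap)
    then have sumeq: "psi \<bullet> ((mpow G n ** mpow ?l k) *v z0) =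
      (\<Sum>p\<in>words UNIV n \<times> words I k. psi \<bullet> ((mprod (map c (fst p)) ** mprod (map b (snd p))) *v z0))" (is "_ = ?X")
      by (simp add: sum_matrix_vector_mult inner_sum_right sum.cartesian_product case_prod_beta)
    have "rG ^ n * ?r ^ k \<le> (t2 * t4 / (psi \<bullet> vG)) * ?X"
      using * pv unfolding sumeq by (simp add: pos_le_divide_eq mult_ac)
    also have "\<dots> \<le> t * ?X"
    proof (rule mult_right_mono[OF tge(2)])
      show "0 \<le> ?X"
        using b(2) z0(2) by (intro sum_nonneg inner_vec_nonneg psi nonneg_mat_vec nonneg_mat_mult nnc nnb)
          (auto simp: less_eq_vec_def intro: less_imp_le)
    qed
    finally show "rG ^ n * ?r ^ k / t \<le> ?X" using tpos by (simp add: pos_divide_le_eq mult.commute)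
  qed
qed

text \<open>\<open>n\<close> is fixed first, so large that no single piece exceeds
  \<open>eps\<close>; then \<open>k\<close>, together with the choice of the tree, brings the total
  of all pieces above \<open>T\<close>, and a greedy selection of pieces stops between
  \<open>T\<close> and \<open>T + eps\<close>. Partial selections stay in \<open>S\<close> because
  \<open>0 \<in> S\<close>.\<close>

lemma functional_hits:
  assumes psi: "0 \<le> psi" "psi \<noteq> 0" and T: "T > 0" "eps > 0"
  obtains y where "y \<in> S" "T \<le> psi \<bullet> y" "psi \<bullet> y \<le> T + eps"
proof -
  obtain e where e: "0 < e" "e < 1"
    "\<And>n xs. xs \<in> words UNIV n \<Longrightarrow> mprod (map c xs) *v vG \<le> (e * rG) ^ n *\<^sub>R vG"
    using word_small by metis
  have fin: "finite I1" "finite I2" using adm1 adm2 by (auto simp: admissible_def)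
  let ?x = "\<lambda>b p. psi \<bullet> ((mprod (map c (fst p)) ** mprod (map b (snd p))) *v z0)"
  let ?r1 = "spec_rad (sum b1 I1)" and ?r2 = "spec_rad (sum b2 I2)"
  obtain t1 where t1: "t1 > 0"
    "\<And>n k p. p \<in> words UNIV n \<times> words I1 k \<Longrightarrow> ?x b1 p \<le> t1 * e ^ n * (rG ^ n * ?r1 ^ k)"
    "\<And>n k. rG ^ n * ?r1 ^ k / t1 \<le> (\<Sum>p\<in>words UNIV n \<times> words I1 k. ?x b1 p)"
    using fine_family[OF fin(1) nn1 pos1 e(1,3) psi] by blast
  obtain t2 where t2: "t2 > 0"
    "\<And>n k p. p \<in> words UNIV n \<times> words I2 k \<Longrightarrow> ?x b2 p \<le> t2 * e ^ n * (rG ^ n * ?r2 ^ k)"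
    "\<And>n k. rG ^ n * ?r2 ^ k / t2 \<le> (\<Sum>p\<in>words UNIV n \<times> words I2 k. ?x b2 p)"
    using fine_family[OF fin(2) nn2 pos2 e(1,3) psi] by blast
  define t where "t = max t1 t2"
  have t: "t1 \<le> t" "t2 \<le> t" "t > 0" using t1(1) by (auto simp: t_def)
  have r: "0 < rG" "0 < ?r1" "0 < ?r2" using spec_rad_pos G_pos pos1 pos2 by auto
  \<comment> \<open>\<open>Q\<close> bounds the overshoot in both cases of
    \<open>power_hits_interval\<close>, so the size of the family will lie between
    \<open>T * t\<close> and \<open>T * t * Q\<close> whatever \<open>k\<close> is; this permits
    choosing \<open>n\<close> before \<open>k\<close>.\<close>
  define Q where "Q = max (1 / ?r1) ?r2"
  have Q: "1 / ?r1 \<le> Q" "?r2 \<le> Q" "Q > 0" using r(3) by (auto simp: Q_def)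
  have "(\<lambda>n. t * e ^ n * (T * t * Q)) \<longlonglongrightarrow> t * 0 * (T * t * Q)"
    using e by (intro tendsto_intros LIMSEQ_power_zero) auto
  then have "\<forall>\<^sub>F n in sequentially. t * e ^ n * (T * t * Q) < eps" using T by (intro order_tendstoD) auto
  then obtain n where n: "t * e ^ n * (T * t * Q) < eps" by (metis eventually_sequentially order_refl)
  have key: "\<exists>y\<in>S. T \<le> psi \<bullet> y \<and> psi \<bullet> y \<le> T + eps"
    if adm: "admissible S I b" and nn: "\<And>i. i \<in> I \<Longrightarrow> nonneg_mat (b i)"
      and small: "\<And>p. p \<in> words UNIV n \<times> words I k \<Longrightarrow> ?x b p \<le> s * e ^ n * (rG ^ n * rr ^ k)"
      and total: "rG ^ n * rr ^ k / s \<le> (\<Sum>p\<in>words UNIV n \<times> words I k. ?x b p)"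
      and s: "0 < s" "s \<le> t" and k: "T * t \<le> rG ^ n * rr ^ k" "rG ^ n * rr ^ k \<le> T * t * Q"
    for I :: "'i set" and b k s rr
  proof -
    let ?W = "words (UNIV :: bool set) n \<times> words I k"
    have admW: "admissible S ?W (\<lambda>p. mprod (map c (fst p)) ** mprod (map b (snd p)))"
      by (rule admissible_times[OF admissible_words[OF c_adm] admissible_words[OF adm]])
    have pos: "0 \<le> ?x b p" if "p \<in> ?W" for p
      using that nn z0(2)
      by (intro inner_vec_nonneg psi nonneg_mat_vec nonneg_mat_mult nonneg_mat_mprod)
        (auto simp: less_eq_vec_def pos_mat_imp_nonneg[OF c_pos] words_def intro: less_imp_le)
    have Xnn: "0 \<le> rG ^ n * rr ^ k" using k(1) T t by (smt (verit) mult_pos_pos)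
    have upper: "?x b p \<le> eps" if "p \<in> ?W" for p
    proof -
      have "?x b p \<le> s * e ^ n * (rG ^ n * rr ^ k)" by (rule small[OF that])
      also have "\<dots> \<le> t * e ^ n * (T * t * Q)"
      proof (rule mult_mono[OF mult_right_mono[OF s(2)] k(2)])
      qed (use e t Xnn in auto)
      finally show ?thesis using n by simp
    qed
    have "T = T * t / t" using t by simp
    also have "\<dots> \<le> rG ^ n * rr ^ k / s"
      using s k Xnn by (intro frac_le) auto
    also note total
    finally have "T \<le> (\<Sum>p\<in>?W. ?x b p)" .
    moreover have "finite ?W" using admW by (simp add: admissible_def)
    ultimately obtain J where J: "J \<subseteq> ?W" "T \<le> sum (?x b) J" "sum (?x b) J \<le> T + eps"
      using subset_sum_between[of ?W "?x b" eps T] pos upper T by blast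
    have "(\<Sum>p\<in>J. (mprod (map c (fst p)) ** mprod (map b (snd p))) *v z0) \<in> S"
      using admissible_subset[OF admW zero_S J(1)] by (rule admissibleD) (rule z0)
    with J show ?thesis by (intro bexI) (auto simp: inner_sum_right)
  qed
  have "0 < rG ^ n" "0 < T * t" using r T t by auto
  from power_hits_interval[OF this r(2) rad1 rad2]
  have "\<exists>y\<in>S. T \<le> psi \<bullet> y \<and> psi \<bullet> y \<le> T + eps"
  proof (elim disjE exE conjE)
    fix k assume k: "T * t \<le> rG ^ n * ?r1 ^ k" "rG ^ n * ?r1 ^ k \<le> T * t / ?r1"
    have "T * t / ?r1 \<le> T * t * Q"
      using mult_left_mono[OF Q(1), of "T * t"] T t by simp
    with k show ?thesis using t1 t by (intro key[OF adm1 nn1, of k t1 ?r1]) auto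
  next
    fix k assume k: "T * t \<le> rG ^ n * ?r2 ^ k" "rG ^ n * ?r2 ^ k \<le> T * t * ?r2"
    have "T * t * ?r2 \<le> T * t * Q" using Q T t by (intro mult_left_mono) auto
    with k show ?thesis using t2 t by (intro key[OF adm2 nn2, of k t2 ?r2]) auto
  qed
  then show ?thesis using that by blast
qed

text \<open>Choose \<open>y n\<close> in \<open>S\<close> with \<open>l \<bullet> y n\<close> close
  to \<open>s / r ^ n\<close> and apply the \<open>n\<close>-th power of the matrix: in the limit
  only the value under the left eigenvector \<open>l\<close> survives.\<close>

lemma perron_ray:
  assumes adm: "admissible S I b" and pos: "pos_mat (sum b I)" and s: "0 \<le> s"
  shows "s *\<^sub>R perron_vec (sum b I) \<in> S"
proof (cases "s = 0")
  case False
  let ?g = "sum b I" let ?r = "spec_rad ?g"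
  have r: "?r > 0" by (rule spec_rad_pos[OF pos])
  obtain l where l: "\<And>i. 0 < l $ i" "l v* ?g = ?r *\<^sub>R l" "l \<bullet> perron_vec ?g = 1"
    using left_perron_vec[OF pos] by metis
  have l': "0 \<le> l" "l \<noteq> 0" using l by (auto simp: less_eq_vec_def intro: less_imp_le)
  \<comment> \<open>The error is relative, \<open>1 / (n + 1)\<close>, so it still tends to 0 after
    multiplication by \<open>?r ^ n\<close>.\<close>
  have "\<exists>y. y \<in> S \<and> s / ?r ^ n \<le> l \<bullet> y \<and> l \<bullet> y \<le> s / ?r ^ n + s / ?r ^ n / real (Suc n)" for n
    using functional_hits[OF l', of "s / ?r ^ n" "s / ?r ^ n / real (Suc n)"] r s False
    by (metis divide_pos_pos of_nat_0_less_iff order_le_less zero_less_Suc zero_less_power)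
  then obtain y where y: "\<And>n. y n \<in> S" "\<And>n. s / ?r ^ n \<le> l \<bullet> y n"
    "\<And>n. l \<bullet> y n \<le> s / ?r ^ n + s / ?r ^ n / real (Suc n)" by metis
  have "(\<lambda>n. ?r ^ n * (l \<bullet> y n)) \<longlonglongrightarrow> s"
  proof (rule real_tendsto_sandwich)
    show "\<forall>\<^sub>F n in sequentially. s \<le> ?r ^ n * (l \<bullet> y n)"
      using y(2) r by (intro always_eventually allI) (simp add: pos_divide_le_eq mult.commute)
    show "\<forall>\<^sub>F n in sequentially. ?r ^ n * (l \<bullet> y n) \<le> s + s / real (Suc n)"
    proof (intro always_eventually allI)
      fix n
      have "?r ^ n * (l \<bullet> y n) \<le> ?r ^ n * (s / ?r ^ n + s / ?r ^ n / real (Suc n))"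
        using y(3) r by (intro mult_left_mono) auto
      also have "\<dots> = s + s / real (Suc n)" using r by (simp add: field_simps del: of_nat_Suc)
      finally show "?r ^ n * (l \<bullet> y n) \<le> s + s / real (Suc n)" .
    qed
    have "(\<lambda>n. s + s / real (Suc n)) \<longlonglongrightarrow> s + 0"
      by (intro tendsto_intros LIMSEQ_Suc[OF lim_const_over_n])
    then show "(\<lambda>n. s + s / real (Suc n)) \<longlonglongrightarrow> s" by simp
  qed simp
  then have "(\<lambda>n. mpow ?g n *v y n) \<longlonglongrightarrow> s *\<^sub>R perron_vec ?g"
    by (intro perron_limit[OF pos l] S_nonneg y)
  moreover have "\<And>n. mpow ?g n *v y n \<in> S" by (intro admissible_mpow_vec adm y)
  ultimately show ?thesis using closed_sequentially[OF closed_S, of "\<lambda>n. mpow ?g n *v y n"] by blast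
qed (use zero_S in simp)

text \<open>Subfamilies \<open>V\<close> may overlap. A word over \<open>V\<close> is used for \<open>V\<close> only if it is not a word over
  some \<open>V'\<close> that fails to contain \<open>V\<close>; this makes the allocation disjoint, and the words that are
  given up are asymptotically negligible because \<open>V \<inter> V'\<close> is a proper part of \<open>V\<close>.\<close>

lemma perron_cone_finite:
  assumes adm: "admissible S W b" and nn: "\<And>u. u \<in> W \<Longrightarrow> nonneg_mat (b u)"
    and fin: "finite \<V>" and V: "\<And>V. V \<in> \<V> \<Longrightarrow> V \<subseteq> W"
    and pos: "\<And>V. V \<in> \<V> \<Longrightarrow> pos_mat (sum b V)" and nz: "\<And>V u. V \<in> \<V> \<Longrightarrow> u \<in> V \<Longrightarrow> b u \<noteq> 0"
    and s: "\<And>V. V \<in> \<V> \<Longrightarrow> 0 \<le> s V"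
  shows "(\<Sum>V\<in>\<V>. s V *\<^sub>R perron_vec (sum b V)) \<in> S"
proof -
  define v where "v = (\<lambda>V. perron_vec (sum b V))"
  define r where "r = (\<lambda>V. spec_rad (sum b V))"
  define own where "own = (\<lambda>V n. words V n - (\<Union>V'\<in>{V'\<in>\<V>. \<not> V \<subseteq> V'}. words V' n))"
  \<comment> \<open>The scaling compensates the eigenvalue: all words over \<open>V\<close> of
    length \<open>n\<close> together send \<open>x V n\<close> to
    \<open>s V *\<^sub>R v V\<close>.\<close>
  define x where "x = (\<lambda>V n. (s V / r V ^ n) *\<^sub>R v V)"
  define P where "P = (\<lambda>xs. mprod (map b xs))"
  have finW: "finite W" using adm by (simp add: admissible_def)
  have finV: "finite V" if "V \<in> \<V>" for V using V[OF that] finW finite_subset by blast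
  have r: "r V > 0" if "V \<in> \<V>" for V using spec_rad_pos[OF pos[OF that]] by (simp add: r_def)
  have nnP: "nonneg_mat (P xs)" if "xs \<in> words W n" for xs n
    using that nn unfolding P_def by (intro nonneg_mat_mprod) (auto simp: words_def)
  have xS: "x V n \<in> S" if "V \<in> \<V>" for V n
    unfolding x_def v_def using that r[OF that] s[OF that]
    by (intro perron_ray admissible_subset[OF adm zero_S] V pos) auto
  have xnn: "0 \<le> x V n" if "V \<in> \<V>" for V n using S_nonneg[OF xS[OF that]] .
  define y where "y = (\<lambda>n. \<Sum>V\<in>\<V>. \<Sum>xs\<in>own V n. P xs *v x V n)"
  \<comment> \<open>A word owned by both sets forces \<open>V \<subseteq> V'\<close> and
    \<open>V' \<subseteq> V\<close>.\<close>
  have disj: "V = V'" if "V \<in> \<V>" "V' \<in> \<V>" "xs \<in> own V n" "xs \<in> own V' n" for V V' xs n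
    using that by (auto simp: own_def)
  have ownW: "own V n \<subseteq> words W n" if "V \<in> \<V>" for V n
    using words_mono[OF V[OF that], of n] by (auto simp: own_def)
  have yS: "y n \<in> S" for n
  proof -
    define z where "z = (\<lambda>xs. \<Sum>V\<in>\<V>. if xs \<in> own V n then x V n else 0)"
    have "z xs \<in> S" for xs
    proof (cases "\<exists>V\<in>\<V>. xs \<in> own V n")
      case True
      then obtain V where V: "V \<in> \<V>" "xs \<in> own V n" by blast
      have "z xs = (\<Sum>V'\<in>{V}. if xs \<in> own V' n then x V' n else 0)"
        unfolding z_def using V fin disj by (intro sum.mono_neutral_right) auto
      with V xS show ?thesis by simp
    next
      case False
      then have "z xs = 0" unfolding z_def by (intro sum.neutral) auto
      with zero_S show ?thesis by simp
    qed
    then have "(\<Sum>xs\<in>words W n. P xs *v z xs) \<in> S"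
      using admissibleD[OF admissible_words[OF adm]] unfolding P_def by blast
    also have "(\<Sum>xs\<in>words W n. P xs *v z xs) = (\<Sum>V\<in>\<V>. \<Sum>xs\<in>words W n. P xs *v (if xs \<in> own V n then x V n else 0))"
      unfolding z_def matrix_vector_mult_sum by (rule sum.swap)
    also have "\<dots> = y n"
      unfolding y_def
    proof (rule sum.cong[OF refl])
      fix V assume "V \<in> \<V>"
      then show "(\<Sum>xs\<in>words W n. P xs *v (if xs \<in> own V n then x V n else 0)) = (\<Sum>xs\<in>own V n. P xs *v x V n)"
        using ownW finite_words[OF finW] by (intro sum.mono_neutral_cong_right) auto
    qed
    finally show ?thesis .
  qed
  have "y \<longlonglongrightarrow> (\<Sum>V\<in>\<V>. s V *\<^sub>R v V)"
    unfolding y_def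
  proof (rule tendsto_sum)
    fix V assume VV: "V \<in> \<V>"
    let ?B = "{V'\<in>\<V>. \<not> V \<subseteq> V'}"
    define lost where "lost = (\<lambda>n. \<Sum>xs\<in>words V n \<inter> (\<Union>V'\<in>?B. words V' n). P xs *v x V n)"
    have split: "(\<Sum>xs\<in>own V n. P xs *v x V n) = s V *\<^sub>R v V - lost n" for n
    proof -
      have "(\<Sum>xs\<in>words V n. P xs *v x V n) = mpow (sum b V) n *v x V n"
        unfolding P_def by (rule sum_words_mprod_vec)
      also have "\<dots> = s V *\<^sub>R v V"
        using mpow_eigen[OF perron_vec_eigen[OF pos[OF VV]]] r[OF VV]
        by (simp add: x_def v_def matrix_vector_mult_scaleR r_def)
      finally have "s V *\<^sub>R v V = (\<Sum>xs\<in>words V n. P xs *v x V n)" ..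
      also have "\<dots> = (\<Sum>xs\<in>own V n. P xs *v x V n) + lost n"
        unfolding lost_def own_def
        by (subst sum.Int_Diff[of _ _ "\<Union>V'\<in>?B. words V' n"]) (auto simp: finite_words finV[OF VV] add.commute)
      finally show ?thesis by simp
    qed
    have "lost \<longlonglongrightarrow> 0"
    proof (rule vec_sandwich_null)
      let ?h = "\<lambda>V'. sum b (V \<inter> V')"
      show "0 \<le> lost n" for n
        unfolding lost_def using VV V[OF VV] words_mono[OF V[OF VV], of n]
        by (intro sum_nonneg nonneg_mat_vec nnP[of _ n] xnn) auto
      \<comment> \<open>Union bound over \<open>V'\<close>: the words common to \<open>V\<close> and
        \<open>V'\<close> are the words over \<open>V \<inter> V'\<close>, and they sum to a power
        of \<open>?h V'\<close>.\<close>
      show "lost n \<le> (\<Sum>V'\<in>?B. s V *\<^sub>R ((1 / r V ^ n) *\<^sub>R (mpow (?h V') n *v v V)))" for n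
      proof -
        have "lost n \<le> (\<Sum>V'\<in>?B. \<Sum>xs\<in>words V n \<inter> words V' n. P xs *v x V n)"
        proof -
          have "lost n = (\<Sum>xs\<in>(\<Union>V'\<in>?B. words V n \<inter> words V' n). P xs *v x V n)"
            unfolding lost_def by (rule sum.cong) auto
          also have "\<dots> \<le> (\<Sum>p\<in>Sigma ?B (\<lambda>V'. words V n \<inter> words V' n). P (snd p) *v x V n)"
          proof -
            have "(\<Union>V'\<in>?B. words V n \<inter> words V' n) = snd ` Sigma ?B (\<lambda>V'. words V n \<inter> words V' n)"
              by force
            moreover have "finite (Sigma ?B (\<lambda>V'. words V n \<inter> words V' n))"
              using fin finite_words[OF finV[OF VV], of n] by auto
            moreover have "0 \<le> P xs *v x V n" if "xs \<in> words V n" for xs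
              using that VV words_mono[OF V[OF VV], of n] by (intro nonneg_mat_vec nnP[of _ n] xnn) auto
            ultimately show ?thesis
              using sum_image_le[of "Sigma ?B (\<lambda>V'. words V n \<inter> words V' n)" "\<lambda>xs. P xs *v x V n" snd]
              by (auto simp: comp_def)
          qed
          also have "\<dots> = (\<Sum>V'\<in>?B. \<Sum>xs\<in>words V n \<inter> words V' n. P xs *v x V n)"
            using fin finite_words[OF finV[OF VV], of n] by (subst sum.Sigma) (auto simp: case_prod_beta)
          finally show ?thesis .
        qed
        also have "\<dots> = (\<Sum>V'\<in>?B. mpow (?h V') n *v x V n)"
          unfolding words_Int P_def sum_words_mprod_vec ..
        also have "\<dots> = (\<Sum>V'\<in>?B. s V *\<^sub>R ((1 / r V ^ n) *\<^sub>R (mpow (?h V') n *v v V)))"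
          by (simp add: x_def matrix_vector_mult_scaleR)
        finally show ?thesis .
      qed
      have "(\<lambda>n. s V *\<^sub>R ((1 / r V ^ n) *\<^sub>R (mpow (?h V') n *v v V))) \<longlonglongrightarrow> s V *\<^sub>R 0" if V': "V' \<in> ?B" for V'
        unfolding r_def v_def
      proof (intro tendsto_intros submatrix_power_negligible pos VV)
        show "nonneg_mat (?h V')" using V[OF VV] nn by (intro nonneg_mat_sum) auto
        have diff: "sum b V - ?h V' = sum b (V - V')"
          using sum.Int_Diff[OF finV[OF VV], of b V'] by simp
        show "nonneg_mat (sum b V - ?h V')" unfolding diff using V[OF VV] nn by (intro nonneg_mat_sum) auto
        obtain u where u: "u \<in> V" "u \<notin> V'" using V' by blast
        show "sum b V \<noteq> ?h V'"
        proof
          assume "sum b V = ?h V'"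
          then have "sum b (V - V') = 0" using diff by simp
          then have "b u = 0"
            using nonneg_mat_sum_eq_0[of "V - V'" b u] u finV[OF VV] V[OF VV] nn by auto
          with nz[OF VV u(1)] show False by simp
        qed
      qed
      then have "(\<lambda>n. \<Sum>V'\<in>?B. s V *\<^sub>R ((1 / r V ^ n) *\<^sub>R (mpow (?h V') n *v v V))) \<longlonglongrightarrow> (\<Sum>V'\<in>?B. s V *\<^sub>R 0)"
        by (rule tendsto_sum)
      then show "(\<lambda>n. \<Sum>V'\<in>?B. s V *\<^sub>R ((1 / r V ^ n) *\<^sub>R (mpow (?h V') n *v v V))) \<longlonglongrightarrow> 0" by simp
    qed
    then have "(\<lambda>n. s V *\<^sub>R v V - lost n) \<longlonglongrightarrow> s V *\<^sub>R v V - 0" by (intro tendsto_intros)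
    then show "(\<lambda>n. \<Sum>xs\<in>own V n. P xs *v x V n) \<longlonglongrightarrow> s V *\<^sub>R v V" unfolding split by simp
  qed
  then show ?thesis using closed_sequentially[OF closed_S] yS unfolding v_def by blast
qed

text \<open>Infinite sets \<open>V\<close> are replaced by finite parts. Positivity of the sums is
  an open condition and \<open>perron_vec\<close> is continuous, so closedness of \<open>S\<close>
  gives the limit.\<close>

lemma perron_cone:
  assumes adm: "\<And>W. finite W \<Longrightarrow> W \<subseteq> U \<Longrightarrow> admissible S W w" and nn: "\<And>u. u \<in> U \<Longrightarrow> nonneg_mat (w u)"
  shows "cone_sum {perron_vec (infsum w V) | V. V \<subseteq> U \<and> w summable_on V \<and> pos_mat (infsum w V)} \<subseteq> S"
proof
  fix x assume "x \<in> cone_sum {perron_vec (infsum w V) | V. V \<subseteq> U \<and> w summable_on V \<and> pos_mat (infsum w V)}"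
  then obtain F s where F: "x = (\<Sum>q\<in>F. s q *\<^sub>R q)" "finite F" "\<And>q. q \<in> F \<Longrightarrow> 0 \<le> s q"
    "\<And>q. q \<in> F \<Longrightarrow> \<exists>V. q = perron_vec (infsum w V) \<and> V \<subseteq> U \<and> w summable_on V \<and> pos_mat (infsum w V)"
    unfolding cone_sum_def by blast
  then obtain V where VF: "\<And>q. q \<in> F \<Longrightarrow> q = perron_vec (infsum w (V q)) \<and> V q \<subseteq> U \<and> w summable_on V q \<and> pos_mat (infsum w (V q))"
    by metis
  then have V: "\<And>q. q \<in> F \<Longrightarrow> V q \<subseteq> U" "\<And>q. q \<in> F \<Longrightarrow> w summable_on V q"
    "\<And>q. q \<in> F \<Longrightarrow> pos_mat (infsum w (V q))" by auto
  have "\<exists>X. (\<forall>n. finite (X n)) \<and> (\<forall>n. X n \<subseteq> V q) \<and> (\<forall>n. \<forall>u\<in>X n. w u \<noteq> 0) \<and>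
    (\<lambda>n. sum w (X n)) \<longlonglongrightarrow> infsum w (V q)" if "q \<in> F" for q
    using has_sum_finite_approx[OF V(2)[OF that]] by metis
  then obtain X where X: "\<And>q n. q \<in> F \<Longrightarrow> finite (X q n)" "\<And>q n. q \<in> F \<Longrightarrow> X q n \<subseteq> V q"
    "\<And>q n u. q \<in> F \<Longrightarrow> u \<in> X q n \<Longrightarrow> w u \<noteq> 0" "\<And>q. q \<in> F \<Longrightarrow> (\<lambda>n. sum w (X q n)) \<longlonglongrightarrow> infsum w (V q)"
    by metis
  have "\<forall>\<^sub>F n in sequentially. pos_mat (sum w (X q n))" if "q \<in> F" for q
    using topological_tendstoD[OF X(4)[OF that] open_pos_mat] V(3)[OF that] by simp
  then have ev: "\<forall>\<^sub>F n in sequentially. \<forall>q\<in>F. pos_mat (sum w (X q n))"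
    by (intro eventually_ball_finite F(2)) auto
  define y where "y = (\<lambda>n. \<Sum>q\<in>F. s q *\<^sub>R perron_vec (sum w (X q n)))"
  have "\<forall>\<^sub>F n in sequentially. y n \<in> S"
    using ev
  proof eventually_elim
    fix n assume pos: "\<forall>q\<in>F. pos_mat (sum w (X q n))"
    let ?V = "(\<lambda>q. X q n) ` F"
    \<comment> \<open>Different rays may be approximated through the same finite set; their
      coefficients are then added.\<close>
    have "(\<Sum>V\<in>?V. (\<Sum>q\<in>{q\<in>F. X q n = V}. s q) *\<^sub>R perron_vec (sum w V)) \<in> S"
    proof (rule perron_cone_finite[where W = "\<Union>?V"])
      have sub: "\<Union>?V \<subseteq> U" using X(2) V(1) by blast
      then show "admissible S (\<Union>?V) w" using X(1) F(2) by (intro adm) auto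
      show "nonneg_mat (w u)" if "u \<in> \<Union>?V" for u using sub that nn by blast
    qed (use X(3) F(2,3) pos in \<open>auto intro!: sum_nonneg\<close>)
    also have "(\<Sum>V\<in>?V. (\<Sum>q\<in>{q\<in>F. X q n = V}. s q) *\<^sub>R perron_vec (sum w V)) = y n"
      unfolding y_def scaleR_sum_left
      by (subst sum.image_gen[OF F(2), of _ "\<lambda>q. X q n"]) (auto intro!: sum.cong)
    finally show "y n \<in> S" .
  qed
  moreover have "y \<longlonglongrightarrow> (\<Sum>q\<in>F. s q *\<^sub>R perron_vec (infsum w (V q)))"
    unfolding y_def using X(4) V(3) by (intro tendsto_intros tendsto_perron_vec) auto
  moreover have "(\<Sum>q\<in>F. s q *\<^sub>R perron_vec (infsum w (V q))) = x"
    unfolding F(1)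
  proof (rule sum.cong)
    show "s q *\<^sub>R perron_vec (infsum w (V q)) = s q *\<^sub>R q" if "q \<in> F" for q
      using VF[OF that] by metis
  qed simp
  ultimately show "x \<in> S" using Lim_in_closed_set[OF closed_S, of y sequentially] by simp
qed

end

section \<open>Supports of measures\<close>

lemma closed_supp_measure: "closed (supp_measure \<nu>)"
proof -
  have "- supp_measure \<nu> = \<Union>{S. open S \<and> emeasure \<nu> S = 0}"
    by (auto simp: supp_measure_def)
  then have "open (- supp_measure \<nu>)" by auto
  then show ?thesis by (simp add: closed_def)
qed

text \<open>The complement of the support is a union of open null sets, which a countable basis
  reduces to countably many.\<close>

lemma AE_supp_measure:
  fixes \<nu> :: "'a::second_countable_topology measure"
  assumes [simp]: "sets \<nu> = sets borel"
  shows "AE x in \<nu>. x \<in> supp_measure \<nu>"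
proof -
  obtain B :: "'a set set" where B: "countable B" "topological_basis B"
    using ex_countable_basis by blast
  define B0 where "B0 = {b\<in>B. emeasure \<nu> b = 0}"
  have "AE x in \<nu>. \<forall>b\<in>B0. x \<notin> b"
  proof (rule AE_ball_countable')
    show "countable B0" using B by (auto simp: B0_def)
    fix b assume b: "b \<in> B0"
    then have "b \<in> null_sets \<nu>" using topological_basis_open[OF B(2)] by (auto simp: B0_def null_sets_def)
    then show "AE x in \<nu>. x \<notin> b" by (rule AE_not_in)
  qed
  then show ?thesis
  proof eventually_elim
    fix x assume x: "\<forall>b\<in>B0. x \<notin> b"
    show "x \<in> supp_measure \<nu>"
      unfolding supp_measure_def
    proof (clarsimp)
      fix S assume S: "open S" "x \<in> S"
      then obtain b where b: "b \<in> B" "x \<in> b" "b \<subseteq> S" using B(2) by (auto elim: topological_basisE)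
      then have "emeasure \<nu> b \<noteq> 0" using x by (auto simp: B0_def)
      moreover have "emeasure \<nu> b \<le> emeasure \<nu> S" using b S by (intro emeasure_mono) auto
      ultimately show "0 < emeasure \<nu> S" by (auto simp: zero_less_iff_neq_zero)
    qed
  qed
qed

lemma supp_measure_subset:
  assumes [simp]: "sets \<nu> = sets borel" and "closed C" "AE x in \<nu>. x \<in> C"
  shows "supp_measure \<nu> \<subseteq> C"
proof
  fix x assume x: "x \<in> supp_measure \<nu>"
  show "x \<in> C"
  proof (rule ccontr)
    assume "x \<notin> C"
    then have "emeasure \<nu> (- C) > 0" using x assms(2) by (auto simp: supp_measure_def)
    moreover have "emeasure \<nu> (- C) = 0"
      using assms by (subst AE_iff_measurable[symmetric, where P = "\<lambda>x. x \<in> C"])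
        (auto simp: sets_eq_imp_space_eq[OF assms(1)])
    ultimately show False by simp
  qed
qed

text \<open>Equality case shared by the two maximum arguments, \<open>AE_inner_pos\<close> and
  \<open>constant_functional\<close>: the nonnegative function \<open>c - X\<close> has integral
  0.\<close>

lemma AE_eq_of_nn_integral_ge:
  assumes "prob_space \<nu>" and X: "X \<in> borel_measurable \<nu>" and le: "AE x in \<nu>. X x \<le> ennreal c"
    and ge: "ennreal c \<le> (\<integral>\<^sup>+x. X x \<partial>\<nu>)"
  shows "AE x in \<nu>. X x = ennreal c"
proof -
  interpret prob_space \<nu> by fact
  have "(\<integral>\<^sup>+x. X x \<partial>\<nu>) \<le> (\<integral>\<^sup>+x. ennreal c \<partial>\<nu>)" by (rule nn_integral_mono_AE[OF le])
  then have le': "(\<integral>\<^sup>+x. X x \<partial>\<nu>) \<le> ennreal c" by (simp add: emeasure_space_1)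
  have "(\<integral>\<^sup>+x. ennreal c - X x \<partial>\<nu>) = (\<integral>\<^sup>+x. ennreal c \<partial>\<nu>) - (\<integral>\<^sup>+x. X x \<partial>\<nu>)"
  proof (rule nn_integral_diff)
    show "(\<integral>\<^sup>+x. X x \<partial>\<nu>) \<noteq> \<infinity>" using le' by (metis ennreal_neq_top top.extremum_unique infinity_ennreal_def)
  qed (use X le in auto)
  also have "\<dots> = 0" using ge by (simp add: emeasure_space_1 diff_eq_0_iff_ennreal)
  finally have "AE x in \<nu>. ennreal c - X x = 0" using X by (subst (asm) nn_integral_0_iff_AE) auto
  with le show ?thesis
    by eventually_elim (auto simp: diff_eq_0_iff_ennreal)
qed

section \<open>The smoothing equation\<close>

text \<open>\<open>numN\<close> as a function of the sequence alone, so that the right-hand side of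
  the equation becomes a measurable function of the pair \<open>(A, Zs)\<close> and Fubini
  applies.\<close>

definition seqN :: "(nat \<Rightarrow> real^'d^'d) \<Rightarrow> nat" where
  "seqN a = card {i. a i \<noteq> 0}"

lemma numN_eq_seqN: "numN A \<omega> = seqN (A \<omega>)"
  by (simp add: numN_def seqN_def)

lemma measurable_seqN [measurable]: "seqN \<in> measurable borel (count_space UNIV)"
  unfolding seqN_def
proof (rule measurable_card)
  fix i
  have "open {a :: nat \<Rightarrow> real^'d^'d. a i \<noteq> 0}"
    by (intro open_Collect_neq continuous_intros) auto
  then show "{a \<in> space borel. i \<in> {i. (a :: nat \<Rightarrow> real^'d^'d) i \<noteq> 0}} \<in> sets borel" by simp
qed

definition branch_sum :: "(nat \<Rightarrow> real^'d^'d) \<Rightarrow> (nat \<Rightarrow> real^'d) \<Rightarrow> real^'d" where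
  "branch_sum a z = (\<Sum>i<seqN a. a i *v z i)"

lemma measurable_matrix_vector_mult [measurable (raw)]:
  fixes f :: "'a \<Rightarrow> real^'n^'m" and g :: "'a \<Rightarrow> real^'n"
  assumes "f \<in> borel_measurable M" "g \<in> borel_measurable M"
  shows "(\<lambda>x. f x *v g x) \<in> borel_measurable M"
proof (rule borel_measurable_continuous_Pair[OF assms])
  show "continuous_on UNIV (\<lambda>x :: (real^'n^'m) \<times> (real^'n). fst x *v snd x)" by (intro continuous_intros)
qed

lemma continuous_on_vector_matrix_mult [continuous_intros]:
  fixes f :: "'a::topological_space \<Rightarrow> real^'n^'m"
  assumes "continuous_on S g" "continuous_on S f"
  shows "continuous_on S (\<lambda>x. g x v* f x)"
  unfolding vector_matrix_mult_def
  by (intro continuous_on_vec_lambda continuous_intros assms)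

lemma measurable_vector_matrix_mult [measurable (raw)]:
  fixes f :: "'a \<Rightarrow> real^'n^'m"
  assumes "f \<in> borel_measurable M" "g \<in> borel_measurable M"
  shows "(\<lambda>x. g x v* f x) \<in> borel_measurable M"
proof (rule borel_measurable_continuous_Pair[OF assms])
  show "continuous_on UNIV (\<lambda>x :: (real^'n^'m) \<times> (real^'m). snd x v* fst x)" by (intro continuous_intros)
qed

lemma measurable_branch_sum [measurable]:
  "(\<lambda>p :: (nat \<Rightarrow> real^'d^'d) \<times> (nat \<Rightarrow> real^'d). branch_sum (fst p) (snd p))
    \<in> borel_measurable (borel \<Otimes>\<^sub>M borel)"
proof -
  let ?M = "borel \<Otimes>\<^sub>M borel :: ((nat \<Rightarrow> real^'d^'d) \<times> (nat \<Rightarrow> real^'d)) measure"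
  have [measurable]: "(\<lambda>p. fst p i) \<in> borel_measurable ?M" "(\<lambda>p. snd p i) \<in> borel_measurable ?M" for i
    by (rule measurable_compose[OF measurable_fst measurable_product_coordinates]
        measurable_compose[OF measurable_snd measurable_product_coordinates])+
  have "(\<lambda>p. \<Sum>i<n. fst p i *v snd p i) \<in> borel_measurable ?M" for n
    by (intro borel_measurable_sum measurable_matrix_vector_mult) measurable
  moreover have "(\<lambda>p. seqN (fst p)) \<in> measurable ?M (count_space UNIV)" by measurable
  ultimately show ?thesis
    unfolding branch_sum_def by (rule measurable_compose_countable)
qed

lemma inner_branch_sum: "psi \<bullet> branch_sum a z = (\<Sum>i<seqN a. (psi v* a i) \<bullet> z i)"
  by (simp add: branch_sum_def inner_sum_right dot_lmul_matrix)

text \<open>The two trees are kept out of the locale; they appear as explicit assumptions in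
  \<open>zero_in_S\<close> and \<open>cone_sum_subset_support\<close>.\<close>

locale smoothing = prob_space M
  for M :: "'w measure" and A :: "'w \<Rightarrow> nat \<Rightarrow> real^'d^'d" and Z :: "'w \<Rightarrow> real^'d"
    and Zs :: "'w \<Rightarrow> nat \<Rightarrow> real^'d" +
  assumes A_meas [measurable]: "A \<in> borel_measurable M"
    and A_struct: "AE \<omega> in M. finite {i. A \<omega> i \<noteq> 0} \<and> (\<forall>i. A \<omega> i \<noteq> 0 \<longleftrightarrow> i < numN A \<omega>)"
    and N_ge1: "AE \<omega> in M. numN A \<omega> \<ge> 1"
    and A_nonneg: "AE \<omega> in M. \<forall>i. nonneg_mat (A \<omega> i)"
    and EN_gt1: "1 < (\<integral>\<^sup>+\<omega>. of_nat (numN A \<omega>) \<partial>M)"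
    and EN_fin: "(\<integral>\<^sup>+\<omega>. of_nat (numN A \<omega>) \<partial>M) < \<infinity>"
    and Gamma_rows_cols: "\<forall>a\<in>semigrp (supp_measure (mu_meas M A)).
                (\<forall>i. \<exists>j. a $ i $ j > 0) \<and> (\<forall>j. \<exists>i. a $ i $ j > 0)"
    and Gamma_pos: "\<exists>a\<in>semigrp (supp_measure (mu_meas M A)). pos_mat a"
    and Z_meas [measurable]: "Z \<in> borel_measurable M"
    and Z_nonneg: "\<forall>\<omega>. nonneg_vec (Z \<omega>)"
    and Zs_meas [measurable]: "Zs \<in> borel_measurable M"
    and Zs_indep: "indep_vars (\<lambda>_. borel) (\<lambda>i \<omega>. Zs \<omega> i) UNIV"
    and Zs_distr: "\<forall>i. distr M borel (\<lambda>\<omega>. Zs \<omega> i) = distr M borel Z"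
    and A_Zs_indep: "indep_set {A -` S \<inter> space M | S. S \<in> sets borel}
                 {Zs -` S \<inter> space M | S. S \<in> sets borel}"
    and fixed_point: "distr M borel Z
                 = distr M borel (\<lambda>\<omega>. \<Sum>i<numN A \<omega>. A \<omega> i *v Zs \<omega> i)"
    and Z_nonzero: "measure M {\<omega>\<in>space M. Z \<omega> = 0} = 0"
begin

section \<open>The equation in terms of laws and supports\<close>

definition "zeta = distr M borel Z"
definition "PZ = distr M borel Zs"
definition "S = supp_measure zeta"
definition "mu = mu_meas M A"
definition "\<Gamma> = semigrp (supp_measure mu)"
definition "EN = (\<integral>\<^sup>+\<omega>. of_nat (numN A \<omega>) \<partial>M)"

lemma sets_zeta [simp, measurable_cong]: "sets zeta = sets borel"
  by (simp add: zeta_def)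

lemma space_zeta [simp]: "space zeta = UNIV"
  by (simp add: zeta_def)

lemma sets_PZ [simp, measurable_cong]: "sets PZ = sets borel"
  by (simp add: PZ_def)

sublocale zeta: prob_space zeta
  unfolding zeta_def by (rule prob_space_distr) simp

sublocale PZ: prob_space PZ
  unfolding PZ_def by (rule prob_space_distr) simp

lemma measurable_numN [measurable]: "(\<lambda>\<omega>. numN A \<omega>) \<in> measurable M (count_space UNIV)"
  unfolding numN_eq_seqN by measurable

lemma Zs_component_measurable [measurable]: "(\<lambda>\<omega>. Zs \<omega> i) \<in> borel_measurable M"
  by (rule measurable_compose[OF Zs_meas]) measurable

lemma A_component_measurable [measurable]: "(\<lambda>\<omega>. A \<omega> i) \<in> borel_measurable M"
  by (rule measurable_compose[OF A_meas]) measurable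

lemma closed_S: "closed S"
  unfolding S_def by (rule closed_supp_measure)

lemma AE_S: "AE x in zeta. x \<in> S"
  unfolding S_def by (rule AE_supp_measure) simp

lemma S_subset: "closed C \<Longrightarrow> AE x in zeta. x \<in> C \<Longrightarrow> S \<subseteq> C"
  unfolding S_def by (rule supp_measure_subset) simp_all

lemma AE_zeta_nonneg: "AE x in zeta. 0 \<le> x"
  unfolding zeta_def using Z_nonneg by (subst AE_distr_iff) (auto simp: nonneg_vec_iff)

lemma S_nonneg: "z \<in> S \<Longrightarrow> 0 \<le> z"
  using S_subset[of "{x. 0 \<le> x}"] AE_zeta_nonneg by auto

lemma S_nonempty: "S \<noteq> {}"
proof
  assume "S = {}"
  then have "AE x in zeta. False" using AE_S by simp
  then show False using zeta.AE_False by simp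
qed

lemma joint_law: "distr M (borel \<Otimes>\<^sub>M borel) (\<lambda>\<omega>. (A \<omega>, Zs \<omega>)) = distr M borel A \<Otimes>\<^sub>M PZ"
proof -
  have indep: "emeasure M (A -` X \<inter> space M) * emeasure M (Zs -` Y \<inter> space M)
      = emeasure M ((\<lambda>\<omega>. (A \<omega>, Zs \<omega>)) -` (X \<times> Y) \<inter> space M)"
    if "X \<in> sets borel" "Y \<in> sets borel" for X Y
  proof -
    have "prob ((A -` X \<inter> space M) \<inter> (Zs -` Y \<inter> space M)) = prob (A -` X \<inter> space M) * prob (Zs -` Y \<inter> space M)"
      by (rule indep_setD[OF A_Zs_indep]) (use that in auto)
    moreover have "(\<lambda>\<omega>. (A \<omega>, Zs \<omega>)) -` (X \<times> Y) \<inter> space M = (A -` X \<inter> space M) \<inter> (Zs -` Y \<inter> space M)" by auto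
    ultimately show ?thesis by (simp add: emeasure_eq_measure ennreal_mult)
  qed
  interpret PA: prob_space "distr M borel A" by (rule prob_space_distr) simp
  show ?thesis
  proof (rule pair_measure_eqI[symmetric])
    show "sigma_finite_measure (distr M borel A)" "sigma_finite_measure PZ" by unfold_locales
    fix X Y assume XY: "X \<in> sets (distr M borel A)" "Y \<in> sets PZ"
    then have "X \<times> Y \<in> sets (borel \<Otimes>\<^sub>M borel)" by auto
    with XY show "emeasure (distr M borel A) X * emeasure PZ Y
        = emeasure (distr M (borel \<Otimes>\<^sub>M borel) (\<lambda>\<omega>. (A \<omega>, Zs \<omega>))) (X \<times> Y)"
      using indep[of X Y] by (simp add: PZ_def emeasure_distr)
  qed (simp add: PZ_def cong: sets_pair_measure_cong)
qed
lemma measurable_branch_integral: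
  assumes [measurable]: "f \<in> borel_measurable borel"
  shows "(\<lambda>\<omega>. \<integral>\<^sup>+z. f (branch_sum (A \<omega>) z) \<partial>PZ) \<in> borel_measurable M"
proof -
  have "(\<lambda>p. f (branch_sum (fst p) (snd p))) \<in> borel_measurable (borel \<Otimes>\<^sub>M PZ)"
    by measurable
  from PZ.borel_measurable_nn_integral_fst[OF this] show ?thesis
    by (intro measurable_compose[OF A_meas]) simp
qed

text \<open>The fixed-point equation in the form in which it is used: for given matrices, the
  vectors are integrated against the law of the whole sequence of copies.\<close>

lemma nn_integral_zeta:
  assumes [measurable]: "f \<in> borel_measurable borel"
  shows "(\<integral>\<^sup>+x. f x \<partial>zeta) = (\<integral>\<^sup>+\<omega>. (\<integral>\<^sup>+z. f (branch_sum (A \<omega>) z) \<partial>PZ) \<partial>M)"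
proof -
  have "zeta = distr M borel (\<lambda>\<omega>. branch_sum (A \<omega>) (Zs \<omega>))"
    unfolding zeta_def fixed_point branch_sum_def numN_eq_seqN ..
  also have "\<dots> = distr (distr M (borel \<Otimes>\<^sub>M borel) (\<lambda>\<omega>. (A \<omega>, Zs \<omega>))) borel (\<lambda>p. branch_sum (fst p) (snd p))"
    by (subst distr_distr) (auto simp: comp_def)
  finally have "(\<integral>\<^sup>+x. f x \<partial>zeta) = (\<integral>\<^sup>+p. f (branch_sum (fst p) (snd p)) \<partial>(distr M borel A \<Otimes>\<^sub>M PZ))"
    unfolding joint_law by (simp add: nn_integral_distr)
  also have "\<dots> = (\<integral>\<^sup>+a. (\<integral>\<^sup>+z. f (branch_sum a z) \<partial>PZ) \<partial>distr M borel A)"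
    by (subst PZ.nn_integral_fst[symmetric]) simp_all
  also have "\<dots> = (\<integral>\<^sup>+\<omega>. (\<integral>\<^sup>+z. f (branch_sum (A \<omega>) z) \<partial>PZ) \<partial>M)"
    by (rule nn_integral_distr) measurable
  finally show ?thesis .
qed

lemma AE_branch:
  assumes "AE x in zeta. P x" "Measurable.pred borel P"
  shows "AE \<omega> in M. AE z in PZ. P (branch_sum (A \<omega>) z)"
proof -
  note [measurable] = assms(2)
  have "(\<integral>\<^sup>+x. indicator {x. \<not> P x} x \<partial>zeta) = 0"
    using assms(1) by (subst nn_integral_0_iff_AE) (auto elim: eventually_mono)
  then have "(\<integral>\<^sup>+\<omega>. (\<integral>\<^sup>+z. indicator {x. \<not> P x} (branch_sum (A \<omega>) z) \<partial>PZ) \<partial>M) = 0"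
    by (subst (asm) nn_integral_zeta) auto
  then have "AE \<omega> in M. (\<integral>\<^sup>+z. indicator {x. \<not> P x} (branch_sum (A \<omega>) z) \<partial>PZ) = 0"
    by (subst (asm) nn_integral_0_iff_AE) (auto intro!: measurable_branch_integral)
  then show ?thesis
  proof eventually_elim
    fix \<omega> assume *: "(\<integral>\<^sup>+z. indicator {x. \<not> P x} (branch_sum (A \<omega>) z) \<partial>PZ) = (0::ennreal)"
    have "(\<lambda>z. branch_sum (A \<omega>) z) \<in> borel_measurable PZ" unfolding branch_sum_def by measurable
    then have "AE z in PZ. indicator {x. \<not> P x} (branch_sum (A \<omega>) z) = (0::ennreal)"
      using * by (subst (asm) nn_integral_0_iff_AE) auto
    then show "AE z in PZ. P (branch_sum (A \<omega>) z)"
      by eventually_elim (auto simp: indicator_def split: if_splits)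
  qed
qed

lemma PZ_prod:
  assumes [measurable]: "\<And>i. f i \<in> borel_measurable borel"
  shows "(\<integral>\<^sup>+z. (\<Prod>i<n. f i (z i)) \<partial>PZ) = (\<Prod>i<n. \<integral>\<^sup>+x. f i x \<partial>zeta)"
proof -
  have "(\<integral>\<^sup>+z. (\<Prod>i<n. f i (z i)) \<partial>PZ) = (\<integral>\<^sup>+\<omega>. (\<Prod>i<n. f i (Zs \<omega> i)) \<partial>M)"
    unfolding PZ_def by (subst nn_integral_distr) auto
  also have "\<dots> = (\<Prod>i<n. \<integral>\<^sup>+\<omega>. f i (Zs \<omega> i) \<partial>M)"
  proof (rule indep_vars_nn_integral)
    have "indep_vars (\<lambda>_. borel) (\<lambda>i \<omega>. f i (Zs \<omega> i)) UNIV"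
      by (rule indep_vars_compose2[OF Zs_indep]) simp
    then show "indep_vars (\<lambda>_. borel) (\<lambda>i \<omega>. f i (Zs \<omega> i)) {..<n}"
      by (rule indep_vars_subset) simp
  qed auto
  also have "\<dots> = (\<Prod>i<n. \<integral>\<^sup>+x. f i x \<partial>zeta)"
  proof (rule prod.cong[OF refl])
    fix i
    have "zeta = distr M borel (\<lambda>\<omega>. Zs \<omega> i)" using Zs_distr by (simp add: zeta_def)
    then show "(\<integral>\<^sup>+\<omega>. f i (Zs \<omega> i) \<partial>M) = (\<integral>\<^sup>+x. f i x \<partial>zeta)"
      by (simp add: nn_integral_distr)
  qed
  finally show ?thesis .
qed

lemma AE_PZ:
  assumes "AE x in zeta. P x" "Measurable.pred borel P"
  shows "AE z in PZ. \<forall>i. P (z i)"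
proof -
  have "AE \<omega> in M. P (Zs \<omega> i)" for i
  proof -
    have "zeta = distr M borel (\<lambda>\<omega>. Zs \<omega> i)" using Zs_distr by (simp add: zeta_def)
    then have "AE x in distr M borel (\<lambda>\<omega>. Zs \<omega> i). P x" using assms(1) by metis
    then show ?thesis by (rule AE_distrD[rotated]) simp
  qed
  then have "AE \<omega> in M. \<forall>i. P (Zs \<omega> i)" by (simp add: AE_all_countable)
  moreover have "Measurable.pred borel (\<lambda>z. \<forall>i. P ((z :: nat \<Rightarrow> real^'d) i))"
    using assms(2) by measurable
  ultimately show ?thesis
    unfolding PZ_def by (subst AE_distr_iff) (auto simp: pred_def)
qed

text \<open>A basic neighbourhood in the product topology restricts finitely many coordinates only,
  and by independence its probability is a product of finitely many positive numbers.\<close>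

lemma PZ_support:
  assumes z: "\<And>i. z i \<in> S" and C: "closed C" "AE y in PZ. y \<in> C"
  shows "z \<in> C"
proof (rule ccontr)
  assume "z \<notin> C"
  then have "openin (product_topology (\<lambda>i. euclidean) UNIV) (- C)" "z \<in> - C"
    using C(1) by (auto simp: open_fun_def[symmetric] closed_def)
  from product_topology_open_contains_basis[OF this]
  obtain X where X: "z \<in> (\<Pi>\<^sub>E i\<in>UNIV. X i)" "\<And>i. open (X i)" "finite {i. X i \<noteq> UNIV}" "(\<Pi>\<^sub>E i\<in>UNIV. X i) \<subseteq> - C"
    by auto
  obtain n where n: "\<And>i. X i \<noteq> UNIV \<Longrightarrow> i < n"
    using X(3) finite_nat_set_iff_bounded by auto
  have "AE y in PZ. (\<Prod>i<n. indicator (X i) (y i) :: ennreal) = 0"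
    using C(2)
  proof eventually_elim
    fix y assume "y \<in> C"
    then have "y \<notin> (\<Pi>\<^sub>E i\<in>UNIV. X i)" using X(4) by blast
    then obtain i where "y i \<notin> X i" by (auto simp: PiE_UNIV_domain)
    moreover from this have "i < n" using n by blast
    ultimately show "(\<Prod>i<n. indicator (X i) (y i) :: ennreal) = 0"
      by (intro prod_zero bexI[of _ i]) auto
  qed
  then have "(\<integral>\<^sup>+y. (\<Prod>i<n. indicator (X i) (y i)) \<partial>PZ) = (0::ennreal)"
    by (subst nn_integral_cong_AE[where v = "\<lambda>_. 0"]) auto
  then have "(\<Prod>i<n. emeasure zeta (X i)) = 0"
    using X(2) by (subst (asm) PZ_prod) (auto simp: nn_integral_indicator)
  then obtain i where "emeasure zeta (X i) = 0" by auto
  moreover have "z i \<in> X i" using X(1) by auto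
  ultimately show False using z[of i] X(2)[of i] by (auto simp: S_def supp_measure_def)
qed

text \<open>The exceptional null set must not depend on \<open>z\<close>. For a fixed good
  \<open>\<omega>\<close>, \<open>branch_sum\<close> is continuous in \<open>z\<close>, so the
  preimage of \<open>S\<close> is closed and of full measure, and \<open>PZ_support\<close> covers
  every \<open>z\<close> at once.\<close>

lemma S_branch: "AE \<omega> in M. \<forall>z. (\<forall>i. z i \<in> S) \<longrightarrow> branch_sum (A \<omega>) z \<in> S"
proof -
  have "Measurable.pred borel (\<lambda>x. x \<in> S)" using closed_S by (simp add: pred_def)
  from AE_branch[OF AE_S this] show ?thesis
  proof eventually_elim
    fix \<omega> assume ae: "AE z in PZ. branch_sum (A \<omega>) z \<in> S"
    show "\<forall>z. (\<forall>i. z i \<in> S) \<longrightarrow> branch_sum (A \<omega>) z \<in> S"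
    proof (intro allI impI)
      fix z :: "nat \<Rightarrow> real^'d" assume z: "\<forall>i. z i \<in> S"
      have "closed ((\<lambda>z. branch_sum (A \<omega>) z) -` S)"
        unfolding branch_sum_def by (intro closed_vimage closed_S continuous_intros) auto
      then have "z \<in> (\<lambda>z. branch_sum (A \<omega>) z) -` S"
        using z ae by (intro PZ_support) auto
      then show "branch_sum (A \<omega>) z \<in> S" by simp
    qed
  qed
qed

text \<open>For functions that turn sums into products, as the indicator of
  \<open>psi \<bullet> x = 0\<close> and the exponential do. Measurability of the product in
  \<open>\<omega>\<close> is part of the conclusion because the equality cases need it.\<close>

lemma nn_integral_zeta_prod:
  assumes f [measurable]: "f \<in> borel_measurable borel"
    and g [measurable]: "(\<lambda>p. g (fst p) (snd p)) \<in> borel_measurable (borel \<Otimes>\<^sub>M borel)"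
    and eq: "AE \<omega> in M. AE z in PZ. f (branch_sum (A \<omega>) z) = (\<Prod>i<numN A \<omega>. g (A \<omega> i) (z i))"
  shows "(\<integral>\<^sup>+x. f x \<partial>zeta) = (\<integral>\<^sup>+\<omega>. (\<Prod>i<numN A \<omega>. \<integral>\<^sup>+x. g (A \<omega> i) x \<partial>zeta) \<partial>M)"
    and "(\<lambda>\<omega>. \<Prod>i<numN A \<omega>. \<integral>\<^sup>+x. g (A \<omega> i) x \<partial>zeta) \<in> borel_measurable M"
proof -
  have gm [measurable]: "g b \<in> borel_measurable borel" for b
    using measurable_compose[OF _ g, of "\<lambda>x. (b, x)" borel] by simp
  have "(\<integral>\<^sup>+x. f x \<partial>zeta) = (\<integral>\<^sup>+\<omega>. (\<integral>\<^sup>+z. f (branch_sum (A \<omega>) z) \<partial>PZ) \<partial>M)"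
    by (rule nn_integral_zeta[OF f])
  also have "\<dots> = (\<integral>\<^sup>+\<omega>. (\<Prod>i<numN A \<omega>. \<integral>\<^sup>+x. g (A \<omega> i) x \<partial>zeta) \<partial>M)"
  proof (rule nn_integral_cong_AE)
    show "AE \<omega> in M. (\<integral>\<^sup>+z. f (branch_sum (A \<omega>) z) \<partial>PZ) = (\<Prod>i<numN A \<omega>. \<integral>\<^sup>+x. g (A \<omega> i) x \<partial>zeta)"
      using eq
    proof eventually_elim
      fix \<omega> assume "AE z in PZ. f (branch_sum (A \<omega>) z) = (\<Prod>i<numN A \<omega>. g (A \<omega> i) (z i))"
      then have "(\<integral>\<^sup>+z. f (branch_sum (A \<omega>) z) \<partial>PZ) = (\<integral>\<^sup>+z. (\<Prod>i<numN A \<omega>. g (A \<omega> i) (z i)) \<partial>PZ)"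
        by (rule nn_integral_cong_AE)
      also have "\<dots> = (\<Prod>i<numN A \<omega>. \<integral>\<^sup>+x. g (A \<omega> i) x \<partial>zeta)"
        by (rule PZ_prod[where f = "\<lambda>i. g (A \<omega> i)"]) (rule gm)
      finally show "(\<integral>\<^sup>+z. f (branch_sum (A \<omega>) z) \<partial>PZ) = (\<Prod>i<numN A \<omega>. \<integral>\<^sup>+x. g (A \<omega> i) x \<partial>zeta)" .
    qed
  qed
  finally show "(\<integral>\<^sup>+x. f x \<partial>zeta) = (\<integral>\<^sup>+\<omega>. (\<Prod>i<numN A \<omega>. \<integral>\<^sup>+x. g (A \<omega> i) x \<partial>zeta) \<partial>M)" .
  have "(\<lambda>p. g (fst p) (snd p)) \<in> borel_measurable (borel \<Otimes>\<^sub>M zeta)"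
    using g measurable_cong_sets[OF sets_pair_measure_cong[OF refl sets_zeta] refl] by blast
  from zeta.borel_measurable_nn_integral_fst[OF this]
  have [measurable]: "(\<lambda>b. \<integral>\<^sup>+x. g b x \<partial>zeta) \<in> borel_measurable borel" by simp
  show "(\<lambda>\<omega>. \<Prod>i<numN A \<omega>. \<integral>\<^sup>+x. g (A \<omega> i) x \<partial>zeta) \<in> borel_measurable M"
    by (rule measurable_compose_countable[where g = "\<lambda>\<omega>. numN A \<omega>"]) measurable
qed

section \<open>The intensity measure and its semigroup\<close>

lemma EN_bounds: "1 < EN" "EN < \<infinity>" "EN \<noteq> 0" "EN \<noteq> \<infinity>"
  using EN_gt1 EN_fin by (auto simp: EN_def)

text \<open>Since \<open>E N > 1\<close>, the event \<open>N \<ge> 2\<close> is not null and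
  therefore meets every almost sure event.\<close>

lemma ex_two:
  assumes "AE \<omega> in M. P \<omega>"
  obtains \<omega> where "P \<omega>" "2 \<le> numN A \<omega>"
proof -
  have "\<exists>\<omega>. P \<omega> \<and> 2 \<le> numN A \<omega>"
  proof (rule ccontr)
    assume *: "\<nexists>\<omega>. P \<omega> \<and> 2 \<le> numN A \<omega>"
    have "AE \<omega> in M. (of_nat (numN A \<omega>) :: ennreal) \<le> 1"
      using assms
    proof eventually_elim
      fix \<omega> assume "P \<omega>"
      then have "numN A \<omega> \<le> 1" using * by (metis not_less_eq_eq one_add_one plus_1_eq_Suc)
      then show "(of_nat (numN A \<omega>) :: ennreal) \<le> 1" by (metis of_nat_1 of_nat_mono)
    qed
    then have "(\<integral>\<^sup>+\<omega>. of_nat (numN A \<omega>) \<partial>M) \<le> (\<integral>\<^sup>+\<omega>. 1 \<partial>M)" by (rule nn_integral_mono_AE)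
    with EN_gt1 show False by (simp add: emeasure_space_1)
  qed
  with that show ?thesis by blast
qed

text \<open>\<open>measure_of\<close> yields the intended values only after countable additivity has
  been verified; monotone convergence and the finiteness of each branching sum provide it.\<close>

lemma emeasure_mu:
  assumes [measurable]: "X \<in> sets borel"
  shows "emeasure mu X = (\<integral>\<^sup>+\<omega>. (\<Sum>i<numN A \<omega>. indicator X (A \<omega> i)) \<partial>M) / EN"
proof -
  have card: "of_nat (card {i. i < numN A \<omega> \<and> A \<omega> i \<in> Y}) = (\<Sum>i<numN A \<omega>. indicator Y (A \<omega> i) :: ennreal)" for Y \<omega>
    by (simp add: indicator_def sum.If_cases Int_def)
  have meas: "(\<lambda>\<omega>. \<Sum>i<numN A \<omega>. indicator Y (A \<omega> i) :: ennreal) \<in> borel_measurable M" if [measurable]: "Y \<in> sets borel" for Y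
    by (rule measurable_compose_countable[where g = "\<lambda>\<omega>. numN A \<omega>"]) measurable
  let ?f = "\<lambda>Y. (\<integral>\<^sup>+\<omega>. (\<Sum>i<numN A \<omega>. indicator Y (A \<omega> i)) \<partial>M) / EN"
  have mu: "mu = measure_of UNIV (sets borel) ?f"
    unfolding mu_def mu_meas_def EN_def card ..
  show ?thesis
  proof (rule emeasure_measure_of[OF mu])
    have sets: "sets mu = sets borel" by (simp add: mu sets.sigma_sets_eq[of borel, simplified])
    show "X \<in> sets mu" by (simp add: sets)
    show "positive (sets mu) ?f" by (simp add: positive_def)
    show "countably_additive (sets mu) ?f"
    proof (rule countably_additiveI)
      fix Y :: "nat \<Rightarrow> (real^'d^'d) set" assume Y: "range Y \<subseteq> sets mu" "disjoint_family Y"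
      have "(\<integral>\<^sup>+\<omega>. (\<Sum>i<numN A \<omega>. indicator (\<Union>(range Y)) (A \<omega> i)) \<partial>M)
          = (\<integral>\<^sup>+\<omega>. (\<Sum>j. \<Sum>i<numN A \<omega>. indicator (Y j) (A \<omega> i)) \<partial>M)"
        by (subst suminf_indicator[OF Y(2), symmetric], subst suminf_sum) auto
      also have "\<dots> = (\<Sum>j. \<integral>\<^sup>+\<omega>. (\<Sum>i<numN A \<omega>. indicator (Y j) (A \<omega> i)) \<partial>M)"
        using Y(1) by (intro nn_integral_suminf meas) (auto simp: sets)
      finally show "(\<Sum>j. ?f (Y j)) = ?f (\<Union>(range Y))"
        by (simp add: divide_ennreal_def)
    qed
  qed auto
qed

lemma sets_mu [simp, measurable_cong]: "sets mu = sets borel"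
  by (simp add: mu_def mu_meas_def sets.sigma_sets_eq[of borel, simplified])

lemma space_mu [simp]: "space mu = UNIV"
  using sets_eq_imp_space_eq[OF sets_mu] by simp

lemma measurable_branch_total:
  assumes [measurable]: "f \<in> borel_measurable borel"
  shows "(\<lambda>\<omega>. \<Sum>i<numN A \<omega>. f (A \<omega> i) :: ennreal) \<in> borel_measurable M"
  by (rule measurable_compose_countable[where g = "\<lambda>\<omega>. numN A \<omega>"]) measurable

text \<open>The many-to-one formula: indicators are \<open>emeasure_mu\<close>, the rest is
  measurable induction.\<close>

lemma nn_integral_mu:
  assumes "f \<in> borel_measurable borel"
  shows "(\<integral>\<^sup>+a. f a \<partial>mu) = (\<integral>\<^sup>+\<omega>. (\<Sum>i<numN A \<omega>. f (A \<omega> i)) \<partial>M) / EN"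
  using assms
proof (induction rule: borel_measurable_induct)
  case (cong f g)
  then have "f = g" by auto
  with cong show ?case by simp
next
  case (set B)
  then show ?case by (simp add: emeasure_mu)
next
  case (mult u c)
  then show ?case
    by (simp add: nn_integral_cmult sum_distrib_left[symmetric] measurable_branch_total ennreal_times_divide)
next
  case (add u v)
  then show ?case
    by (simp add: nn_integral_add sum.distrib measurable_branch_total divide_ennreal_def distrib_right)
next
  case (seq U)
  have "(\<integral>\<^sup>+a. (SUP n. U n a) \<partial>mu) = (SUP n. \<integral>\<^sup>+a. U n a \<partial>mu)"
    using seq by (intro nn_integral_monotone_convergence_SUP) auto
  also have "\<dots> = (SUP n. (\<integral>\<^sup>+\<omega>. (\<Sum>i<numN A \<omega>. U n (A \<omega> i)) \<partial>M) / EN)" using seq by simp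
  also have "\<dots> = (SUP n. \<integral>\<^sup>+\<omega>. (\<Sum>i<numN A \<omega>. U n (A \<omega> i)) \<partial>M) / EN"
    by (simp add: divide_ennreal_def SUP_mult_right_ennreal)
  also have "(SUP n. \<integral>\<^sup>+\<omega>. (\<Sum>i<numN A \<omega>. U n (A \<omega> i)) \<partial>M) = (\<integral>\<^sup>+\<omega>. (SUP n. \<Sum>i<numN A \<omega>. U n (A \<omega> i)) \<partial>M)"
    using seq by (intro nn_integral_monotone_convergence_SUP[symmetric] measurable_branch_total)
      (auto simp: incseq_def le_fun_def intro!: sum_mono)
  also have "\<dots> = (\<integral>\<^sup>+\<omega>. (\<Sum>i<numN A \<omega>. SUP n. U n (A \<omega> i)) \<partial>M)"
    using seq by (intro nn_integral_cong ennreal_SUP_sum) (auto simp: incseq_def le_fun_def)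
  finally show ?case by (simp add: image_comp)
qed

sublocale mu: prob_space mu
proof
  have "emeasure mu UNIV = (\<integral>\<^sup>+\<omega>. of_nat (numN A \<omega>) \<partial>M) / EN" by (subst emeasure_mu) auto
  then show "emeasure mu (space mu) = 1" using EN_bounds unfolding EN_def[symmetric] by (simp add: less_top)
qed

lemma AE_muD:
  assumes "AE a in mu. P a"
  shows "AE \<omega> in M. \<forall>i<numN A \<omega>. P (A \<omega> i)"
proof -
  obtain X where X: "{a. \<not> P a} \<subseteq> X" "X \<in> sets borel" "emeasure mu X = 0"
    using AE_E[OF assms] by auto
  then have "(\<integral>\<^sup>+\<omega>. (\<Sum>i<numN A \<omega>. indicator X (A \<omega> i)) \<partial>M) = 0"
    using EN_bounds(2) by (auto simp: emeasure_mu ennreal_divide_eq_0_iff)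
  then have "AE \<omega> in M. (\<Sum>i<numN A \<omega>. indicator X (A \<omega> i)) = (0::ennreal)"
    using X(2) by (subst (asm) nn_integral_0_iff_AE) (auto intro: measurable_branch_total)
  then show ?thesis
    by eventually_elim (use X(1) in \<open>auto simp: indicator_def split: if_splits\<close>)
qed

lemma supp_mu_subset:
  assumes "closed C" "AE \<omega> in M. \<forall>i<numN A \<omega>. A \<omega> i \<in> C"
  shows "supp_measure mu \<subseteq> C"
proof (rule supp_measure_subset)
  have "(\<integral>\<^sup>+\<omega>. (\<Sum>i<numN A \<omega>. indicator (- C) (A \<omega> i)) \<partial>M) = (\<integral>\<^sup>+\<omega>. 0 \<partial>M)"
    using assms(2) by (intro nn_integral_cong_AE) (auto elim!: eventually_mono)
  then have "emeasure mu (- C) = 0" using assms(1) by (subst emeasure_mu) auto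
  then show "AE a in mu. a \<in> C"
    using assms(1) by (intro AE_I[of _ _ "- C"]) auto
qed (use assms in auto)

lemma AE_supp_mu: "AE \<omega> in M. \<forall>i<numN A \<omega>. A \<omega> i \<in> supp_measure mu"
  by (rule AE_muD, rule AE_supp_measure) simp

lemma Gamma_mult: "a \<in> \<Gamma> \<Longrightarrow> b \<in> supp_measure mu \<Longrightarrow> a ** b \<in> \<Gamma>"
  unfolding \<Gamma>_def by (rule semigrp.mult)

lemma Gamma_one: "mat 1 \<in> \<Gamma>"
  unfolding \<Gamma>_def by (rule semigrp.one)

lemma supp_mu_Gamma: "b \<in> supp_measure mu \<Longrightarrow> b \<in> \<Gamma>"
  using Gamma_mult[OF Gamma_one] by simp

lemma Gamma_times:
  assumes "a \<in> \<Gamma>" "b \<in> \<Gamma>"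
  shows "a ** b \<in> \<Gamma>"
  using assms(2) unfolding \<Gamma>_def
  by (induction rule: semigrp.induct)
    (use assms(1) in \<open>auto simp: \<Gamma>_def matrix_mul_assoc intro: semigrp.mult\<close>)

lemma supp_mu_nonneg: "b \<in> supp_measure mu \<Longrightarrow> nonneg_mat b"
proof -
  have "closed {b :: real^'d^'d. nonneg_mat b}"
    unfolding nonneg_mat_def by (intro closed_Collect_all closed_Collect_le continuous_intros)
  then have "supp_measure mu \<subseteq> {b. nonneg_mat b}"
    using A_nonneg by (intro supp_mu_subset) (auto elim: eventually_mono)
  then show "b \<in> supp_measure mu \<Longrightarrow> nonneg_mat b" by auto
qed

lemma Gamma_nonneg: "a \<in> \<Gamma> \<Longrightarrow> nonneg_mat a"
  unfolding \<Gamma>_def by (induction rule: semigrp.induct) (auto intro: nonneg_mat_mult supp_mu_nonneg)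

lemma Gamma_row: "a \<in> \<Gamma> \<Longrightarrow> \<exists>j. a $ i $ j > 0"
  using Gamma_rows_cols by (auto simp: \<Gamma>_def mu_def)

lemma Gamma_vm_nonzero:
  assumes "a \<in> \<Gamma>" "0 \<le> psi" "psi \<noteq> 0"
  shows "psi v* a \<noteq> 0"
proof -
  obtain i where "psi $ i \<noteq> 0" using assms(3) by (auto simp: vec_eq_iff)
  then have i: "psi $ i > 0" using assms(2) by (metis less_eq_vec_def order_le_less zero_index)
  obtain j where j: "a $ i $ j > 0" using Gamma_row[OF assms(1)] by blast
  have "0 < a $ i $ j * psi $ i" using i j by simp
  also have "\<dots> \<le> (\<Sum>i\<in>UNIV. a $ i $ j * psi $ i)"
    using assms(2) Gamma_nonneg[OF assms(1)] 
    by (intro member_le_sum mult_nonneg_nonneg) (auto simp: nonneg_mat_def less_eq_vec_def)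
  finally have "0 < (psi v* a) $ j" by (simp add: vector_matrix_mult_def mult.commute)
  then show ?thesis by auto
qed

lemma Gamma_pos': obtains g where "g \<in> \<Gamma>" "pos_mat g"
  using Gamma_pos by (auto simp: \<Gamma>_def mu_def)

lemma pos_mat_vm_pos:
  assumes "pos_mat g" "0 \<le> psi" "psi \<noteq> 0"
  shows "0 < (psi v* g) $ i"
  using pos_mat_vec[of "transpose g" psi i] assms by simp

text \<open>Membership of \<open>b\<^sup>T psi\<close> in a closed set is a closed condition on \<open>b\<close>, so it passes from the
  random matrices to the support of \<open>mu\<close> and then to \<open>\<Gamma>\<close>.\<close>

lemma Gamma_invariant:
  assumes "closed K" and inv: "AE \<omega> in M. \<forall>i<numN A \<omega>. \<forall>psi\<in>K. psi v* A \<omega> i \<in> K"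
    and g: "g \<in> \<Gamma>" "psi \<in> K"
  shows "psi v* g \<in> K"
proof -
  have "closed {b :: real^'d^'d. \<forall>psi\<in>K. psi v* b \<in> K}"
  proof -
    have "{b. \<forall>psi\<in>K. psi v* b \<in> K} = (\<Inter>psi\<in>K. (\<lambda>b. psi v* b) -` K)" by auto
    then show ?thesis using assms(1) by (auto intro!: closed_INT closed_vimage continuous_intros)
  qed
  then have "supp_measure mu \<subseteq> {b. \<forall>psi\<in>K. psi v* b \<in> K}"
    using inv by (intro supp_mu_subset) (auto elim: eventually_mono)
  then have *: "psi v* b \<in> K" if "b \<in> supp_measure mu" "psi \<in> K" for b psi using that by auto
  show ?thesis using g unfolding \<Gamma>_def
    by (induction arbitrary: psi rule: semigrp.induct) (auto simp: vector_matrix_mul_assoc[symmetric] intro: *)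
qed

end

lemma prod_mono_ennreal:
  fixes f g :: "'i \<Rightarrow> ennreal"
  assumes "\<And>i. i \<in> I \<Longrightarrow> f i \<le> g i"
  shows "prod f I \<le> prod g I"
  using assms by (induction I rule: infinite_finite_induct) (auto intro: mult_mono)

section \<open>Strict positivity of the solution\<close>

context smoothing
begin

lemma zeta_UNIV [simp]: "emeasure zeta UNIV = 1" "measure zeta UNIV = 1"
  using zeta.emeasure_space_1 zeta.prob_space by simp_all

lemma sum_inner_eq_0:
  fixes psi :: "real^'d" and n :: nat
  assumes "0 \<le> psi" "\<And>i. i < n \<Longrightarrow> nonneg_mat (a i)" "\<And>i. 0 \<le> z i"
  shows "(\<Sum>i<n. (psi v* a i) \<bullet> z i) = 0 \<longleftrightarrow> (\<forall>i<n. (psi v* a i) \<bullet> z i = 0)"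
  by (subst sum_nonneg_eq_0_iff) (use assms in \<open>auto intro!: inner_vec_nonneg nonneg_mat_vec'\<close>)

lemma AE_good:
  "AE \<omega> in M. (\<forall>i. A \<omega> i \<noteq> 0 \<longleftrightarrow> i < numN A \<omega>) \<and> 1 \<le> numN A \<omega> \<and> (\<forall>i. nonneg_mat (A \<omega> i)) \<and>
    (\<forall>i<numN A \<omega>. A \<omega> i \<in> supp_measure mu) \<and> (\<forall>z. (\<forall>i. z i \<in> S) \<longrightarrow> branch_sum (A \<omega>) z \<in> S)"
  using A_struct N_ge1 A_nonneg AE_supp_mu S_branch by eventually_elim auto

lemma AE_zeta_zero: "\<not> (AE x in zeta. x = 0)"
proof
  assume "AE x in zeta. x = 0"
  then have "AE \<omega> in M. Z \<omega> = 0" unfolding zeta_def by (rule AE_distrD[OF Z_meas])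
  then have "prob {\<omega> \<in> space M. Z \<omega> = 0} = 1" by (subst prob_Collect_eq_1) auto
  with Z_nonzero show False by simp
qed

text \<open>The largest value \<open>Q\<close> of \<open>P (psi \<bullet> Z = 0)\<close> over nonzero \<open>psi \<ge> 0\<close> is attained, because the
  event depends on \<open>psi\<close> only through the set of its nonzero coordinates. The equation gives
  \<open>Q \<le> E (Q ^ N)\<close>, hence \<open>Q\<close> is \<open>0\<close> or \<open>1\<close>; positivity of a matrix in \<open>\<Gamma>\<close> excludes \<open>1\<close>.\<close>

lemma AE_inner_pos:
  fixes psi :: "real^'d"
  assumes psi: "0 \<le> psi" "psi \<noteq> 0"
  shows "AE x in zeta. 0 < psi \<bullet> x"
proof -
  define q where "q = (\<lambda>psi. emeasure zeta {x. psi \<bullet> x = 0})"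
  define chi :: "'d set \<Rightarrow> real^'d" where "chi = (\<lambda>J. \<chi> i. if i \<in> J then 1 else 0)"
  have chi: "0 \<le> chi J" "J \<noteq> {} \<Longrightarrow> chi J \<noteq> 0" for J by (auto simp: chi_def less_eq_vec_def vec_eq_iff)
  have q_chi: "q psi = q (chi {i. psi $ i \<noteq> 0})" if "0 \<le> psi" for psi
    unfolding q_def
  proof (rule emeasure_eq_AE)
    show "AE x in zeta. x \<in> {x. psi \<bullet> x = 0} \<longleftrightarrow> x \<in> {x. chi {i. psi $ i \<noteq> 0} \<bullet> x = 0}"
      using AE_zeta_nonneg
    proof eventually_elim
      fix x :: "real^'d" assume "0 \<le> x"
      then show "x \<in> {x. psi \<bullet> x = 0} \<longleftrightarrow> x \<in> {x. chi {i. psi $ i \<noteq> 0} \<bullet> x = 0}"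
        using that by (auto simp: inner_vec_def less_eq_vec_def chi_def sum_nonneg_eq_0_iff)
    qed
  qed auto
  define Q where "Q = Max ((\<lambda>J. q (chi J)) ` {J. J \<noteq> {}})"
  have Qge: "q psi \<le> Q" if "0 \<le> psi" "psi \<noteq> 0" for psi
    unfolding q_chi[OF that(1)] Q_def using that(2) by (intro Max_ge imageI) (auto simp: vec_eq_iff)
  have "Q \<in> (\<lambda>J. q (chi J)) ` {J. J \<noteq> {}}" unfolding Q_def by (rule Max_in) auto
  then obtain J0 where J0: "J0 \<noteq> {}" "Q = q (chi J0)" by auto
  let ?p = "chi J0"
  have p: "0 \<le> ?p" "?p \<noteq> 0" using chi J0 by auto
  define c where "c = enn2real Q"
  have Q1: "Q \<le> 1" unfolding J0(2) q_def by (rule zeta.emeasure_le_1)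
  then have Qc: "Q = ennreal c" by (auto simp: c_def ennreal_enn2real_if top_unique)
  have c: "0 \<le> c" "c \<le> 1" using Q1 by (auto simp: c_def intro: enn2real_leI)
  let ?g = "\<lambda>b x. indicator {x. (?p v* b) \<bullet> x = 0} x :: ennreal"
  have gm: "(\<lambda>pr. ?g (fst pr) (snd pr)) \<in> borel_measurable (borel \<Otimes>\<^sub>M borel)"
  proof -
    have "{pr \<in> space (borel \<Otimes>\<^sub>M borel). (?p v* fst pr) \<bullet> snd pr = 0} \<in> sets (borel \<Otimes>\<^sub>M borel)" by measurable
    then have "(\<lambda>pr. indicator {pr. (?p v* fst pr) \<bullet> snd pr = 0} pr :: ennreal) \<in> borel_measurable (borel \<Otimes>\<^sub>M borel)"
      by (intro borel_measurable_indicator) (simp add: space_pair_measure)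
    then show ?thesis by (simp add: indicator_def)
  qed
  have fm: "(\<lambda>x. indicator {x. ?p \<bullet> x = 0} x :: ennreal) \<in> borel_measurable borel" by measurable
  have prod_eq: "AE \<omega> in M. AE z in PZ. indicator {x. ?p \<bullet> x = 0} (branch_sum (A \<omega>) z) = (\<Prod>i<numN A \<omega>. ?g (A \<omega> i) (z i))"
    using A_nonneg
  proof eventually_elim
    fix \<omega> assume nn: "\<forall>i. nonneg_mat (A \<omega> i)"
    have "AE z in PZ. \<forall>i. 0 \<le> z i" by (rule AE_PZ[OF AE_zeta_nonneg]) (simp add: pred_def)
    then show "AE z in PZ. indicator {x. ?p \<bullet> x = 0} (branch_sum (A \<omega>) z) = (\<Prod>i<numN A \<omega>. ?g (A \<omega> i) (z i))"
    proof eventually_elim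
      fix z :: "nat \<Rightarrow> real^'d" assume z: "\<forall>i. 0 \<le> z i"
      have iff: "?p \<bullet> branch_sum (A \<omega>) z = 0 \<longleftrightarrow> (\<forall>i<numN A \<omega>. (?p v* A \<omega> i) \<bullet> z i = 0)"
        using z nn unfolding inner_branch_sum numN_eq_seqN by (intro sum_inner_eq_0 p) auto
      show "indicator {x. ?p \<bullet> x = 0} (branch_sum (A \<omega>) z) = (\<Prod>i<numN A \<omega>. ?g (A \<omega> i) (z i))"
      proof (cases "\<forall>i<numN A \<omega>. (?p v* A \<omega> i) \<bullet> z i = 0")
        case True
        then show ?thesis using iff by simp
      next
        case False
        then obtain i where "i < numN A \<omega>" "(?p v* A \<omega> i) \<bullet> z i \<noteq> 0" by blast
        then have "(\<Prod>i<numN A \<omega>. ?g (A \<omega> i) (z i)) = 0" by (intro prod_zero bexI[of _ i]) auto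
        with False iff show ?thesis by simp
      qed
    qed
  qed
  have q_int: "(\<integral>\<^sup>+x. ?g b x \<partial>zeta) = q (?p v* b)" for b unfolding q_def by (rule nn_integral_indicator) simp
  have Q_eq: "Q = (\<integral>\<^sup>+\<omega>. (\<Prod>i<numN A \<omega>. q (?p v* A \<omega> i)) \<partial>M)"
    and q_meas: "(\<lambda>\<omega>. \<Prod>i<numN A \<omega>. q (?p v* A \<omega> i)) \<in> borel_measurable M"
    using nn_integral_zeta_prod[OF fm gm prod_eq] by (simp_all add: q_int J0(2)) (simp add: q_def)
  have le_pow: "AE \<omega> in M. (\<Prod>i<numN A \<omega>. q (?p v* A \<omega> i)) \<le> ennreal (c ^ numN A \<omega>)"
    using AE_good
  proof eventually_elim
    fix \<omega> assume good: "(\<forall>i. A \<omega> i \<noteq> 0 \<longleftrightarrow> i < numN A \<omega>) \<and> 1 \<le> numN A \<omega> \<and> (\<forall>i. nonneg_mat (A \<omega> i)) \<and>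
      (\<forall>i<numN A \<omega>. A \<omega> i \<in> supp_measure mu) \<and> (\<forall>z. (\<forall>i. z i \<in> S) \<longrightarrow> branch_sum (A \<omega>) z \<in> S)"
    have "(\<Prod>i<numN A \<omega>. q (?p v* A \<omega> i)) \<le> (\<Prod>i<numN A \<omega>. Q)"
      using good by (intro prod_mono_ennreal Qge Gamma_vm_nonzero nonneg_mat_vec' p supp_mu_Gamma) auto
    also have "\<dots> = ennreal (c ^ numN A \<omega>)" using c by (simp add: Qc ennreal_power)
    finally show "(\<Prod>i<numN A \<omega>. q (?p v* A \<omega> i)) \<le> ennreal (c ^ numN A \<omega>)" .
  qed
  have "AE \<omega> in M. (\<Prod>i<numN A \<omega>. q (?p v* A \<omega> i)) \<le> ennreal c"
    using le_pow N_ge1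
  proof eventually_elim
    fix \<omega> assume *: "(\<Prod>i<numN A \<omega>. q (?p v* A \<omega> i)) \<le> ennreal (c ^ numN A \<omega>)" "1 \<le> numN A \<omega>"
    have "c ^ numN A \<omega> \<le> c ^ 1" using c *(2) by (intro power_decreasing) auto
    then show "(\<Prod>i<numN A \<omega>. q (?p v* A \<omega> i)) \<le> ennreal c"
      using *(1) by (intro order.trans[OF *(1)] ennreal_leI) simp
  qed
  then have "AE \<omega> in M. (\<Prod>i<numN A \<omega>. q (?p v* A \<omega> i)) = ennreal c"
    using q_meas Q_eq Qc by (intro AE_eq_of_nn_integral_ge prob_space_axioms) auto
  with le_pow have "AE \<omega> in M. ennreal c \<le> ennreal (c ^ numN A \<omega>)"
    by eventually_elim simp
  from ex_two[OF this] obtain \<omega> where w: "ennreal c \<le> ennreal (c ^ numN A \<omega>)" "2 \<le> numN A \<omega>" by blast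
  have "c ^ numN A \<omega> \<le> c ^ 2" using c w(2) by (intro power_decreasing) auto
  then have "c \<le> c * c" using w(1) c by (simp add: power2_eq_square)
  then have "c = 0 \<or> c = 1" using c by (metis mult_cancel_left1 mult_left_le order_antisym)
  then show ?thesis
  proof
    assume "c = 0"
    then have "q psi = 0" using Qge[OF psi] Qc by simp
    then have "AE x in zeta. \<not> psi \<bullet> x = 0"
      unfolding q_def by (subst AE_iff_measurable[OF _ refl]) auto
    then show ?thesis using AE_zeta_nonneg
      by eventually_elim (use inner_vec_nonneg[OF psi(1)] in \<open>auto simp: less_le\<close>)
  next
    assume "c = 1"
    \<comment> \<open>The value 1 would mean that some functional vanishes on \<open>S\<close>. In a
      vanishing sum of nonnegative terms every term vanishes, so \<open>K\<close> is invariant under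
      the transposed matrices; a positive \<open>g\<close> then produces a strictly positive
      functional vanishing on \<open>S\<close>, hence \<open>Z = 0\<close>.\<close>
    define K where "K = {psi. 0 \<le> psi \<and> (\<forall>z\<in>S. psi \<bullet> z = 0)}"
    have "emeasure zeta {x. ?p \<bullet> x = 0} = 1" using \<open>c = 1\<close> Qc J0(2) by (simp add: q_def)
    then have "AE x in zeta. ?p \<bullet> x = 0"
      by (subst zeta.AE_in_set_eq_1[of "{x. ?p \<bullet> x = 0}", simplified]) (auto simp: zeta.emeasure_eq_measure)
    then have "S \<subseteq> {x. ?p \<bullet> x = 0}" by (intro S_subset closed_Collect_eq continuous_intros) auto
    then have pK: "?p \<in> K" using p by (auto simp: K_def)
    have closedK: "closed K"
    proof -
      have "K = {psi. 0 \<le> psi} \<inter> (\<Inter>z\<in>S. {psi. psi \<bullet> z = 0})" by (auto simp: K_def)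
      then show ?thesis by (auto intro!: closed_Int closed_INT closed_Collect_eq continuous_intros)
    qed
    have "AE \<omega> in M. \<forall>i<numN A \<omega>. \<forall>psi\<in>K. psi v* A \<omega> i \<in> K"
      using AE_good
    proof eventually_elim
      fix \<omega> assume good: "(\<forall>i. A \<omega> i \<noteq> 0 \<longleftrightarrow> i < numN A \<omega>) \<and> 1 \<le> numN A \<omega> \<and> (\<forall>i. nonneg_mat (A \<omega> i)) \<and>
        (\<forall>i<numN A \<omega>. A \<omega> i \<in> supp_measure mu) \<and> (\<forall>z. (\<forall>i. z i \<in> S) \<longrightarrow> branch_sum (A \<omega>) z \<in> S)"
      show "\<forall>i<numN A \<omega>. \<forall>psi\<in>K. psi v* A \<omega> i \<in> K"
      proof (intro allI impI ballI)
        fix i and psi :: "real^'d" assume i: "i < numN A \<omega>" and psi: "psi \<in> K"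
        have "(psi v* A \<omega> i) \<bullet> z = 0" if "z \<in> S" for z
        proof -
          have "psi \<bullet> branch_sum (A \<omega>) (\<lambda>_. z) = 0" using psi good that by (auto simp: K_def)
          then have "(\<Sum>i<numN A \<omega>. (psi v* A \<omega> i) \<bullet> z) = 0" by (simp add: inner_branch_sum numN_eq_seqN)
          then show ?thesis
            using sum_inner_eq_0[of psi "numN A \<omega>" "A \<omega>" "\<lambda>_. z"] psi good i S_nonneg[OF that] by (auto simp: K_def)
        qed
        then show "psi v* A \<omega> i \<in> K" using psi good by (auto simp: K_def intro: nonneg_mat_vec')
      qed
    qed
    moreover obtain g where g: "g \<in> \<Gamma>" "pos_mat g" by (rule Gamma_pos')
    ultimately have "?p v* g \<in> K" using Gamma_invariant[OF closedK _ g(1) pK] by blast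
    then have "z = 0" if "z \<in> S" for z
      using inner_vec_pos[OF pos_mat_vm_pos[OF g(2) p], of z] S_nonneg[OF that] that by (auto simp: K_def)
    then have "AE x in zeta. x = 0" using AE_S by (auto elim: eventually_mono)
    with AE_zeta_zero show ?thesis by simp
  qed
qed

lemma AE_zeta_pos: "AE x in zeta. \<forall>i. 0 < x $ i"
proof -
  have "AE x in zeta. 0 < axis i (1::real) \<bullet> x" for i :: 'd
    by (rule AE_inner_pos) (auto simp: less_eq_vec_def axis_def vec_eq_iff)
  then have "AE x in zeta. \<forall>i\<in>(UNIV::'d set). 0 < axis i (1::real) \<bullet> x"
    by (intro AE_finite_allI) auto
  then show ?thesis by (simp add: inner_axis')
qed

lemma obtain_pos_in_S: obtains z0 where "z0 \<in> S" "\<And>i. 0 < z0 $ i"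
proof -
  have "AE x in zeta. x \<in> S \<and> (\<forall>i. 0 < x $ i)" using AE_S AE_zeta_pos by eventually_elim auto
  then have "\<exists>x. x \<in> S \<and> (\<forall>i. 0 < x $ i)"
    using zeta.AE_False by (metis (no_types, lifting) eventually_mono)
  with that show ?thesis by blast
qed

section \<open>The Laplace transform of the solution\<close>

definition "L psi = (\<integral>x. exp (- (psi \<bullet> x)) \<partial>zeta)"

lemma AE_exp_le_1: "0 \<le> (psi::real^'d) \<Longrightarrow> AE x in zeta. exp (- (psi \<bullet> x)) \<le> 1"
  using AE_zeta_nonneg by eventually_elim (simp add: inner_vec_nonneg)

lemma L_integrable: "0 \<le> (psi::real^'d) \<Longrightarrow> integrable zeta (\<lambda>x. exp (- (psi \<bullet> x)))"
  using AE_exp_le_1[of psi] by (intro zeta.integrable_const_bound[of _ 1]) auto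

lemma L_nn: "0 \<le> (psi::real^'d) \<Longrightarrow> (\<integral>\<^sup>+x. ennreal (exp (- (psi \<bullet> x))) \<partial>zeta) = ennreal (L psi)"
  unfolding L_def by (intro nn_integral_eq_integral L_integrable) auto

lemma L_le_1: "0 \<le> (psi::real^'d) \<Longrightarrow> L psi \<le> 1"
  using integral_mono_AE[OF L_integrable[of psi] zeta.integrable_const[of 1] AE_exp_le_1[of psi]]
  by (simp add: L_def)

lemma L_pos: "0 \<le> (psi::real^'d) \<Longrightarrow> 0 < L psi"
  using zeta.integral_less_AE_space[OF zeta.integrable_const[of 0] L_integrable[of psi]]
  by (simp add: L_def)

lemma L_less_1:
  assumes "0 \<le> (psi::real^'d)" "psi \<noteq> 0"
  shows "L psi < 1"
proof -
  have "AE x in zeta. exp (- (psi \<bullet> x)) < 1" using AE_inner_pos[OF assms] by eventually_elim simp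
  then show ?thesis
    using zeta.integral_less_AE_space[OF L_integrable[OF assms(1)] zeta.integrable_const[of 1]]
    by (simp add: L_def)
qed

lemma L_continuous: "continuous_on {psi :: real^'d. 0 \<le> psi} L"
  unfolding continuous_on_sequentially
proof (intro allI ballI impI)
  fix p :: "nat \<Rightarrow> real^'d" and psi
  assume p: "psi \<in> {psi. 0 \<le> psi}" "(\<forall>n. p n \<in> {psi. 0 \<le> psi}) \<and> p \<longlonglongrightarrow> psi"
  show "(L \<circ> p) \<longlonglongrightarrow> L psi"
    unfolding L_def comp_def
  proof (rule integral_dominated_convergence[where w = "\<lambda>_. 1"])
    show "AE x in zeta. (\<lambda>n. exp (- (p n \<bullet> x))) \<longlonglongrightarrow> exp (- (psi \<bullet> x))"
      using p by (intro AE_I2 tendsto_intros) auto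
    show "AE x in zeta. norm (exp (- (p n \<bullet> x))) \<le> 1" for n
      using AE_exp_le_1[of "p n"] p by auto
  qed (auto intro!: zeta.integrable_const)
qed

text \<open>The measurability clause is stated with the integrals instead of \<open>L\<close>, since
  the two are identified only for nonnegative functionals, hence only for almost every
  \<open>\<omega>\<close>.\<close>

lemma L_laplace_equation:
  assumes psi: "0 \<le> (psi::real^'d)"
  shows "ennreal (L psi) = (\<integral>\<^sup>+\<omega>. (\<Prod>i<numN A \<omega>. ennreal (L (psi v* A \<omega> i))) \<partial>M)"
    and "(\<lambda>\<omega>. \<Prod>i<numN A \<omega>. \<integral>\<^sup>+x. ennreal (exp (- ((psi v* A \<omega> i) \<bullet> x))) \<partial>zeta) \<in> borel_measurable M"
proof -
  have fm: "(\<lambda>x. ennreal (exp (- (psi \<bullet> x)))) \<in> borel_measurable borel" by measurable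
  have gm: "(\<lambda>p. ennreal (exp (- ((psi v* fst p) \<bullet> snd p)))) \<in> borel_measurable (borel \<Otimes>\<^sub>M borel)" by measurable
  have eq: "AE \<omega> in M. AE z in PZ. ennreal (exp (- (psi \<bullet> branch_sum (A \<omega>) z)))
      = (\<Prod>i<numN A \<omega>. ennreal (exp (- ((psi v* A \<omega> i) \<bullet> z i))))"
    by (simp add: inner_branch_sum numN_eq_seqN prod_ennreal exp_sum[symmetric] sum_negf[symmetric])
  note * = nn_integral_zeta_prod[where g = "\<lambda>b x. ennreal (exp (- ((psi v* b) \<bullet> x)))", OF fm gm eq]
  show "(\<lambda>\<omega>. \<Prod>i<numN A \<omega>. \<integral>\<^sup>+x. ennreal (exp (- ((psi v* A \<omega> i) \<bullet> x))) \<partial>zeta) \<in> borel_measurable M"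
    by (rule *(2))
  have "ennreal (L psi) = (\<integral>\<^sup>+\<omega>. (\<Prod>i<numN A \<omega>. \<integral>\<^sup>+x. ennreal (exp (- ((psi v* A \<omega> i) \<bullet> x))) \<partial>zeta) \<partial>M)"
    using *(1) by (simp add: L_nn[OF psi])
  also have "\<dots> = (\<integral>\<^sup>+\<omega>. (\<Prod>i<numN A \<omega>. ennreal (L (psi v* A \<omega> i))) \<partial>M)"
    using A_nonneg by (intro nn_integral_cong_AE)
      (auto elim!: eventually_mono simp: L_nn nonneg_mat_vec' psi)
  finally show "ennreal (L psi) = (\<integral>\<^sup>+\<omega>. (\<Prod>i<numN A \<omega>. ennreal (L (psi v* A \<omega> i))) \<partial>M)" .
qed

end

text \<open>Both \<open>t\<close> and \<open>1\<close> are compared with \<open>t powr m\<close> through \<open>e\<^sup>s \<ge> 1 + s\<close>, at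
  \<open>s = (1 - m) ln t\<close> and \<open>s = - m ln t\<close>.\<close>

lemma powr_le_tangent:
  fixes t m :: real
  assumes t: "0 < t" and m: "0 < m" "m < 1"
  shows "t powr m \<le> m * t + (1 - m)" and "t powr m = m * t + (1 - m) \<Longrightarrow> t = 1"
proof -
  define e where "e = t powr m"
  have e: "e > 0" using t by (simp add: e_def)
  have t_eq: "t = e * exp ((1 - m) * ln t)"
    using t by (simp add: e_def powr_def exp_add[symmetric] algebra_simps)
  have one_eq: "1 = e * exp (- m * ln t)"
    using t by (simp add: e_def powr_def exp_add[symmetric])
  have 1: "e * (1 + (1 - m) * ln t) \<le> t"
    by (subst (2) t_eq) (use e in \<open>simp add: exp_ge_add_one_self\<close>)
  have 2: "e * (1 - m * ln t) \<le> 1"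
    by (subst one_eq) (use e exp_ge_add_one_self[of "- m * ln t"] in \<open>simp add: mult_left_mono\<close>)
  have id: "m * (e * (1 + (1 - m) * ln t)) + (1 - m) * (e * (1 - m * ln t)) = e" by (simp add: algebra_simps)
  have le: "m * (e * (1 + (1 - m) * ln t)) \<le> m * t" "(1 - m) * (e * (1 - m * ln t)) \<le> (1 - m) * 1"
    using 1 2 m by (auto intro!: mult_left_mono simp del: mult_1_right)
  show "t powr m \<le> m * t + (1 - m)" using le id by (simp add: e_def[symmetric])
  assume "t powr m = m * t + (1 - m)"
  then have "e = m * t + (1 - m)" by (simp only: e_def)
  moreover have "b = y" if "a \<le> x" "b \<le> y" "a + b = c" "c = x + y" for a b c x y :: real
    using that by linarith
  ultimately have "(1 - m) * (e * (1 - m * ln t)) = (1 - m) * 1" using le id by (metis mult_1_right)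
  then have "e * (1 - m * ln t) = e * exp (- m * ln t)" using m one_eq by simp
  then have "exp (- m * ln t) - 1 = ln (exp (- m * ln t))" using e by simp
  then have "exp (- m * ln t) = 1" by (intro ln_eq_minus_one) auto
  then show "t = 1" using m t by simp
qed

context smoothing
begin

text \<open>Jensen's inequality for the concave function \<open>t powr m\<close>, through its
  tangent at the mean: \<open>T\<close> has mean 1, and the tangent touches only at 1, so equality
  makes \<open>T\<close> constant.\<close>

lemma L_jensen:
  assumes psi: "0 \<le> (psi::real^'d)" and m: "0 < m" "m < 1"
  shows "L (m *\<^sub>R psi) \<le> L psi powr m"
    and "L (m *\<^sub>R psi) = L psi powr m \<Longrightarrow> AE x in zeta. psi \<bullet> x = - ln (L psi)"
proof -
  let ?c = "L psi"
  have c: "?c > 0" by (rule L_pos[OF psi])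
  have mpsi: "0 \<le> m *\<^sub>R psi" using psi m by (intro scaleR_nonneg_nonneg) auto
  define T where "T = (\<lambda>x. exp (- (psi \<bullet> x)) / ?c)"
  define R where "R = (\<lambda>x. ?c powr m * (m * T x + (1 - m)))"
  have T: "T x > 0" for x using c by (simp add: T_def)
  have lhs: "exp (- ((m *\<^sub>R psi) \<bullet> x)) = ?c powr m * (T x powr m)" for x
    using c by (simp add: T_def powr_divide exp_powr_real mult.commute)
  have le: "exp (- ((m *\<^sub>R psi) \<bullet> x)) \<le> R x" for x
    unfolding lhs R_def using c powr_le_tangent(1)[OF T m] by (intro mult_left_mono) auto
  have iR: "integrable zeta R"
    unfolding R_def T_def
    by (intro integrable_mult_right Bochner_Integration.integrable_add integrable_divide L_integrable psi zeta.integrable_const)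
  have "(\<integral>x. T x \<partial>zeta) = 1" using c by (simp add: T_def L_def)
  moreover have "integrable zeta T" unfolding T_def by (intro integrable_divide L_integrable psi)
  ultimately have R: "(\<integral>x. R x \<partial>zeta) = ?c powr m"
    unfolding R_def by simp
  show le': "L (m *\<^sub>R psi) \<le> ?c powr m"
    unfolding R[symmetric] unfolding L_def by (intro integral_mono L_integrable mpsi iR le)
  assume eq: "L (m *\<^sub>R psi) = ?c powr m"
  let ?E = "\<lambda>x. exp (- ((m *\<^sub>R psi) \<bullet> x))"
  have "(\<integral>x. R x - ?E x \<partial>zeta) = (\<integral>x. R x \<partial>zeta) - L (m *\<^sub>R psi)"
    unfolding L_def by (rule Bochner_Integration.integral_diff[OF iR L_integrable[OF mpsi]])
  also have "\<dots> = 0" unfolding R eq by simp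
  finally have "(\<integral>x. R x - ?E x \<partial>zeta) = 0" .
  moreover have "integrable zeta (\<lambda>x. R x - ?E x)"
    by (rule Bochner_Integration.integrable_diff[OF iR L_integrable[OF mpsi]])
  moreover have "AE x in zeta. 0 \<le> R x - ?E x" using le by simp
  ultimately have "AE x in zeta. R x - ?E x = 0"
    using integral_nonneg_eq_0_iff_AE[of zeta "\<lambda>x. R x - ?E x"] by blast
  then show "AE x in zeta. psi \<bullet> x = - ln ?c"
  proof eventually_elim
    fix x assume "R x - exp (- ((m *\<^sub>R psi) \<bullet> x)) = 0"
    then have "T x powr m = m * T x + (1 - m)" unfolding lhs R_def using c by simp
    then have "T x = 1" by (rule powr_le_tangent(2)[OF T m])
    then have "exp (- (psi \<bullet> x)) = ?c" using c by (simp add: T_def)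
    then have "- (psi \<bullet> x) = ln ?c" by (metis ln_exp)
    then show "psi \<bullet> x = - ln ?c" by simp
  qed
qed

text \<open>For \<open>x \<ge> 0\<close> the value \<open>psi \<bullet> x\<close> is at least
  \<open>l1norm psi\<close> times the smallest coordinate of \<open>x\<close>, which is positive
  almost surely. The bound is uniform in \<open>psi\<close>; it provides the compactness for the
  maximisation of \<open>L\<close>.\<close>

lemma L_vanishes:
  assumes "e > 0"
  obtains n :: nat where "\<And>psi :: real^'d. 0 \<le> psi \<Longrightarrow> real n \<le> l1norm psi \<Longrightarrow> L psi < e"
proof -
  define mn :: "real^'d \<Rightarrow> real" where "mn = (\<lambda>x. MIN i. x $ i)"
  have mn_meas [measurable]: "mn \<in> borel_measurable borel"
    unfolding mn_def by (intro borel_measurable_Min) auto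
  have mn_le: "mn x \<le> x $ i" for x i unfolding mn_def by (rule Min_le) auto
  have mn_pos: "AE x in zeta. 0 < mn x"
    using AE_zeta_pos
  proof eventually_elim
    fix x :: "real^'d" assume x: "\<forall>i. 0 < x $ i"
    have "mn x \<in> range (($) x)" unfolding mn_def by (rule Min_in) auto
    with x show "0 < mn x" by auto
  qed
  define h where "h = (\<lambda>(n::nat) x. exp (- (real n * mn x)))"
  have h_le: "AE x in zeta. norm (h n x) \<le> 1" for n
    using mn_pos by eventually_elim (simp add: h_def)
  have "(\<lambda>n. \<integral>x. h n x \<partial>zeta) \<longlonglongrightarrow> (\<integral>x. 0 \<partial>zeta)"
  proof (rule integral_dominated_convergence[where w = "\<lambda>_. 1"])
    show "AE x in zeta. (\<lambda>n. h n x) \<longlonglongrightarrow> 0"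
      using mn_pos
    proof eventually_elim
      fix x assume x: "0 < mn x"
      have "filterlim (\<lambda>n. mn x * real n) at_top sequentially"
        by (rule filterlim_tendsto_pos_mult_at_top[OF tendsto_const x filterlim_real_sequentially])
      then have "filterlim (\<lambda>n. real n * mn x) at_top sequentially" by (simp add: mult.commute)
      then show "(\<lambda>n. h n x) \<longlonglongrightarrow> 0"
        unfolding h_def
        by (rule filterlim_compose[OF exp_at_bot filterlim_compose[OF filterlim_uminus_at_bot_at_top]])
    qed
  qed (use h_le in \<open>auto simp: h_def intro!: zeta.integrable_const\<close>)
  then have "\<forall>\<^sub>F n in sequentially. (\<integral>x. h n x \<partial>zeta) < e" using assms by (intro order_tendstoD) auto
  then obtain n where n: "(\<integral>x. h n x \<partial>zeta) < e" using eventually_happens'[OF sequentially_bot] by blast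
  have "L psi < e" if psi: "0 \<le> psi" "real n \<le> l1norm psi" for psi
  proof -
    have "L psi \<le> (\<integral>x. h n x \<partial>zeta)"
      unfolding L_def
    proof (rule integral_mono_AE)
      show "integrable zeta (h n)"
        using h_le by (intro zeta.integrable_const_bound[of _ 1]) (auto simp: h_def)
      show "AE x in zeta. exp (- (psi \<bullet> x)) \<le> h n x"
        using mn_pos
      proof eventually_elim
        fix x assume x: "0 < mn x"
        have "real n * mn x \<le> l1norm psi * mn x" using psi x by (intro mult_right_mono) auto
        also have "\<dots> \<le> psi \<bullet> x"
          using psi mn_le unfolding l1norm_def inner_vec_def sum_distrib_right
          by (intro sum_mono) (auto simp: less_eq_vec_def intro!: mult_left_mono)
        finally show "exp (- (psi \<bullet> x)) \<le> h n x" by (simp add: h_def)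
      qed
    qed (rule L_integrable[OF psi(1)])
    with n show ?thesis by simp
  qed
  with that show ?thesis by blast
qed

text \<open>If \<open>0 \<notin> S\<close>, maximise the Laplace transform \<open>L\<close> over \<open>C = {psi \<ge> 0. psi \<bullet> z \<ge> 1 on S}\<close>. Writing
  \<open>m psi\<close> for the infimum of \<open>psi \<bullet> z\<close> over \<open>S\<close>, Jensen's inequality gives
  \<open>L psi \<le> I powr min 1 (m psi)\<close>, and \<open>m\<close> is superadditive along the equation. Hence equality holds
  almost surely, and Jensen's inequality is an equality as soon as there are two summands.\<close>

lemma constant_functional:
  assumes "0 \<notin> S"
  obtains psi :: "real^'d" and k where "0 \<le> psi" "psi \<noteq> 0" "\<And>z. z \<in> S \<Longrightarrow> psi \<bullet> z = k"
proof -
  define C where "C = {psi. 0 \<le> psi \<and> (\<forall>z\<in>S. 1 \<le> psi \<bullet> z)}"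
  have closedC: "closed C"
  proof -
    have "C = {psi. 0 \<le> psi} \<inter> (\<Inter>z\<in>S. {psi. 1 \<le> psi \<bullet> z})" by (auto simp: C_def)
    then show ?thesis by (auto intro!: closed_Int closed_INT closed_Collect_le continuous_intros)
  qed
  obtain d where d: "d > 0" "\<And>z. z \<in> S \<Longrightarrow> d \<le> dist 0 z"
    using separate_point_closed[OF closed_S assms] by blast
  \<comment> \<open>\<open>S\<close> keeps the distance \<open>d\<close> from 0 and the Euclidean
    norm is at most the sum of the coordinates, so \<open>psi0\<close> is at least 1 on
    \<open>S\<close> and \<open>C\<close> is not empty.\<close>
  define psi0 :: "real^'d" where "psi0 = (1 / d) *\<^sub>R 1"
  have psi0: "psi0 \<in> C"
    unfolding C_def
  proof (intro CollectI conjI ballI)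
    show "0 \<le> psi0" using d(1) by (simp add: psi0_def less_eq_vec_def)
    fix z assume z: "z \<in> S"
    have "d \<le> norm z" using d(2)[OF z] by simp
    also have "\<dots> \<le> 1 \<bullet> z" using norm_le_l1norm[of z] l1norm_eq_inner[OF S_nonneg[OF z]] by simp
    finally show "1 \<le> psi0 \<bullet> z" using d(1) by (simp add: psi0_def)
  qed
  then have "0 \<le> psi0" by (simp add: C_def)
  obtain n where n: "\<And>psi :: real^'d. 0 \<le> psi \<Longrightarrow> real n \<le> l1norm psi \<Longrightarrow> L psi < L psi0"
    using L_vanishes[OF L_pos[OF \<open>0 \<le> psi0\<close>]] by blast
  \<comment> \<open>Functionals of large norm are beaten by \<open>psi0\<close>, so the maximum over
    the unbounded set \<open>C\<close> is attained on its compact part \<open>C'\<close>.\<close>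
  define C' where "C' = C \<inter> {psi. l1norm psi \<le> real n}"
  have "compact C'"
  proof -
    have "bounded C'"
      unfolding bounded_iff C'_def using norm_le_l1norm by (metis IntD2 mem_Collect_eq order.trans)
    moreover have "closed C'"
      unfolding C'_def by (intro closed_Int closedC closed_Collect_le continuous_intros)
    ultimately show ?thesis by (simp add: compact_eq_bounded_closed)
  qed
  moreover have "\<not> real n \<le> l1norm psi0" using n[OF \<open>0 \<le> psi0\<close>] by blast
  then have "psi0 \<in> C'" using psi0 by (simp add: C'_def)
  moreover have "continuous_on C' L"
    by (rule continuous_on_subset[OF L_continuous]) (auto simp: C'_def C_def)
  ultimately obtain phi where phi: "phi \<in> C'" "\<And>psi. psi \<in> C' \<Longrightarrow> L psi \<le> L phi"
    using continuous_attains_sup[of C' L] by blast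
  define I where "I = L phi"
  have max: "L psi \<le> I" if "psi \<in> C" for psi
  proof (cases "l1norm psi \<le> real n")
    case True
    then show ?thesis using phi that by (auto simp: C'_def I_def)
  next
    case False
    then have "L psi < L psi0" using n[of psi] that by (auto simp: C_def)
    also have "\<dots> \<le> I" using phi(2)[OF \<open>psi0 \<in> C'\<close>] by (simp add: I_def)
    finally show ?thesis by simp
  qed
  have phiC: "phi \<in> C" using phi by (simp add: C'_def)
  have phi_nn: "0 \<le> phi" using phiC by (simp add: C_def)
  have "phi \<noteq> 0" using phiC S_nonempty by (auto simp: C_def)
  then have I: "0 < I" "I < 1" using L_pos[OF phi_nn] L_less_1[OF phi_nn] by (auto simp: I_def)
  define m where "m = (\<lambda>psi. Inf ((\<bullet>) psi ` S))"
  have bdd: "bdd_below ((\<bullet>) psi ` S)" if "0 \<le> psi" for psi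
    using that S_nonneg by (intro bdd_belowI2[of _ 0] inner_vec_nonneg) auto
  have m_le: "m psi \<le> psi \<bullet> z" if "0 \<le> psi" "z \<in> S" for psi z
    unfolding m_def using that by (intro cInf_lower bdd) auto
  have m_nn: "0 \<le> m psi" if "0 \<le> psi" for psi
    unfolding m_def using that S_nonempty S_nonneg by (intro cInf_greatest) (auto intro: inner_vec_nonneg)
  have scaled: "(1 / m psi) *\<^sub>R psi \<in> C" if "0 \<le> psi" "0 < m psi" for psi
    using that m_le[OF that(1)] by (auto simp: C_def pos_le_divide_eq intro!: scaleR_nonneg_nonneg)
  have unscaled: "L (m psi *\<^sub>R ((1 / m psi) *\<^sub>R psi)) = L psi" if "0 < m psi" for psi using that by simp
  have L_le: "L psi \<le> I powr (min 1 (m psi))" if psi: "0 \<le> psi" for psi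
  proof -
    consider "m psi = 0" | "0 < m psi" "m psi < 1" | "1 \<le> m psi" using m_nn[OF psi] by linarith
    then show ?thesis
    proof cases
      case 1
      then show ?thesis using L_le_1[OF psi] I by simp
    next
      case 2
      let ?p = "(1 / m psi) *\<^sub>R psi"
      have p: "0 \<le> ?p" "?p \<in> C" using scaled[OF psi 2(1)] by (auto simp: C_def)
      have "L psi \<le> L ?p powr m psi" using L_jensen(1)[OF p(1) 2] unscaled[OF 2(1)] by simp
      also have "\<dots> \<le> I powr m psi" using max[OF p(2)] L_pos[OF p(1)] 2 by (intro powr_mono2) auto
      finally show ?thesis using 2 by simp
    next
      case 3
      then have "psi \<in> C" using psi m_le[OF psi] by (auto simp: C_def intro: order.trans)
      then show ?thesis using max 3 I by simp
    qed
  qed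
  \<comment> \<open>If some term is truncated it already equals 1. Otherwise nothing is truncated,
    and inserting almost minimising vectors \<open>z i\<close> into the equation shows that the
    infima add up to at least 1, because \<open>phi \<in> C\<close>.\<close>
  have super: "1 \<le> (\<Sum>i<numN A \<omega>. min 1 (m (phi v* A \<omega> i)))"
    if good: "\<forall>i. nonneg_mat (A \<omega> i)" "\<forall>z. (\<forall>i. z i \<in> S) \<longrightarrow> branch_sum (A \<omega>) z \<in> S" for \<omega>
  proof (cases "\<exists>i<numN A \<omega>. 1 \<le> m (phi v* A \<omega> i)")
    case True
    then obtain i where i: "i < numN A \<omega>" "1 \<le> m (phi v* A \<omega> i)" by blast
    have "min 1 (m (phi v* A \<omega> i)) \<le> (\<Sum>i<numN A \<omega>. min 1 (m (phi v* A \<omega> i)))"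
      using i good m_nn nonneg_mat_vec'[OF _ phi_nn] by (intro member_le_sum) auto
    with i show ?thesis by simp
  next
    case False
    have "1 \<le> (\<Sum>i<numN A \<omega>. m (phi v* A \<omega> i))"
    proof (rule field_le_epsilon)
      fix e :: real assume e: "e > 0"
      let ?n = "numN A \<omega>"
      have "\<exists>z\<in>S. (phi v* A \<omega> i) \<bullet> z < m (phi v* A \<omega> i) + e / (real ?n + 1)" for i
        using cInf_lessD[of "(\<bullet>) (phi v* A \<omega> i) ` S" "m (phi v* A \<omega> i) + e / (real ?n + 1)"] S_nonempty e
        by (auto simp: m_def)
      then obtain z where z: "\<And>i. z i \<in> S" "\<And>i. (phi v* A \<omega> i) \<bullet> z i < m (phi v* A \<omega> i) + e / (real ?n + 1)"
        by metis
      have "1 \<le> phi \<bullet> branch_sum (A \<omega>) z" using phiC good z(1) by (auto simp: C_def)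
      also have "\<dots> = (\<Sum>i<?n. (phi v* A \<omega> i) \<bullet> z i)" by (simp add: inner_branch_sum numN_eq_seqN)
      also have "\<dots> \<le> (\<Sum>i<?n. m (phi v* A \<omega> i) + e / (real ?n + 1))" using z(2) by (intro sum_mono less_imp_le)
      also have "\<dots> = (\<Sum>i<?n. m (phi v* A \<omega> i)) + e * (real ?n / (real ?n + 1))" by (simp add: sum.distrib)
      also have "\<dots> \<le> (\<Sum>i<?n. m (phi v* A \<omega> i)) + e * 1"
        using e by (intro add_left_mono mult_left_mono) auto
      finally show "1 \<le> (\<Sum>i<?n. m (phi v* A \<omega> i)) + e" by simp
    qed
    also have "\<dots> = (\<Sum>i<numN A \<omega>. min 1 (m (phi v* A \<omega> i)))" using False by (intro sum.cong) auto
    finally show ?thesis .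
  qed
  have bound: "(\<Prod>i<numN A \<omega>. I powr min 1 (m (phi v* A \<omega> i))) = I powr (\<Sum>i<numN A \<omega>. min 1 (m (phi v* A \<omega> i)))" for \<omega>
    using I by (simp add: powr_sum)
  have decr: "I powr s \<le> I" if "1 \<le> s" for s using powr_mono'[of 1 s I] I that by simp
  have prod_le: "(\<Prod>i<numN A \<omega>. L (phi v* A \<omega> i)) \<le> I"
    if good: "\<forall>i. nonneg_mat (A \<omega> i)" "\<forall>z. (\<forall>i. z i \<in> S) \<longrightarrow> branch_sum (A \<omega>) z \<in> S" for \<omega>
  proof -
    have nn: "0 \<le> phi v* A \<omega> i" for i using good phi_nn by (auto intro: nonneg_mat_vec')
    have "(\<Prod>i<numN A \<omega>. L (phi v* A \<omega> i)) \<le> (\<Prod>i<numN A \<omega>. I powr min 1 (m (phi v* A \<omega> i)))"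
      using L_le[OF nn] L_pos[OF nn] by (intro prod_mono) (auto intro: less_imp_le)
    also have "\<dots> \<le> I" unfolding bound using super[OF good] by (rule decr)
    finally show ?thesis .
  qed
  define X where "X = (\<lambda>\<omega>. \<Prod>i<numN A \<omega>. \<integral>\<^sup>+x. ennreal (exp (- ((phi v* A \<omega> i) \<bullet> x))) \<partial>zeta)"
  have X: "X \<omega> = ennreal (\<Prod>i<numN A \<omega>. L (phi v* A \<omega> i))" if "\<forall>i. nonneg_mat (A \<omega> i)" for \<omega>
    using that phi_nn L_pos[OF nonneg_mat_vec'[OF _ phi_nn]]
    by (simp add: X_def L_nn nonneg_mat_vec' prod_ennreal less_imp_le)
  have "AE \<omega> in M. X \<omega> = ennreal I"
  proof (rule AE_eq_of_nn_integral_ge[OF prob_space_axioms])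
    show "X \<in> borel_measurable M" unfolding X_def by (rule L_laplace_equation(2)[OF phi_nn])
    show "AE \<omega> in M. X \<omega> \<le> ennreal I" using AE_good by eventually_elim (auto simp: X intro!: ennreal_leI prod_le)
    have "ennreal I = (\<integral>\<^sup>+\<omega>. X \<omega> \<partial>M)"
      unfolding I_def L_laplace_equation(1)[OF phi_nn]
      using A_nonneg L_pos[OF nonneg_mat_vec'[OF _ phi_nn]]
      by (intro nn_integral_cong_AE) (auto elim!: eventually_mono simp: X prod_ennreal less_imp_le)
    then show "ennreal I \<le> (\<integral>\<^sup>+\<omega>. X \<omega> \<partial>M)" by simp
  qed
  with AE_good have "AE \<omega> in M. X \<omega> = ennreal I \<and> (\<forall>i. nonneg_mat (A \<omega> i)) \<and>
      (\<forall>i<numN A \<omega>. A \<omega> i \<in> supp_measure mu) \<and> (\<forall>z. (\<forall>i. z i \<in> S) \<longrightarrow> branch_sum (A \<omega>) z \<in> S)"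
    by eventually_elim auto
  then obtain \<omega> where w: "X \<omega> = ennreal I \<and> (\<forall>i. nonneg_mat (A \<omega> i)) \<and>
      (\<forall>i<numN A \<omega>. A \<omega> i \<in> supp_measure mu) \<and> (\<forall>z. (\<forall>i. z i \<in> S) \<longrightarrow> branch_sum (A \<omega>) z \<in> S)"
    and N2: "2 \<le> numN A \<omega>" by (rule ex_two)
  note w = w[THEN conjunct1] w[THEN conjunct2, THEN conjunct1]
    w[THEN conjunct2, THEN conjunct2, THEN conjunct1] w[THEN conjunct2, THEN conjunct2, THEN conjunct2]
  let ?n = "numN A \<omega>"
  define p where "p = (\<lambda>i. phi v* A \<omega> i)"
  define s where "s = (\<lambda>i. min 1 (m (p i)))"
  have p: "0 \<le> p i" for i using w(2) phi_nn by (auto simp: p_def intro: nonneg_mat_vec')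
  have p0: "p i \<noteq> 0" if "i < ?n" for i
    using w(3) that unfolding p_def by (intro Gamma_vm_nonzero supp_mu_Gamma phi_nn \<open>phi \<noteq> 0\<close>) auto
  have prodI: "(\<Prod>i<?n. L (p i)) = I"
  proof -
    have "0 \<le> (\<Prod>i<?n. L (p i))" using L_pos[OF p] by (intro prod_nonneg) (auto intro: less_imp_le)
    then show ?thesis using w(1,2) I X[of \<omega>] by (simp add: p_def)
  qed
  have sum1: "1 \<le> sum s {..<?n}" using super[OF w(2,4)] by (simp add: s_def p_def)
  have Lps: "L (p i) \<le> I powr s i" for i using L_le[OF p] by (simp add: s_def)
  have Lpn: "0 < L (p i)" for i by (rule L_pos[OF p])
  \<comment> \<open>The product of the upper bounds is itself at most \<open>I\<close>, the actual
    product, so no factor can be strictly below its bound.\<close>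
  have Leq: "L (p j) = I powr s j" if j: "j < ?n" for j
  proof (rule antisym[OF Lps], rule ccontr)
    assume "\<not> I powr s j \<le> L (p j)"
    then have "(\<Prod>i<?n. L (p i)) < (\<Prod>i<?n. I powr s i)"
      using j Lps Lpn by (intro prod_mono_strict) (auto intro: less_imp_le)
    also have "\<dots> = I powr sum s {..<?n}" using I by (simp add: powr_sum)
    also have "\<dots> \<le> I" by (rule decr[OF sum1])
    finally show False using prodI by simp
  qed
  have spos: "0 < s i" if "i < ?n" for i
  proof -
    have "I powr s i < 1" using L_less_1[OF p p0[OF that]] Leq[OF that] by simp
    moreover have "0 \<le> s i" using m_nn[OF p] by (simp add: s_def)
    ultimately show ?thesis using I by (cases "s i = 0") auto
  qed
  have sumeq: "sum s {..<?n} = 1"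
  proof (rule ccontr)
    assume "sum s {..<?n} \<noteq> 1"
    then have "1 < sum s {..<?n}" using sum1 by simp
    then have "sum s {..<?n} * ln I < 1 * ln I" using I by (intro mult_strict_right_mono_neg) auto
    then have "exp (sum s {..<?n} * ln I) < exp (1 * ln I)" by (simp only: exp_less_cancel_iff)
    then have "I powr sum s {..<?n} < I powr 1" using I by (simp add: powr_def)
    moreover have "I = I powr sum s {..<?n}" using prodI Leq I by (simp add: powr_sum)
    ultimately show False using I by simp
  qed
  \<comment> \<open>\<open>s 0\<close> and \<open>s 1\<close> are positive within a total of 1.
    Hence \<open>m (p 0)\<close> is not truncated and lies strictly between 0 and 1, as the equality
    case of \<open>L_jensen\<close> demands.\<close>
  have "s 0 < 1"
  proof -
    have "s 0 + s 1 = sum s {0, 1}" by simp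
    also have "\<dots> \<le> sum s {..<?n}" using N2 spos by (intro sum_mono2) (auto intro: less_imp_le)
    finally show ?thesis using spos[of 1] N2 sumeq by simp
  qed
  moreover have "0 < s 0" using spos N2 by simp
  ultimately have m0: "0 < m (p 0)" "m (p 0) < 1" "s 0 = m (p 0)" by (auto simp: s_def)
  let ?q = "(1 / m (p 0)) *\<^sub>R p 0"
  have q: "0 \<le> ?q" "?q \<in> C" using scaled[OF p m0(1)] by (auto simp: C_def)
  have "L ?q powr m (p 0) \<le> I powr m (p 0)" using max[OF q(2)] L_pos[OF q(1)] m0 by (intro powr_mono2) auto
  then have "L (m (p 0) *\<^sub>R ?q) = L ?q powr m (p 0)"
    using L_jensen(1)[OF q(1) m0(1,2)] unscaled[OF m0(1)] Leq[of 0] N2 m0(3) by simp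
  then have "AE x in zeta. ?q \<bullet> x = - ln (L ?q)" by (rule L_jensen(2)[OF q(1) m0(1,2)])
  then have "S \<subseteq> {x. ?q \<bullet> x = - ln (L ?q)}" by (intro S_subset closed_Collect_eq continuous_intros) auto
  moreover have "?q \<noteq> 0" using p0[of 0] N2 m0 by simp
  ultimately show ?thesis using that[of ?q "- ln (L ?q)"] q(1) by auto
qed

end

section \<open>Cover sets and bounds on matrices\<close>

lemma cover_set_antichain:
  assumes "cover_set U" "u \<in> U" "u @ w \<in> U"
  shows "w = []"
proof -
  \<comment> \<open>Both words are prefixes of this one infinite sequence, padded by 0.\<close>
  define s where "s = (\<lambda>i. if i < length (u @ w) then (u @ w) ! i else 0)"
  have "map s [0..<length u] = u" "map s [0..<length (u @ w)] = u @ w"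
    by (auto intro!: nth_equalityI simp: s_def nth_append)
  moreover have "\<exists>!k. map s [0..<k] \<in> U" using assms(1) by (simp add: cover_set_def)
  ultimately have "length u = length (u @ w)" using assms(2,3) by metis
  then show ?thesis by simp
qed

lemma cover_set_subtree:
  assumes "cover_set U" "[] \<notin> U"
  shows "cover_set {u. i # u \<in> U}"
  unfolding cover_set_def
proof
  fix s :: "nat \<Rightarrow> nat"
  have shift: "map (case_nat i s) [0..<Suc k] = i # map s [0..<k]" for k
    by (simp add: upt_conv_Cons map_Suc_upt[symmetric] comp_def del: upt_Suc)
  have "\<exists>!k. map (case_nat i s) [0..<k] \<in> U" using assms(1) by (simp add: cover_set_def)
  then obtain k where k: "map (case_nat i s) [0..<k] \<in> U"
    and uniq: "\<And>j. map (case_nat i s) [0..<j] \<in> U \<Longrightarrow> j = k" by blast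
  have "k \<noteq> 0" using k assms(2) by (intro notI) simp
  then obtain l where l: "k = Suc l" using not0_implies_Suc by blast
  show "\<exists>!k. map s [0..<k] \<in> {u. i # u \<in> U}"
  proof (rule ex1I[of _ l])
    show "map s [0..<l] \<in> {u. i # u \<in> U}" using k l shift by simp
    show "j = l" if "map s [0..<j] \<in> {u. i # u \<in> U}" for j
      using uniq[of "Suc j"] that l shift by simp
  qed
qed

lemma cover_set_nonempty: "cover_set U \<Longrightarrow> U \<noteq> {}"
  by (auto simp: cover_set_def)

text \<open>For nonnegative \<open>b\<close> the value \<open>psi \<bullet> (b *v z)\<close> is a
  weighted sum of all entries with weights at least \<open>p * q\<close>, hence it controls the
  norm.\<close>

lemma pos_functional_bounds_norm:
  fixes psi z :: "real^'d"
  assumes "\<And>i. 0 < psi $ i" "\<And>i. 0 < z $ i"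
  obtains e where "e > 0" "\<And>b. nonneg_mat b \<Longrightarrow> e * norm b \<le> psi \<bullet> (b *v z)"
proof -
  define p where "p = (MIN i. psi $ i)"
  define q where "q = (MIN i. z $ i)"
  have "p \<in> range (($) psi)" "q \<in> range (($) z)" unfolding p_def q_def by (rule Min_in; simp)+
  then have pos: "p > 0" "q > 0" using assms by auto
  have le: "p \<le> psi $ i" "q \<le> z $ i" for i unfolding p_def q_def by (rule Min_le; simp)+
  show ?thesis
  proof (rule that[of "p * q"])
    show "p * q > 0" using pos by simp
    fix b :: "real^'d^'d" assume b: "nonneg_mat b"
    have "norm b \<le> (\<Sum>i\<in>UNIV. norm (b $ i))" unfolding norm_vec_def by (rule L2_set_le_sum) simp
    also have "\<dots> \<le> (\<Sum>i\<in>UNIV. \<Sum>j\<in>UNIV. \<bar>b $ i $ j\<bar>)" by (intro sum_mono norm_le_l1_cart)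
    finally have "p * q * norm b \<le> p * q * (\<Sum>i\<in>UNIV. \<Sum>j\<in>UNIV. \<bar>b $ i $ j\<bar>)"
      using pos by (intro mult_left_mono) auto
    also have "\<dots> = (\<Sum>i\<in>UNIV. \<Sum>j\<in>UNIV. p * (b $ i $ j * q))"
      using b by (simp add: sum_distrib_left nonneg_mat_def mult_ac)
    also have "\<dots> \<le> (\<Sum>i\<in>UNIV. \<Sum>j\<in>UNIV. psi $ i * (b $ i $ j * z $ j))"
      using le pos b by (intro sum_mono mult_mono mult_nonneg_nonneg mult_left_mono)
        (auto simp: nonneg_mat_def intro: less_imp_le order.trans[OF less_imp_le])
    also have "\<dots> = psi \<bullet> (b *v z)" by (simp add: inner_vec_def matrix_vector_mult_def sum_distrib_left)
    finally show "p * q * norm b \<le> psi \<bullet> (b *v z)" .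
  qed
qed

section \<open>Zero in the support, and the cones of part 1\<close>

context smoothing
begin

abbreviation "suppA \<equiv> supp_measure (distr M borel A)"

lemma suppA_subset:
  assumes "closed C" "AE \<omega> in M. A \<omega> \<in> C"
  shows "suppA \<subseteq> C"
  using assms by (intro supp_measure_subset) (auto simp: AE_distr_iff)

lemma suppA_nonneg: "a \<in> suppA \<Longrightarrow> nonneg_mat (a i)"
proof -
  have "closed {a :: nat \<Rightarrow> real^'d^'d. \<forall>i. nonneg_mat (a i)}"
    unfolding nonneg_mat_def by (intro closed_Collect_all closed_Collect_le continuous_intros) auto
  then have "suppA \<subseteq> {a. \<forall>i. nonneg_mat (a i)}" using A_nonneg by (intro suppA_subset) auto
  then show "a \<in> suppA \<Longrightarrow> nonneg_mat (a i)" by auto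
qed

text \<open>The row condition keeps the zero matrix out of the support, which is closed. The gap is
  what bounds the number of summands in \<open>zero_in_S\<close>.\<close>

lemma gap_supp_mu: obtains d where "d > 0" "\<And>b. b \<in> supp_measure mu \<Longrightarrow> d \<le> norm b"
proof -
  have "0 \<notin> supp_measure mu" using Gamma_row[OF supp_mu_Gamma] by force
  from separate_point_closed[OF closed_supp_measure this] that show ?thesis by auto
qed

text \<open>Suppose \<open>0 \<notin> S\<close>. The functionals that are constant on \<open>S\<close> form a subspace \<open>\<Phi>\<close> which is invariant
  under the transposed random matrices and contains a positive vector. Conservation of a positive
  functional bounds \<open>N\<close>, so it holds for every tree of realizations; this contradicts
  \<open>spec_rad (gsum a U) < 1\<close>.\<close>

lemma zero_in_S:
  assumes U: "cover_set U" "finite_level U" and a: "\<And>v. a v \<in> suppA"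
    and l: "pos_mat (gsum a U)" "spec_rad (gsum a U) < 1"
  shows "0 \<in> S"
proof (rule ccontr)
  assume "0 \<notin> S"
  then obtain psi0 k where psi0: "0 \<le> psi0" "psi0 \<noteq> 0" "\<And>z. z \<in> S \<Longrightarrow> psi0 \<bullet> z = k"
    by (rule constant_functional) blast
  obtain z0 where z0: "z0 \<in> S" "\<And>i. 0 < z0 $ i" using obtain_pos_in_S by blast
  \<comment> \<open>Constancy is expressed through the reference point \<open>z0\<close>; imposing
    no sign makes \<open>\<Phi>\<close> a linear space.\<close>
  define \<Phi> where "\<Phi> = {psi. \<forall>z\<in>S. psi \<bullet> z = psi \<bullet> z0}"
  have closed\<Phi>: "closed \<Phi>"
  proof -
    have "\<Phi> = (\<Inter>z\<in>S. {psi. psi \<bullet> z = psi \<bullet> z0})" by (auto simp: \<Phi>_def)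
    then show ?thesis by (auto intro!: closed_INT closed_Collect_eq continuous_intros)
  qed
  have zero\<Phi>: "0 \<in> \<Phi>" by (simp add: \<Phi>_def)
  have sum\<Phi>: "(\<Sum>u\<in>F. f u) \<in> \<Phi>" if "\<And>u. u \<in> F \<Longrightarrow> f u \<in> \<Phi>" for F :: "nat list set" and f
    using that by (auto simp: \<Phi>_def inner_sum_left intro!: sum.cong)
  have step: "AE \<omega> in M. (\<forall>i. \<forall>psi\<in>\<Phi>. psi v* A \<omega> i \<in> \<Phi>) \<and>
      (\<forall>psi\<in>\<Phi>. (\<Sum>i<numN A \<omega>. psi \<bullet> (A \<omega> i *v z0)) = psi \<bullet> z0)"
    using AE_good
  proof eventually_elim
    fix \<omega> assume good: "(\<forall>i. A \<omega> i \<noteq> 0 \<longleftrightarrow> i < numN A \<omega>) \<and> 1 \<le> numN A \<omega> \<and> (\<forall>i. nonneg_mat (A \<omega> i)) \<and>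
      (\<forall>i<numN A \<omega>. A \<omega> i \<in> supp_measure mu) \<and> (\<forall>z. (\<forall>i. z i \<in> S) \<longrightarrow> branch_sum (A \<omega>) z \<in> S)"
    have cons: "(\<Sum>i<numN A \<omega>. (psi v* A \<omega> i) \<bullet> z i) = psi \<bullet> z0" if "psi \<in> \<Phi>" "\<And>i. z i \<in> S" for psi z
    proof -
      have "branch_sum (A \<omega>) z \<in> S" using good that(2) by blast
      then have "psi \<bullet> branch_sum (A \<omega>) z = psi \<bullet> z0" using that(1) by (auto simp: \<Phi>_def)
      then show ?thesis by (simp add: inner_branch_sum numN_eq_seqN)
    qed
    have "psi v* A \<omega> i \<in> \<Phi>" if psi: "psi \<in> \<Phi>" for psi i
    proof (cases "i < numN A \<omega>")
      case False
      then have "A \<omega> i = 0" using good by blast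
      then show ?thesis using zero\<Phi> by simp
    next
      case True
      have "(psi v* A \<omega> i) \<bullet> z = (psi v* A \<omega> i) \<bullet> z0" if z: "z \<in> S" for z
      proof -
        \<comment> \<open>Replacing only the \<open>i\<close>-th vector \<open>z0\<close> by
          \<open>z\<close> leaves the total unchanged, so the \<open>i\<close>-th term does not
          depend on \<open>z\<close>.\<close>
        have "(\<Sum>j<numN A \<omega>. (psi v* A \<omega> j) \<bullet> (if j = i then z else z0)) = (\<Sum>j<numN A \<omega>. (psi v* A \<omega> j) \<bullet> z0)"
          using cons[OF psi, of "\<lambda>j. if j = i then z else z0"] cons[OF psi, of "\<lambda>_. z0"] z z0(1) by auto
        then show ?thesis
          using True by (simp add: sum.remove[of "{..<numN A \<omega>}" i])
      qed
      then show ?thesis by (auto simp: \<Phi>_def)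
    qed
    moreover have "(\<Sum>i<numN A \<omega>. psi \<bullet> (A \<omega> i *v z0)) = psi \<bullet> z0" if "psi \<in> \<Phi>" for psi
      using cons[OF that, of "\<lambda>_. z0"] z0(1) by (simp add: dot_lmul_matrix)
    ultimately show "(\<forall>i. \<forall>psi\<in>\<Phi>. psi v* A \<omega> i \<in> \<Phi>) \<and>
      (\<forall>psi\<in>\<Phi>. (\<Sum>i<numN A \<omega>. psi \<bullet> (A \<omega> i *v z0)) = psi \<bullet> z0)" by blast
  qed
  obtain g where g: "g \<in> \<Gamma>" "pos_mat g" by (rule Gamma_pos')
  have "AE \<omega> in M. \<forall>i<numN A \<omega>. \<forall>psi\<in>\<Phi>. psi v* A \<omega> i \<in> \<Phi>" using step by eventually_elim auto
  moreover have "psi0 \<in> \<Phi>" using psi0(3) z0(1) by (auto simp: \<Phi>_def)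
  ultimately have psi1: "psi0 v* g \<in> \<Phi>" by (rule Gamma_invariant[OF closed\<Phi> _ g(1)])
  have psi1_pos: "\<And>i. 0 < (psi0 v* g) $ i" by (rule pos_mat_vm_pos[OF g(2) psi0(1,2)])
  define p where "p = psi0 v* g"
  note psi1 = psi1[folded p_def] and psi1_pos = psi1_pos[folded p_def]
  obtain d where d: "d > 0" "\<And>b. b \<in> supp_measure mu \<Longrightarrow> d \<le> norm b" using gap_supp_mu by blast
  obtain e where e: "e > 0" "\<And>b. nonneg_mat b \<Longrightarrow> e * norm b \<le> p \<bullet> (b *v z0)"
    using pos_functional_bounds_norm[of p z0] psi1_pos z0(2) by blast
  \<comment> \<open>Each summand contributes at least \<open>e * d\<close> to the conserved total
    \<open>p \<bullet> z0\<close>; hence \<open>N\<close> is bounded.\<close>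
  obtain K :: nat where K: "p \<bullet> z0 / (e * d) < real K" using reals_Archimedean2 by blast
  have N_le: "AE \<omega> in M. numN A \<omega> \<le> K"
    using AE_good step
  proof eventually_elim
    fix \<omega> assume good: "(\<forall>i. A \<omega> i \<noteq> 0 \<longleftrightarrow> i < numN A \<omega>) \<and> 1 \<le> numN A \<omega> \<and> (\<forall>i. nonneg_mat (A \<omega> i)) \<and>
      (\<forall>i<numN A \<omega>. A \<omega> i \<in> supp_measure mu) \<and> (\<forall>z. (\<forall>i. z i \<in> S) \<longrightarrow> branch_sum (A \<omega>) z \<in> S)"
      and st: "(\<forall>i. \<forall>psi\<in>\<Phi>. psi v* A \<omega> i \<in> \<Phi>) \<and> (\<forall>psi\<in>\<Phi>. (\<Sum>i<numN A \<omega>. psi \<bullet> (A \<omega> i *v z0)) = psi \<bullet> z0)"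
    have "e * d \<le> p \<bullet> (A \<omega> i *v z0)" if "i < numN A \<omega>" for i
    proof -
      have "e * d \<le> e * norm (A \<omega> i)" using d(2)[of "A \<omega> i"] good that e(1) by (intro mult_left_mono) auto
      also have "\<dots> \<le> p \<bullet> (A \<omega> i *v z0)" using good by (intro e(2)) blast
      finally show ?thesis .
    qed
    then have "(\<Sum>i<numN A \<omega>. e * d) \<le> (\<Sum>i<numN A \<omega>. p \<bullet> (A \<omega> i *v z0))" by (intro sum_mono) auto
    also have "\<dots> = p \<bullet> z0" using st psi1 by blast
    finally have "real (numN A \<omega>) \<le> p \<bullet> z0 / (e * d)" using e(1) d(1) by (simp add: pos_le_divide_eq)
    with K show "numN A \<omega> \<le> K" by linarith
  qed
  \<comment> \<open>The bound \<open>K\<close> turns the conserved sum into a continuous function of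
    finitely many coordinates. This makes \<open>C\<close> closed, so that conservation reaches the
    support of the random sequence.\<close>
  define C where "C = {a :: nat \<Rightarrow> real^'d^'d. (\<forall>i\<ge>K. a i = 0) \<and> (\<forall>psi\<in>\<Phi>. \<forall>i. psi v* a i \<in> \<Phi>) \<and>
    (\<forall>psi\<in>\<Phi>. psi \<bullet> (\<Sum>i<K. a i *v z0) = psi \<bullet> z0)}"
  have "suppA \<subseteq> C"
  proof (rule suppA_subset)
    have cont: "continuous_on UNIV (\<lambda>a :: nat \<Rightarrow> real^'d^'d. a i)" for i
      by (rule continuous_on_product_coordinates)
    have "C = (\<Inter>i\<in>{K..}. {a. a i = 0}) \<inter> (\<Inter>psi\<in>\<Phi>. \<Inter>i. (\<lambda>a. psi v* a i) -` \<Phi>) \<inter>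
       (\<Inter>psi\<in>\<Phi>. {a. psi \<bullet> (\<Sum>i<K. a i *v z0) = psi \<bullet> z0})"
      unfolding C_def by auto
    then show "closed C"
      by (auto intro!: closed_Int closed_INT closed_Collect_eq closed_vimage closed\<Phi> continuous_intros cont)
    show "AE \<omega> in M. A \<omega> \<in> C"
      using AE_good step N_le
    proof eventually_elim
      fix \<omega> assume good: "(\<forall>i. A \<omega> i \<noteq> 0 \<longleftrightarrow> i < numN A \<omega>) \<and> 1 \<le> numN A \<omega> \<and> (\<forall>i. nonneg_mat (A \<omega> i)) \<and>
        (\<forall>i<numN A \<omega>. A \<omega> i \<in> supp_measure mu) \<and> (\<forall>z. (\<forall>i. z i \<in> S) \<longrightarrow> branch_sum (A \<omega>) z \<in> S)"
        and st: "(\<forall>i. \<forall>psi\<in>\<Phi>. psi v* A \<omega> i \<in> \<Phi>) \<and> (\<forall>psi\<in>\<Phi>. (\<Sum>i<numN A \<omega>. psi \<bullet> (A \<omega> i *v z0)) = psi \<bullet> z0)"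
        and NK: "numN A \<omega> \<le> K"
      have zero: "A \<omega> i = 0" if "numN A \<omega> \<le> i" for i using good that by (meson not_less)
      have "(\<Sum>i<K. A \<omega> i *v z0) = (\<Sum>i<numN A \<omega>. A \<omega> i *v z0)"
        using NK zero by (intro sum.mono_neutral_right) auto
      then have "psi \<bullet> (\<Sum>i<K. A \<omega> i *v z0) = psi \<bullet> z0" if "psi \<in> \<Phi>" for psi
        using st that by (simp add: inner_sum_right)
      then show "A \<omega> \<in> C" using st zero NK by (auto simp: C_def)
    qed
  qed
  then have aC: "a v \<in> C" for v using a by blast
  have weight\<Phi>: "psi v* weight a u \<in> \<Phi>" if "\<And>v. a v \<in> C" "psi \<in> \<Phi>" for a u psi
    using that
  proof (induction u arbitrary: a psi)
    case (Cons i u)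
    have "psi v* a [] i \<in> \<Phi>" using Cons.prems by (auto simp: C_def)
    then have "(psi v* a [] i) v* weight (\<lambda>v. a (i # v)) u \<in> \<Phi>" by (intro Cons.IH Cons.prems)
    then show ?case by (simp add: weight_Cons vector_matrix_mul_assoc)
  qed simp
  \<comment> \<open>A cover set is infinite unless it is \<open>{[]}\<close>; \<open>F\<close> keeps
    its words with all letters below \<open>K\<close>, and all others have weight 0.\<close>
  have tree: "\<exists>F. finite F \<and> F \<subseteq> U \<and> (\<forall>u\<in>U - F. weight a u = 0) \<and>
      (\<forall>psi\<in>\<Phi>. psi \<bullet> (\<Sum>u\<in>F. weight a u *v z0) = psi \<bullet> z0)"
    if "cover_set U" "\<And>u. u \<in> U \<Longrightarrow> length u \<le> L" "\<And>v. a v \<in> C" for U a L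
    using that
  proof (induction L arbitrary: U a)
    case 0
    then have "U = {[]}" using cover_set_nonempty[of U] by fastforce
    then show ?case by (intro exI[of _ "{[]}"]) auto
  next
    case (Suc L)
    show ?case
    proof (cases "[] \<in> U")
      case True
      then have "U = {[]}" using cover_set_antichain[OF Suc.prems(1) True] by auto
      then show ?thesis by (intro exI[of _ "{[]}"]) auto
    next
      case False
      have "\<exists>F. finite F \<and> F \<subseteq> {u. i # u \<in> U} \<and> (\<forall>u\<in>{u. i # u \<in> U} - F. weight (\<lambda>v. a (i # v)) u = 0) \<and>
          (\<forall>psi\<in>\<Phi>. psi \<bullet> (\<Sum>u\<in>F. weight (\<lambda>v. a (i # v)) u *v z0) = psi \<bullet> z0)" for i
      proof (rule Suc.IH)
        show "cover_set {u. i # u \<in> U}" by (rule cover_set_subtree[OF Suc.prems(1) False])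
        show "length u \<le> L" if "u \<in> {u. i # u \<in> U}" for u using Suc.prems(2)[of "i # u"] that by simp
      qed (rule Suc.prems)
      from choice[OF allI, OF this]
      obtain F where F0: "\<forall>i. finite (F i) \<and> F i \<subseteq> {u. i # u \<in> U} \<and>
          (\<forall>u\<in>{u. i # u \<in> U} - F i. weight (\<lambda>v. a (i # v)) u = 0) \<and>
          (\<forall>psi\<in>\<Phi>. psi \<bullet> (\<Sum>u\<in>F i. weight (\<lambda>v. a (i # v)) u *v z0) = psi \<bullet> z0)" ..
      have F: "finite (F i)" "F i \<subseteq> {u. i # u \<in> U}"
        "i # u \<in> U \<Longrightarrow> u \<notin> F i \<Longrightarrow> weight (\<lambda>v. a (i # v)) u = 0"
        "psi \<in> \<Phi> \<Longrightarrow> psi \<bullet> (\<Sum>u\<in>F i. weight (\<lambda>v. a (i # v)) u *v z0) = psi \<bullet> z0" for i u psi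
        using F0[rule_format, of i] by simp_all
      define G where "G = (\<lambda>p. fst p # snd p) ` Sigma {..<K} F"
      have aC: "a [] \<in> C" by (rule Suc.prems)
      have inj: "inj_on (\<lambda>p. fst p # snd p) (Sigma {..<K} F)" by (auto simp: inj_on_def)
      have "finite G" unfolding G_def using F(1) by auto
      moreover have "G \<subseteq> U" unfolding G_def using F(2) by force
      moreover have "weight a u = 0" if "u \<in> U - G" for u
      proof -
        have "u \<noteq> []" using that False by auto
        then obtain i w where u: "u = i # w" by (cases u) auto
        show ?thesis
        proof (cases "i < K")
          case True
          then have "w \<notin> F i" using that u by (force simp: G_def)
          then show ?thesis using F(3)[of i w] that u by (simp add: weight_Cons)
        next
          case False
          then have "a [] i = 0" using aC by (auto simp: C_def)
          then show ?thesis using u by (simp add: weight_Cons)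
        qed
      qed
      moreover have "psi \<bullet> (\<Sum>u\<in>G. weight a u *v z0) = psi \<bullet> z0" if psi: "psi \<in> \<Phi>" for psi
      proof -
        have "(\<Sum>u\<in>G. weight a u *v z0) = (\<Sum>p\<in>Sigma {..<K} F. weight a (fst p # snd p) *v z0)"
          unfolding G_def by (subst sum.reindex[OF inj]) simp
        also have "\<dots> = (\<Sum>i<K. a [] i *v (\<Sum>u\<in>F i. weight (\<lambda>v. a (i # v)) u *v z0))"
          using F(1) by (simp add: matrix_vector_mult_sum matrix_vector_mul_assoc weight_Cons sum.Sigma case_prod_beta)
        finally have eq: "(\<Sum>u\<in>G. weight a u *v z0) = (\<Sum>i<K. a [] i *v (\<Sum>u\<in>F i. weight (\<lambda>v. a (i # v)) u *v z0))" .
        have "psi \<bullet> (\<Sum>u\<in>G. weight a u *v z0)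
            = (\<Sum>i<K. (psi v* a [] i) \<bullet> (\<Sum>u\<in>F i. weight (\<lambda>v. a (i # v)) u *v z0))"
          unfolding eq by (subst inner_sum_right) (simp only: dot_lmul_matrix)
        also have "\<dots> = (\<Sum>i<K. (psi v* a [] i) \<bullet> z0)"
          using psi aC by (intro sum.cong F(4)) (auto simp: C_def)
        also have "\<dots> = psi \<bullet> z0" using psi aC by (auto simp: C_def inner_sum_right dot_lmul_matrix)
        finally show ?thesis .
      qed
      ultimately show ?thesis by blast
    qed
  qed
  obtain lev where "\<And>u. u \<in> U \<Longrightarrow> length u \<le> lev" using U(2) by (auto simp: finite_level_def)
  from tree[OF U(1) this aC]
  obtain F where F0: "finite F \<and> F \<subseteq> U \<and> (\<forall>u\<in>U - F. weight a u = 0) \<and>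
      (\<forall>psi\<in>\<Phi>. psi \<bullet> (\<Sum>u\<in>F. weight a u *v z0) = psi \<bullet> z0)" ..
  have F: "finite F" "F \<subseteq> U" "u \<in> U - F \<Longrightarrow> weight a u = 0"
    "psi \<in> \<Phi> \<Longrightarrow> psi \<bullet> (\<Sum>u\<in>F. weight a u *v z0) = psi \<bullet> z0" for u psi
    using F0 by simp_all
  define m where "m = gsum a U"
  have m: "m = (\<Sum>u\<in>F. weight a u)"
  proof -
    have "infsum (weight a) U = infsum (weight a) F" using F(2,3) by (intro infsum_cong_neutral) auto
    then show ?thesis using F(1) by (simp add: m_def gsum_def)
  qed
  have m_cons: "psi \<bullet> (m *v z0) = psi \<bullet> z0" if "psi \<in> \<Phi>" for psi
    using F(4)[OF that] by (simp add: m sum_matrix_vector_mult)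
  have m\<Phi>: "psi v* m \<in> \<Phi>" if "psi \<in> \<Phi>" for psi
  proof -
    have "psi v* m = (\<Sum>u\<in>F. psi v* weight a u)"
      by (simp add: m vec_eq_iff vector_matrix_mult_def sum_distrib_right sum_distrib_left) (subst sum.swap, simp)
    then show ?thesis using weight\<Phi>[of a, OF aC that] by (simp add: sum\<Phi>)
  qed
  have pow_cons: "psi \<bullet> (mpow m n *v z0) = psi \<bullet> z0" if "psi \<in> \<Phi>" for psi n
    using that
  proof (induction n arbitrary: psi)
    case (Suc n)
    have "psi \<bullet> (mpow m (Suc n) *v z0) = (psi v* m) \<bullet> (mpow m n *v z0)"
      by (simp add: matrix_vector_mul_assoc[symmetric] dot_lmul_matrix)
    also have "\<dots> = (psi v* m) \<bullet> z0" by (intro Suc.IH m\<Phi> Suc.prems)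
    also have "\<dots> = psi \<bullet> z0" using m_cons[OF Suc.prems] by (simp add: dot_lmul_matrix)
    finally show ?case .
  qed simp
  have mp: "pos_mat m" "spec_rad m < 1" using l by (simp_all add: m_def)
  obtain t where t: "t > 0" "z0 \<le> t *\<^sub>R perron_vec m"
    using pos_vec_dominates[of "perron_vec m" z0] perron_vec_pos[OF mp(1)] by blast
  have p0: "0 \<le> p" using psi1_pos by (auto simp: less_eq_vec_def intro: less_imp_le)
  \<comment> \<open>Conservation makes \<open>p \<bullet> (mpow m n *v z0)\<close> constant in
    \<open>n\<close>, whereas \<open>spec_rad m < 1\<close> sends it to 0.\<close>
  have bound: "p \<bullet> z0 \<le> t * (p \<bullet> perron_vec m) * spec_rad m ^ n" for n
  proof -
    have "p \<bullet> z0 = p \<bullet> (mpow m n *v z0)" using pow_cons[OF psi1] by simp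
    also have "\<dots> \<le> p \<bullet> (mpow m n *v (t *\<^sub>R perron_vec m))"
      using t mp(1) by (intro inner_vec_mono p0 nonneg_mat_vec_mono nonneg_mat_mprod) (auto intro: pos_mat_imp_nonneg)
    also have "\<dots> = t * (p \<bullet> perron_vec m) * spec_rad m ^ n"
      by (simp add: matrix_vector_mult_scaleR mpow_eigen[OF perron_vec_eigen[OF mp(1)]])
    finally show ?thesis .
  qed
  have "(\<lambda>n. t * (p \<bullet> perron_vec m) * spec_rad m ^ n) \<longlonglongrightarrow> t * (p \<bullet> perron_vec m) * 0"
    using mp spec_rad_pos[OF mp(1)] by (intro tendsto_intros LIMSEQ_power_zero) auto
  then have "p \<bullet> z0 \<le> t * (p \<bullet> perron_vec m) * 0"
    using bound by (intro tendsto_lowerbound[of _ _ sequentially]) auto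
  moreover have "0 < p \<bullet> z0"
  proof (rule inner_vec_pos)
    show "z0 \<noteq> 0" using z0(2) by (metis less_irrefl zero_index)
  qed (use psi1_pos S_nonneg[OF z0(1)] in auto)
  ultimately show False by simp
qed

lemma AE_admissible:
  assumes zero: "0 \<in> S"
  shows "AE \<omega> in M. \<forall>I. finite I \<longrightarrow> admissible S I (A \<omega>)"
  using AE_good
proof eventually_elim
  fix \<omega> assume good: "(\<forall>i. A \<omega> i \<noteq> 0 \<longleftrightarrow> i < numN A \<omega>) \<and> 1 \<le> numN A \<omega> \<and> (\<forall>i. nonneg_mat (A \<omega> i)) \<and>
    (\<forall>i<numN A \<omega>. A \<omega> i \<in> supp_measure mu) \<and> (\<forall>z. (\<forall>i. z i \<in> S) \<longrightarrow> branch_sum (A \<omega>) z \<in> S)"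
  show "\<forall>I. finite I \<longrightarrow> admissible S I (A \<omega>)"
    unfolding admissible_def
  proof (intro allI impI conjI)
    fix I :: "nat set" and z assume fin: "finite I" and z: "\<forall>i\<in>I. z i \<in> S"
    define y where "y = (\<lambda>i. if i \<in> I then z i else 0)"
    have zero': "A \<omega> i = 0" if "numN A \<omega> \<le> i" for i using good that by (meson not_less)
    have "branch_sum (A \<omega>) y \<in> S" using good z zero by (auto simp: y_def)
    also have "branch_sum (A \<omega>) y = (\<Sum>i\<in>I \<union> {..<numN A \<omega>}. A \<omega> i *v y i)"
      unfolding branch_sum_def numN_eq_seqN[symmetric] using fin zero' by (intro sum.mono_neutral_left) auto
    also have "\<dots> = (\<Sum>i\<in>I. A \<omega> i *v z i)"
      using fin by (intro sum.mono_neutral_cong_right) (auto simp: y_def)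
    finally show "(\<Sum>i\<in>I. A \<omega> i *v z i) \<in> S" .
  qed
qed

text \<open>For fixed \<open>I\<close> and \<open>z\<close> the condition is closed and involves
  finitely many entries, so it passes to the support even when a limit sequence has infinitely many
  nonzero matrices.\<close>

lemma suppA_admissible:
  assumes "0 \<in> S" "a \<in> suppA" "finite I"
  shows "admissible S I a"
proof -
  have "suppA \<subseteq> {a. (\<Sum>i\<in>I. a i *v z i) \<in> S}" if z: "\<forall>i\<in>I. z i \<in> S" for z
  proof (rule suppA_subset)
    have cont: "continuous_on UNIV (\<lambda>a :: nat \<Rightarrow> real^'d^'d. a i)" for i
      by (rule continuous_on_product_coordinates)
    have "closed ((\<lambda>a. \<Sum>i\<in>I. a i *v z i) -` S)"
      by (intro closed_vimage closed_S continuous_intros cont)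
    then show "closed {a. (\<Sum>i\<in>I. a i *v z i) \<in> S}" by (simp add: vimage_def)
    show "AE \<omega> in M. A \<omega> \<in> {a. (\<Sum>i\<in>I. a i *v z i) \<in> S}"
      using AE_admissible[OF assms(1)] by eventually_elim (use assms(3) z in \<open>auto simp: admissible_def\<close>)
  qed
  with assms(2,3) show ?thesis unfolding admissible_def by blast
qed

lemma Gamma_S:
  assumes zero: "0 \<in> S" and g: "g \<in> \<Gamma>" "z \<in> S"
  shows "g *v z \<in> S"
proof -
  have supp: "b *v z \<in> S" if "b \<in> supp_measure mu" "z \<in> S" for b z
  proof -
    have "supp_measure mu \<subseteq> {b. b *v z \<in> S}"
    proof (rule supp_mu_subset)
      have "closed ((\<lambda>b. b *v z) -` S)" by (intro closed_vimage closed_S continuous_intros)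
      then show "closed {b. b *v z \<in> S}" by (simp add: vimage_def)
      show "AE \<omega> in M. \<forall>i<numN A \<omega>. A \<omega> i \<in> {b. b *v z \<in> S}"
        using AE_admissible[OF zero]
      proof eventually_elim
        fix \<omega> assume adm: "\<forall>I. finite I \<longrightarrow> admissible S I (A \<omega>)"
        have "A \<omega> i *v z \<in> S" for i
          using adm[rule_format, of "{i}"] that(2) by (auto simp: admissible_def)
        then show "\<forall>i<numN A \<omega>. A \<omega> i \<in> {b. b *v z \<in> S}" by simp
      qed
    qed
    with that(1) show ?thesis by blast
  qed
  show ?thesis using g unfolding \<Gamma>_def
    by (induction arbitrary: z rule: semigrp.induct) (auto simp: matrix_vector_mul_assoc[symmetric] intro: supp)
qed

lemma cone_sum_subset_support:
  assumes U1: "cover_set U1" "finite_level U1" "\<And>v. a1 v \<in> suppA" "weight a1 summable_on U1"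
      "pos_mat (gsum a1 U1)" "spec_rad (gsum a1 U1) < 1"
    and U2: "cover_set U2" "\<And>v. a2 v \<in> suppA" "weight a2 summable_on U2"
      "pos_mat (gsum a2 U2)" "1 < spec_rad (gsum a2 U2)"
    and U: "cover_set U" and a: "\<And>v. a v \<in> suppA"
  shows "cone_sum {perron_vec (gsum a V) | V. V \<subseteq> U \<and> weight a summable_on V \<and> pos_mat (gsum a V)} \<subseteq> S"
proof -
  have zero: "0 \<in> S" by (rule zero_in_S[OF U1(1-3,5,6)])
  have adm: "admissible S W (weight a)" if "finite W" "W \<subseteq> U" "cover_set U" "\<And>v. a v \<in> suppA" for a W U
  proof (rule admissible_tree[where A = suppA])
    show "w = []" if "u \<in> W" "u @ w \<in> W" for u w
      using cover_set_antichain[OF \<open>cover_set U\<close>] that \<open>W \<subseteq> U\<close> by blast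
  qed (use that zero suppA_admissible[OF zero] in auto)
  have nn: "nonneg_mat (weight a u)" if "\<And>v. a v \<in> suppA" for a u
    using that by (intro nonneg_mat_weight suppA_nonneg)
  \<comment> \<open>Positivity and the strict inequality for the spectral radius are open
    conditions, so a large finite part of the tree inherits them.\<close>
  have finite_part: "\<exists>W. finite W \<and> W \<subseteq> V \<and> pos_mat (sum (weight a) W) \<and> P (spec_rad (sum (weight a) W))"
    if V: "weight a summable_on V" "pos_mat (gsum a V)" "open {r. P r}" "P (spec_rad (gsum a V))"
    for a :: "nat list \<Rightarrow> nat \<Rightarrow> real^'d^'d" and V P
  proof -
    obtain X where X: "\<And>n. finite (X n)" "\<And>n. X n \<subseteq> V" "(\<lambda>n. sum (weight a) (X n)) \<longlonglongrightarrow> gsum a V"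
      using has_sum_finite_approx[OF V(1)] unfolding gsum_def by metis
    have "\<forall>\<^sub>F n in sequentially. pos_mat (sum (weight a) (X n))"
      using topological_tendstoD[OF X(3) open_pos_mat] V(2) by simp
    moreover have "\<forall>\<^sub>F n in sequentially. P (spec_rad (sum (weight a) (X n)))"
      using topological_tendstoD[OF tendsto_spec_rad[OF X(3) V(2)] V(3)] V(4) by simp
    ultimately have "\<forall>\<^sub>F n in sequentially. pos_mat (sum (weight a) (X n)) \<and> P (spec_rad (sum (weight a) (X n)))"
      by eventually_elim simp
    then obtain n where "pos_mat (sum (weight a) (X n)) \<and> P (spec_rad (sum (weight a) (X n)))"
      using eventually_happens'[OF sequentially_bot] by blast
    with X show ?thesis by blast
  qed
  obtain I1 where I1: "finite I1" "I1 \<subseteq> U1" "pos_mat (sum (weight a1) I1)" "spec_rad (sum (weight a1) I1) < 1"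
    using finite_part[OF U1(4,5), of "\<lambda>r. r < 1"] U1(6) by (auto simp: lessThan_def[symmetric])
  obtain I2 where I2: "finite I2" "I2 \<subseteq> U2" "pos_mat (sum (weight a2) I2)" "1 < spec_rad (sum (weight a2) I2)"
    using finite_part[OF U2(3,4), of "\<lambda>r. 1 < r"] U2(5) by (auto simp: greaterThan_def[symmetric])
  obtain z0 where z0: "z0 \<in> S" "\<And>i. 0 < z0 $ i" using obtain_pos_in_S by blast
  obtain g where g: "g \<in> \<Gamma>" "pos_mat g" by (rule Gamma_pos')
  have "AE \<omega> in M. (\<forall>I. finite I \<longrightarrow> admissible S I (A \<omega>)) \<and> (\<forall>i<numN A \<omega>. A \<omega> i \<in> supp_measure mu)"
    using AE_admissible[OF zero] AE_supp_mu by eventually_elim auto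
  then obtain \<omega> where w: "(\<forall>I. finite I \<longrightarrow> admissible S I (A \<omega>)) \<and> (\<forall>i<numN A \<omega>. A \<omega> i \<in> supp_measure mu)"
    and N2: "2 \<le> numN A \<omega>" by (rule ex_two)
  have w01: "A \<omega> 0 \<in> \<Gamma>" "A \<omega> 1 \<in> \<Gamma>" using w N2 by (auto intro!: supp_mu_Gamma)
  \<comment> \<open>The two matrices have a positive entry in each row; the right factor
    \<open>g\<close> makes both products positive.\<close>
  define c where "c = (\<lambda>i. (if i then A \<omega> 0 else A \<omega> 1) ** g)"
  interpret scaled_family_set S z0 c I1 I2 "weight a1" "weight a2"
  proof
    show "admissible S UNIV c"
      unfolding admissible_def
    proof (intro conjI allI impI)
      fix z :: "bool \<Rightarrow> real^'d" assume z: "\<forall>i\<in>UNIV. z i \<in> S"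
      define y where "y = (\<lambda>i :: nat. if i = 0 then g *v z True else g *v z False)"
      have "(\<Sum>i\<in>{0, 1}. A \<omega> i *v y i) \<in> S"
        using w[THEN conjunct1, rule_format, of "{0, 1}"] z
        by (intro admissibleD[of S "{0, 1}"]) (auto simp: y_def intro!: Gamma_S[OF zero g(1)])
      then show "(\<Sum>i\<in>UNIV. c i *v z i) \<in> S"
        by (simp add: UNIV_bool c_def y_def matrix_vector_mul_assoc add.commute)
    qed simp
    show "pos_mat (c i)" for i
      using w01 Gamma_row by (auto simp: c_def intro!: pos_mat_mult g Gamma_nonneg)
  qed (use closed_S S_nonneg zero z0 I1 I2 U1 U2 in \<open>auto intro!: adm[of I1 U1] adm[of I2 U2] nn\<close>)
  show ?thesis
    unfolding gsum_def using adm[OF _ _ U a] nn[OF a] by (intro perron_cone) auto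
qed

end

section \<open>Cones generated by subsets of the simplex\<close>

lemma convex_conic_add:
  assumes "convex K" "conic K" "x \<in> K" "y \<in> K"
  shows "x + y \<in> K"
proof -
  have "(1/2) *\<^sub>R x + (1/2) *\<^sub>R y \<in> K" using assms by (intro convexD) auto
  then have "2 *\<^sub>R ((1/2) *\<^sub>R x + (1/2) *\<^sub>R y) \<in> K" using assms(2) by (intro conicD) auto
  then show ?thesis by (simp add: scaleR_add_right)
qed

lemma Hd_set_subset_H_set: "Hd_set L \<subseteq> (H_set L :: (real^'d) set)"
proof
  fix x :: "real^'d" assume "x \<in> Hd_set L"
  then obtain s v where x: "x = (\<Sum>i\<in>(UNIV::'d set). s i *\<^sub>R v i)" "\<forall>i. s i \<ge> 0 \<and> v i \<in> L"
    unfolding Hd_set_def by blast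
  obtain h :: "nat \<Rightarrow> 'd" where h: "bij_betw h {0..<CARD('d)} UNIV"
    using ex_bij_betw_nat_finite[OF finite_class.finite_UNIV] by blast
  have "x = (\<Sum>i<CARD('d). s (h i) *\<^sub>R v (h i))"
    unfolding x(1) using sum.reindex_bij_betw[OF h, of "\<lambda>i. s i *\<^sub>R v i"] by (simp add: atLeast0LessThan)
  moreover have "CARD('d) \<ge> 1" using finite_UNIV_card_ge_0[where 'a = 'd] by simp
  ultimately show "x \<in> H_set L"
    unfolding H_set_def using x(2)
    by (intro CollectI exI[of _ "CARD('d)"] exI[of _ "s \<circ> h"] exI[of _ "v \<circ> h"]) auto
qed

locale simplex_subset =
  fixes L :: "(real^'d) set"
  assumes nonempty: "L \<noteq> {}" and simplex: "\<And>x. x \<in> L \<Longrightarrow> 0 \<le> x \<and> l1norm x = 1" and closed_L: "closed L"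
begin

lemma compact_L: "compact L"
proof -
  have "L = {x. 0 \<le> x \<and> l1norm x = 1} \<inter> L" using simplex by blast
  then show ?thesis using compact_Int_closed[OF compact_l1_simplex closed_L] by simp
qed

lemma hull_hyperplane: "convex hull L \<subseteq> {x. 1 \<bullet> x = 1}"
  using simplex by (intro hull_minimal convex_hyperplane) (auto simp: l1norm_eq_inner[symmetric])

abbreviation "K \<equiv> conic hull (convex hull L)"

text \<open>Closedness is the delicate point: the hull of the compact set lies in the hyperplane
  \<open>1 \<bullet> x = 1\<close>, hence away from 0, and the cone over such a compact set is
  closed.\<close>

lemma convex_K: "convex K" and conic_K: "conic K" and closed_K: "closed K"
proof -
  show "convex K" by (rule convex_conic_hull) (rule convex_convex_hull)
  show "conic K" by (rule conic_conic_hull)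
  have "0 \<notin> convex hull L" using hull_hyperplane by auto
  then show "closed K" using compact_convex_hull[OF compact_L] by (intro closed_conic_hull) auto
qed

lemma L_subset_K: "L \<subseteq> K"
  by (meson hull_subset order.trans)

lemma zero_K: "0 \<in> K"
  using conicD[OF conic_K, of _ 0] L_subset_K nonempty by fastforce

lemma H_set_subset_K: "H_set L \<subseteq> K"
proof
  fix x assume "x \<in> H_set L"
  then obtain n s v where x: "x = (\<Sum>i<(n::nat). s i *\<^sub>R v i)" "\<forall>i<n. s i \<ge> 0 \<and> v i \<in> L"
    unfolding H_set_def by blast
  have "(\<Sum>i<m. s i *\<^sub>R v i) \<in> K" if "m \<le> n" for m
    using that
  proof (induction m)
    case (Suc m)
    have "s m *\<^sub>R v m \<in> K" using Suc.prems x(2) L_subset_K by (intro conicD[OF conic_K]) auto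
    then show ?case using Suc by (simp add: convex_conic_add[OF convex_K conic_K])
  qed (simp add: nonempty)
  then show "x \<in> K" unfolding x(1) by simp
qed

text \<open>Caratheodory inside the hyperplane \<open>1 \<bullet> x = 1\<close>, of dimension
  \<open>CARD('d) - 1\<close>: this saves one point and leaves \<open>CARD('d)\<close>
  generators.\<close>

lemma K_subset_Hd_set: "K \<subseteq> Hd_set L"
proof
  fix x assume "x \<in> K"
  then obtain c y where x: "x = c *\<^sub>R y" "0 \<le> c" "y \<in> convex hull L"
    unfolding conic_hull_explicit by blast
  have "aff_dim L \<le> aff_dim {x::real^'d. 1 \<bullet> x = 1}"
    by (rule aff_dim_subset) (use simplex in \<open>auto simp: l1norm_eq_inner[symmetric]\<close>)
  also have "\<dots> = int CARD('d) - 1"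
    by (subst aff_dim_hyperplane) (auto simp: vec_eq_iff)
  finally have dim: "aff_dim L + 1 \<le> int CARD('d)" by simp
  obtain T where T: "finite T" "T \<subseteq> L" "int (card T) \<le> aff_dim L + 1" "y \<in> convex hull T"
    using x(3) unfolding caratheodory_aff_dim[of L] by blast
  then obtain u where u: "\<forall>x\<in>T. 0 \<le> u x" "(\<Sum>x\<in>T. u x *\<^sub>R x) = y"
    by (auto simp: convex_hull_finite)
  have "card T \<le> CARD('d)" using T(3) dim by simp
  then obtain f :: "real^'d \<Rightarrow> 'd" where f: "inj_on f T"
    using T(1) by (metis card_le_inj finite_class.finite_UNIV)
  obtain l0 where l0: "l0 \<in> L" using nonempty by blast
  define v where "v = (\<lambda>i. if i \<in> f ` T then the_inv_into T f i else l0)"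
  define s where "s = (\<lambda>i. if i \<in> f ` T then c * u (the_inv_into T f i) else 0)"
  have "(\<Sum>i\<in>UNIV. s i *\<^sub>R v i) = (\<Sum>i\<in>f ` T. s i *\<^sub>R v i)"
    by (rule sum.mono_neutral_right) (auto simp: s_def)
  also have "\<dots> = (\<Sum>x\<in>T. c *\<^sub>R (u x *\<^sub>R x))"
    by (subst sum.reindex[OF f]) (auto simp: s_def v_def the_inv_into_f_f[OF f] intro!: sum.cong)
  also have "\<dots> = x" by (simp add: x(1) u(2)[symmetric] scaleR_sum_right)
  finally have "x = (\<Sum>i\<in>UNIV. s i *\<^sub>R v i)" ..
  moreover have "0 \<le> s i \<and> v i \<in> L" for i
    using x(2) u(1) T(2) l0 by (auto simp: s_def v_def the_inv_into_f_f[OF f])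
  ultimately show "x \<in> Hd_set L" unfolding Hd_set_def by blast
qed

lemma H_set_eq: "H_set L = K" and Hd_set_eq: "Hd_set L = K"
  using H_set_subset_K K_subset_Hd_set Hd_set_subset_H_set[of L] by blast+

end

section \<open>Images of Perron vectors as limits of Perron vectors\<close>

lemma perron_vec_scaleR:
  assumes "pos_mat g" "0 < s"
  shows "perron_vec (s *\<^sub>R g) = perron_vec g"
proof (rule sym, rule perron_vec_unique)
  show "pos_mat (s *\<^sub>R g)" using assms by (simp add: pos_mat_def)
  show "s *\<^sub>R g *v perron_vec g = (s * spec_rad g) *\<^sub>R perron_vec g"
    by (simp add: scaleR_matrix_vector_assoc[symmetric] perron_vec_eigen[OF assms(1)])
qed (simp_all add: perron_vec_nonneg l1norm_perron_vec assms)

lemma pos_mat_mpow: "pos_mat g \<Longrightarrow> pos_mat (mpow g (Suc n))"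
proof (induction n)
  case (Suc n)
  have "pos_mat (g ** mpow g (Suc n))"
  proof (rule pos_mat_mult)
    show "\<forall>i. \<exists>j. 0 < g $ i $ j" "nonneg_mat g"
      using Suc.prems by (auto simp: pos_mat_def nonneg_mat_def intro: less_imp_le)
  qed (use Suc in auto)
  then show ?case by simp
qed simp

lemma matrix_tendstoI:
  fixes G :: "'a \<Rightarrow> real^'n^'m"
  assumes "\<And>j. ((\<lambda>x. G x *v axis j 1) \<longlongrightarrow> g *v axis j 1) F"
  shows "(G \<longlongrightarrow> g) F"
proof (rule vec_tendstoI, rule vec_tendstoI)
  fix i j
  have "((\<lambda>x. (G x *v axis j 1) $ i) \<longlongrightarrow> (g *v axis j 1) $ i) F" by (intro tendsto_vec_nth assms)
  then show "((\<lambda>x. G x $ i $ j) \<longlongrightarrow> g $ i $ j) F"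
    by (simp add: matrix_vector_mult_basis column_def)
qed

text \<open>Divided by \<open>r ^ n\<close>, the products \<open>a b^n\<close> tend to the rank-one
  matrix \<open>R\<close> with entries \<open>w_i l_j\<close>, where \<open>w = a v\<close>; its
  Perron vector is the normalised \<open>w\<close>. The exponent starts at 1, where the product is
  already positive.\<close>

lemma perron_vec_right_factor:
  fixes a b :: "real^'d^'d"
  assumes a: "nonneg_mat a" "\<And>i. \<exists>j. 0 < a $ i $ j" and b: "pos_mat b"
  obtains s where "s > 0" "(\<lambda>n. perron_vec (a ** mpow b (Suc n))) \<longlonglongrightarrow> s *\<^sub>R (a *v perron_vec b)"
proof -
  obtain l where l: "\<And>i. 0 < l $ i" "l v* b = spec_rad b *\<^sub>R l" "l \<bullet> perron_vec b = 1"
    using left_perron_vec[OF b] by metis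
  let ?v = "perron_vec b" let ?r = "spec_rad b"
  have r: "?r > 0" by (rule spec_rad_pos[OF b])
  define w where "w = a *v ?v"
  have wpos: "0 < w $ i" for i
  proof -
    obtain j where j: "0 < a $ i $ j" using a(2) by blast
    have "0 < perron_vec b \<bullet> (a $ i)"
    proof (rule inner_vec_pos[OF perron_vec_pos[OF b]])
      show "0 \<le> a $ i" using a(1) by (simp add: nonneg_mat_def less_eq_vec_def)
      show "a $ i \<noteq> 0" using j by auto
    qed
    then show ?thesis by (simp add: w_def matrix_vector_mul_component inner_commute)
  qed
  define R :: "real^'d^'d" where "R = (\<chi> i j. w $ i * l $ j)"
  have Rv: "R *v y = (l \<bullet> y) *\<^sub>R w" for y
    by (simp add: R_def vec_eq_iff matrix_vector_mult_def inner_vec_def sum_distrib_left mult_ac)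
  have R: "pos_mat R" using wpos l(1) by (simp add: R_def pos_mat_def)
  define G where "G = (\<lambda>n. (1 / ?r ^ Suc n) *\<^sub>R (a ** mpow b (Suc n)))"
  have "G \<longlonglongrightarrow> R"
  proof (rule matrix_tendstoI)
    fix j :: 'd
    let ?e = "axis j 1 :: real^'d"
    have e: "0 \<le> ?e" by (simp add: less_eq_vec_def axis_def)
    have "(\<lambda>n. mpow b n *v ((1 / ?r ^ n) *\<^sub>R ?e)) \<longlonglongrightarrow> (l \<bullet> ?e) *\<^sub>R ?v"
      using e r by (intro perron_limit[OF b l]) (auto intro!: scaleR_nonneg_nonneg)
    then have "(\<lambda>n. a *v (mpow b (Suc n) *v ((1 / ?r ^ Suc n) *\<^sub>R ?e))) \<longlonglongrightarrow> a *v ((l \<bullet> ?e) *\<^sub>R ?v)"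
      by (intro tendsto_intros LIMSEQ_Suc[of "\<lambda>n. mpow b n *v ((1 / ?r ^ n) *\<^sub>R ?e)"])
    then show "(\<lambda>n. G n *v ?e) \<longlonglongrightarrow> R *v ?e"
      by (simp add: G_def Rv w_def matrix_vector_mult_scaleR scaleR_matrix_vector_assoc[symmetric]
          matrix_vector_mul_assoc[symmetric])
  qed
  then have lim: "(\<lambda>n. perron_vec (G n)) \<longlonglongrightarrow> perron_vec R" using R by (rule tendsto_perron_vec)
  have G: "perron_vec (G n) = perron_vec (a ** mpow b (Suc n))" for n
    unfolding G_def using r a pos_mat_mpow[OF b] by (intro perron_vec_scaleR pos_mat_mult) auto
  have w0: "w \<noteq> 0" using wpos by (metis less_irrefl zero_index)
  have R_eq: "perron_vec R = (1 / l1norm w) *\<^sub>R w"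
  proof (rule sym, rule perron_vec_unique[OF R])
    have "l1norm w > 0" using w0 by (rule l1norm_pos)
    then show "0 \<le> (1 / l1norm w) *\<^sub>R w" "l1norm ((1 / l1norm w) *\<^sub>R w) = 1"
      using wpos by (auto simp: less_eq_vec_def intro: less_imp_le)
    show "R *v (1 / l1norm w) *\<^sub>R w = (l \<bullet> w) *\<^sub>R ((1 / l1norm w) *\<^sub>R w)"
      by (simp add: Rv)
  qed
  show ?thesis
  proof (rule that)
    show "0 < 1 / l1norm w" using l1norm_pos[OF w0] by simp
    show "(\<lambda>n. perron_vec (a ** mpow b (Suc n))) \<longlonglongrightarrow> (1 / l1norm w) *\<^sub>R (a *v ?v)"
      using lim unfolding G R_eq w_def .
  qed
qed

section \<open>Distance from the cone\<close>

definition excess :: "real^'d \<Rightarrow> (real^'d) set \<Rightarrow> real^'d \<Rightarrow> ennreal" where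
  "excess phi K x = (INF e\<in>{e. 0 \<le> e \<and> x - e \<in> K}. ennreal (phi \<bullet> e))"

lemma excess_le: "0 \<le> e \<Longrightarrow> x - e \<in> K \<Longrightarrow> excess phi K x \<le> ennreal (phi \<bullet> e)"
  unfolding excess_def by (rule INF_lower) simp

lemma excess_0: "0 \<in> K \<Longrightarrow> excess phi K 0 = 0"
  using excess_le[of 0 0 K phi] by simp

lemma excess_less_iff: "excess phi K x < c \<longleftrightarrow> (\<exists>e. 0 \<le> e \<and> x - e \<in> K \<and> ennreal (phi \<bullet> e) < c)"
  unfolding excess_def by (auto simp: INF_less_iff)

lemma excess_approx:
  assumes "excess phi K x < top" "0 < d"
  obtains e where "0 \<le> e" "x - e \<in> K" "ennreal (phi \<bullet> e) \<le> excess phi K x + ennreal d"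
proof -
  have "excess phi K x < excess phi K x + ennreal d"
    using assms by (cases "excess phi K x") (auto simp: ennreal_less_iff simp flip: ennreal_plus)
  then show ?thesis using that unfolding excess_less_iff by (meson less_imp_le)
qed

lemma excess_add:
  assumes K: "convex K" "conic K" and phi: "0 \<le> (phi::real^'d)"
  shows "excess phi K (x + y) \<le> excess phi K x + excess phi K y"
proof (rule ennreal_le_epsilon)
  fix d :: real assume fin: "excess phi K x + excess phi K y < top" and d: "0 < d"
  then have f: "excess phi K x < top" "excess phi K y < top" by auto
  obtain e1 where e1: "0 \<le> e1" "x - e1 \<in> K" "ennreal (phi \<bullet> e1) \<le> excess phi K x + ennreal (d / 2)"
    using excess_approx[OF f(1), of "d / 2"] d by auto
  obtain e2 where e2: "0 \<le> e2" "y - e2 \<in> K" "ennreal (phi \<bullet> e2) \<le> excess phi K y + ennreal (d / 2)"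
    using excess_approx[OF f(2), of "d / 2"] d by auto
  have "(x - e1) + (y - e2) \<in> K" by (intro convex_conic_add K e1 e2)
  then have "excess phi K (x + y) \<le> ennreal (phi \<bullet> (e1 + e2))"
    using e1 e2 by (intro excess_le add_nonneg_nonneg) (auto simp: algebra_simps)
  also have "\<dots> = ennreal (phi \<bullet> e1) + ennreal (phi \<bullet> e2)"
    using e1 e2 phi by (simp add: inner_add_right inner_vec_nonneg)
  also have "\<dots> \<le> (excess phi K x + ennreal (d / 2)) + (excess phi K y + ennreal (d / 2))"
    by (intro add_mono e1 e2)
  also have "\<dots> = excess phi K x + excess phi K y + (ennreal (d / 2) + ennreal (d / 2))" by (simp add: ac_simps)
  also have "ennreal (d / 2) + ennreal (d / 2) = ennreal d" using d by (simp flip: ennreal_plus)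
  finally show "excess phi K (x + y) \<le> excess phi K x + excess phi K y + ennreal d" .
qed

lemma norm_le_pos_functional:
  assumes "\<And>i. 0 < (phi::real^'d) $ i"
  obtains C where "C > 0" "\<And>e. 0 \<le> e \<Longrightarrow> norm e \<le> C * (phi \<bullet> e)"
proof -
  obtain t where t: "t > 0" "1 \<le> t *\<^sub>R phi" using pos_vec_dominates[OF assms] by blast
  show ?thesis
  proof (rule that[OF t(1)])
    fix e :: "real^'d" assume e: "0 \<le> e"
    have "norm e \<le> 1 \<bullet> e" using norm_le_l1norm[of e] l1norm_eq_inner[OF e] by simp
    also have "\<dots> \<le> (t *\<^sub>R phi) \<bullet> e" using inner_vec_mono[OF e t(2)] by (simp add: inner_commute)
    finally show "norm e \<le> t * (phi \<bullet> e)" by simp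
  qed
qed

text \<open>A strict sublevel set is a countable union, over rational \<open>q\<close>, of sets
  \<open>B q\<close>. Each is the sum of the closed set \<open>K\<close> and a set of corrections
  that is compact because \<open>phi\<close> is positive, hence closed.\<close>

lemma excess_measurable:
  assumes phi: "\<And>i. 0 < (phi::real^'d) $ i" and K: "closed K"
  shows "excess phi K \<in> borel_measurable borel"
proof (rule borel_measurableI_less)
  fix c :: ennreal
  have phi0: "0 \<le> phi" using phi by (simp add: less_eq_vec_def less_imp_le)
  define B where "B = (\<lambda>q::real. {x. \<exists>e. 0 \<le> e \<and> x - e \<in> K \<and> phi \<bullet> e \<le> q})"
  have closedB: "closed (B q)" for q
  proof -
    obtain C where C: "C > 0" "\<And>e. 0 \<le> e \<Longrightarrow> norm e \<le> C * (phi \<bullet> e)"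
      using norm_le_pos_functional[of phi] phi by blast
    let ?E = "{e. 0 \<le> e \<and> phi \<bullet> e \<le> q}"
    have "bounded ?E"
      unfolding bounded_iff
    proof (intro exI ballI)
      fix e assume "e \<in> ?E"
      then have "norm e \<le> C * (phi \<bullet> e)" "C * (phi \<bullet> e) \<le> C * q"
        using C(2)[of e] C(1) by (auto intro: mult_left_mono)
      then show "norm e \<le> C * q" by (rule order.trans)
    qed
    moreover have "closed ({e. 0 \<le> e} \<inter> {e. phi \<bullet> e \<le> q})"
      by (intro closed_Int closed_nonneg_vec closed_Collect_le continuous_intros)
    ultimately have "compact ?E" by (simp add: compact_eq_bounded_closed Collect_conj_eq)
    moreover have "B q = (\<Union>x\<in>K. \<Union>y\<in>?E. {x + y})"
    proof (intro set_eqI iffI)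
      fix x assume "x \<in> B q"
      then obtain e where "0 \<le> e" "x - e \<in> K" "phi \<bullet> e \<le> q" by (auto simp: B_def)
      then show "x \<in> (\<Union>x\<in>K. \<Union>y\<in>?E. {x + y})"
        by (intro UN_I[of "x - e"] UN_I[of e]) auto
    qed (auto simp: B_def)
    ultimately show ?thesis using closed_compact_sums[OF K] by simp
  qed
  have "{x \<in> space borel. excess phi K x < c} = (\<Union>q\<in>{q\<in>\<rat>. ennreal q < c}. B q)"
  proof (intro set_eqI iffI)
    fix x assume "x \<in> {x \<in> space borel. excess phi K x < c}"
    then obtain e where e: "0 \<le> e" "x - e \<in> K" "ennreal (phi \<bullet> e) < c" by (auto simp: excess_less_iff)
    have pe: "0 \<le> phi \<bullet> e" by (rule inner_vec_nonneg[OF phi0 e(1)])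
    obtain y where y: "ennreal (phi \<bullet> e) < y" "y < c" using dense[OF e(3)] by blast
    moreover have "y \<noteq> top" using y(2) by auto
    ultimately obtain r where r: "ennreal (phi \<bullet> e) < ennreal r" "ennreal r < c" by (cases y) auto
    then have "phi \<bullet> e < r" using pe by (metis ennreal_less_iff)
    then obtain q where q: "q \<in> \<rat>" "phi \<bullet> e < q" "q < r" using Rats_dense_in_real by blast
    have "ennreal q < c" using q(3) r(2) by (meson ennreal_leI less_imp_le order.strict_trans1)
    then show "x \<in> (\<Union>q\<in>{q\<in>\<rat>. ennreal q < c}. B q)" using q e by (auto simp: B_def intro: less_imp_le)
  next
    fix x assume "x \<in> (\<Union>q\<in>{q\<in>\<rat>. ennreal q < c}. B q)"
    then obtain q e where qe: "ennreal q < c" "0 \<le> e" "x - e \<in> K" "phi \<bullet> e \<le> q" by (auto simp: B_def)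
    then have "ennreal (phi \<bullet> e) < c" by (meson ennreal_leI order.strict_trans1)
    with qe show "x \<in> {x \<in> space borel. excess phi K x < c}" by (auto simp: excess_less_iff)
  qed
  moreover have "countable {q\<in>\<rat>. ennreal q < c}" by (rule countable_subset[OF _ countable_rat]) auto
  ultimately show "{x \<in> space borel. excess phi K x < c} \<in> sets borel"
    using closedB by auto
qed

text \<open>As \<open>phi\<close> is positive, corrections of vanishing \<open>phi\<close>-value
  tend to 0 in norm; closedness of \<open>K\<close> does the rest.\<close>

lemma excess_eq_0_imp:
  assumes phi: "\<And>i. 0 < (phi::real^'d) $ i" and K: "closed K" and x: "excess phi K x = 0"
  shows "x \<in> K"
proof -
  obtain C where C: "C > 0" "\<And>e. 0 \<le> e \<Longrightarrow> norm e \<le> C * (phi \<bullet> e)"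
    using norm_le_pos_functional[of phi] phi by blast
  have "\<exists>e. 0 \<le> e \<and> x - e \<in> K \<and> ennreal (phi \<bullet> e) < ennreal (1 / real (Suc n))" for n
    using x excess_less_iff[of phi K x "ennreal (1 / real (Suc n))"] by (simp add: ennreal_zero_less_divide)
  then obtain e where e: "\<And>n. 0 \<le> e n" "\<And>n. x - e n \<in> K" "\<And>n. ennreal (phi \<bullet> e n) < ennreal (1 / real (Suc n))"
    by metis
  have "norm (e n) \<le> C * (1 / real (Suc n))" for n
  proof -
    have "phi \<bullet> e n \<le> 1 / real (Suc n)" using e(3)[of n] by (subst (asm) ennreal_less_iff)
      (auto intro!: inner_vec_nonneg e simp: less_eq_vec_def phi less_imp_le)
    then show ?thesis using C(2)[OF e(1), of n] mult_left_mono[of "phi \<bullet> e n" _ C] C(1) by (meson less_imp_le order.trans)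
  qed
  moreover have "(\<lambda>n. C * (1 / real (Suc n))) \<longlonglongrightarrow> C * 0"
    by (intro tendsto_intros LIMSEQ_Suc[OF lim_1_over_n])
  ultimately have "e \<longlonglongrightarrow> 0" by (intro Lim_null_comparison[of e "\<lambda>n. C * (1 / real (Suc n))"]) auto
  then have "(\<lambda>n. x - e n) \<longlonglongrightarrow> x - 0" by (intro tendsto_intros)
  then show ?thesis using closed_sequentially[OF K] e(2) by (metis diff_zero)
qed

section \<open>Invariance of the cone and averages over products\<close>

context smoothing
begin

abbreviation "\<Lambda> \<equiv> Lambda_set \<Gamma>"

sublocale cone: simplex_subset \<Lambda>
proof
  obtain g where "g \<in> \<Gamma>" "pos_mat g" by (rule Gamma_pos')
  then show "\<Lambda> \<noteq> {}" unfolding Lambda_set_def by auto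
  show "closed \<Lambda>" by (simp add: Lambda_set_def)
  have "closed {x :: real^'d. 0 \<le> x \<and> l1norm x = 1}" using compact_l1_simplex by (rule compact_imp_closed)
  then have "\<Lambda> \<subseteq> {x. 0 \<le> x \<and> l1norm x = 1}"
    unfolding Lambda_set_def by (intro closure_minimal) (auto simp: perron_vec_nonneg l1norm_perron_vec)
  then show "0 \<le> x \<and> l1norm x = 1" if "x \<in> \<Lambda>" for x using that by auto
qed

lemma perron_vec_Lambda: "g \<in> \<Gamma> \<Longrightarrow> pos_mat g \<Longrightarrow> perron_vec g \<in> \<Lambda>"
  unfolding Lambda_set_def by (rule subsetD[OF closure_subset]) auto

lemma Gamma_mpow: "g \<in> \<Gamma> \<Longrightarrow> mpow g n \<in> \<Gamma>"
  by (induction n) (auto intro: Gamma_one Gamma_times)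

text \<open>On Perron vectors this is \<open>perron_vec_right_factor\<close>, a limit inside the
  closed set \<open>\<Lambda>\<close>. The vectors that \<open>a\<close> maps into the cone form a
  closed, convex and conic set, so it contains everything generated by Perron vectors.\<close>

lemma Gamma_cone:
  assumes a: "a \<in> \<Gamma>" and h: "h \<in> cone.K"
  shows "a *v h \<in> cone.K"
proof -
  have perron: "a *v perron_vec b \<in> cone.K" if b: "b \<in> \<Gamma>" "pos_mat b" for b
  proof -
    obtain s where s: "s > 0" "(\<lambda>n. perron_vec (a ** mpow b (Suc n))) \<longlonglongrightarrow> s *\<^sub>R (a *v perron_vec b)"
      using perron_vec_right_factor[OF Gamma_nonneg[OF a] Gamma_row[OF a] b(2)] by metis
    have mem: "\<And>n. perron_vec (a ** mpow b (Suc n)) \<in> \<Lambda>"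
      using Gamma_row[OF a]
      by (intro perron_vec_Lambda Gamma_times Gamma_mpow pos_mat_mult pos_mat_mpow Gamma_nonneg a b) auto
    have "s *\<^sub>R (a *v perron_vec b) \<in> \<Lambda>"
      by (rule closed_sequentially[OF cone.closed_L mem s(2)])
    then have "s *\<^sub>R (a *v perron_vec b) \<in> cone.K" by (rule subsetD[OF cone.L_subset_K])
    from conicD[OF cone.conic_K this, of "1 / s"] show ?thesis using s(1) by simp
  qed
  let ?P = "{x. a *v x \<in> cone.K}"
  have "closed ((\<lambda>x. a *v x) -` cone.K)"
    by (intro closed_vimage cone.closed_K continuous_intros)
  then have "closed ?P" by (simp add: vimage_def)
  moreover have "{perron_vec b | b. b \<in> \<Gamma> \<and> pos_mat b} \<subseteq> ?P" using perron by blast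
  ultimately have "closure {perron_vec b | b. b \<in> \<Gamma> \<and> pos_mat b} \<subseteq> ?P" by (rule closure_minimal[rotated])
  then have "\<Lambda> \<subseteq> ?P" by (simp only: Lambda_set_def)
  moreover have "convex ?P"
    by (rule convexI) (auto simp: matrix_vector_right_distrib matrix_vector_mult_scaleR intro!: convexD[OF cone.convex_K])
  moreover have "conic ?P"
    by (subst conic_def[of ?P]) (auto simp: matrix_vector_mult_scaleR intro!: conicD[OF cone.conic_K])
  ultimately have "cone.K \<subseteq> ?P" by (intro hull_minimal) (auto intro: hull_minimal)
  then show ?thesis using h by blast
qed

lemma nn_integral_PZ_component:
  assumes [measurable]: "f \<in> borel_measurable borel"
  shows "(\<integral>\<^sup>+z. f (z i) \<partial>PZ) = (\<integral>\<^sup>+x. f x \<partial>zeta)"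
proof -
  have "zeta = distr M borel (\<lambda>\<omega>. Zs \<omega> i)" using Zs_distr by (simp add: zeta_def)
  then show ?thesis unfolding PZ_def by (simp add: nn_integral_distr)
qed

lemma measurable_inner_zeta [measurable]:
  assumes [measurable]: "f \<in> borel_measurable borel"
  shows "(\<lambda>a. \<integral>\<^sup>+x. f (a *v x) \<partial>zeta) \<in> borel_measurable borel"
proof -
  have "(\<lambda>p. f (fst p *v snd p)) \<in> borel_measurable (borel \<Otimes>\<^sub>M zeta)" by measurable
  from zeta.borel_measurable_nn_integral_fst[OF this] show ?thesis by simp
qed

lemma nn_integral_branch_total:
  assumes [measurable]: "f \<in> borel_measurable borel"
  shows "(\<integral>\<^sup>+\<omega>. (\<integral>\<^sup>+z. (\<Sum>i<numN A \<omega>. f (A \<omega> i *v z i)) \<partial>PZ) \<partial>M) = EN * (\<integral>\<^sup>+a. (\<integral>\<^sup>+x. f (a *v x) \<partial>zeta) \<partial>mu)"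
proof -
  have "(\<integral>\<^sup>+z. (\<Sum>i<numN A \<omega>. f (A \<omega> i *v z i)) \<partial>PZ) = (\<Sum>i<numN A \<omega>. \<integral>\<^sup>+x. f (A \<omega> i *v x) \<partial>zeta)" for \<omega>
    using nn_integral_PZ_component[of "\<lambda>x. f (A \<omega> _ *v x)"] by (subst nn_integral_sum) auto
  then have "(\<integral>\<^sup>+\<omega>. (\<integral>\<^sup>+z. (\<Sum>i<numN A \<omega>. f (A \<omega> i *v z i)) \<partial>PZ) \<partial>M) = EN * ((\<integral>\<^sup>+\<omega>. (\<Sum>i<numN A \<omega>. \<integral>\<^sup>+x. f (A \<omega> i *v x) \<partial>zeta) \<partial>M) / EN)"
    using EN_bounds mult_divide_eq_ennreal[of EN] by (simp add: ennreal_times_divide mult.commute[of EN])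
  also have "(\<integral>\<^sup>+\<omega>. (\<Sum>i<numN A \<omega>. \<integral>\<^sup>+x. f (A \<omega> i *v x) \<partial>zeta) \<partial>M) / EN = (\<integral>\<^sup>+a. (\<integral>\<^sup>+x. f (a *v x) \<partial>zeta) \<partial>mu)"
    by (rule nn_integral_mu[symmetric]) measurable
  finally show ?thesis .
qed

text \<open>One step of the distance estimate: subadditivity splits the branching sum into single
  terms, and \<open>nn_integral_branch_total\<close> averages them.\<close>

lemma nn_integral_zeta_subadditive:
  assumes [measurable]: "f \<in> borel_measurable borel" and f0: "f 0 = 0" and add: "\<And>x y. f (x + y) \<le> f x + f y"
  shows "(\<integral>\<^sup>+x. f x \<partial>zeta) \<le> EN * (\<integral>\<^sup>+a. (\<integral>\<^sup>+x. f (a *v x) \<partial>zeta) \<partial>mu)"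
proof -
  have sum: "f (\<Sum>i<n. y i) \<le> (\<Sum>i<n. f (y i))" for n :: nat and y
    by (induction n) (auto simp: f0 intro: order.trans[OF add] add_mono)
  have "(\<integral>\<^sup>+x. f x \<partial>zeta) = (\<integral>\<^sup>+\<omega>. (\<integral>\<^sup>+z. f (branch_sum (A \<omega>) z) \<partial>PZ) \<partial>M)"
    by (rule nn_integral_zeta) measurable
  also have "\<dots> \<le> (\<integral>\<^sup>+\<omega>. (\<integral>\<^sup>+z. (\<Sum>i<numN A \<omega>. f (A \<omega> i *v z i)) \<partial>PZ) \<partial>M)"
    unfolding branch_sum_def numN_eq_seqN by (intro nn_integral_mono sum)
  finally show ?thesis by (simp add: nn_integral_branch_total)
qed

lemma nn_integral_zeta_linear:
  assumes c: "0 \<le> c"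
  shows "(\<integral>\<^sup>+x. ennreal (c \<bullet> x) \<partial>zeta) = EN * (\<integral>\<^sup>+a. (\<integral>\<^sup>+x. ennreal (c \<bullet> (a *v x)) \<partial>zeta) \<partial>mu)"
proof -
  have "(\<integral>\<^sup>+x. ennreal (c \<bullet> x) \<partial>zeta) = (\<integral>\<^sup>+\<omega>. (\<integral>\<^sup>+z. ennreal (c \<bullet> branch_sum (A \<omega>) z) \<partial>PZ) \<partial>M)"
    by (rule nn_integral_zeta) measurable
  also have "\<dots> = (\<integral>\<^sup>+\<omega>. (\<integral>\<^sup>+z. (\<Sum>i<numN A \<omega>. ennreal (c \<bullet> (A \<omega> i *v z i))) \<partial>PZ) \<partial>M)"
  proof (rule nn_integral_cong_AE)
    show "AE \<omega> in M. (\<integral>\<^sup>+z. ennreal (c \<bullet> branch_sum (A \<omega>) z) \<partial>PZ) = (\<integral>\<^sup>+z. (\<Sum>i<numN A \<omega>. ennreal (c \<bullet> (A \<omega> i *v z i))) \<partial>PZ)"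
      using A_nonneg
    proof eventually_elim
      fix \<omega> assume nn: "\<forall>i. nonneg_mat (A \<omega> i)"
      have "AE z in PZ. \<forall>i. 0 \<le> z i" by (rule AE_PZ[OF AE_zeta_nonneg]) (simp add: pred_def)
      then show "(\<integral>\<^sup>+z. ennreal (c \<bullet> branch_sum (A \<omega>) z) \<partial>PZ) = (\<integral>\<^sup>+z. (\<Sum>i<numN A \<omega>. ennreal (c \<bullet> (A \<omega> i *v z i))) \<partial>PZ)"
      proof (intro nn_integral_cong_AE, eventually_elim)
        fix z :: "nat \<Rightarrow> real^'d" assume z: "\<forall>i. 0 \<le> z i"
        have "0 \<le> c \<bullet> (A \<omega> i *v z i)" for i using nn z by (intro inner_vec_nonneg c nonneg_mat_vec) auto
        then show "ennreal (c \<bullet> branch_sum (A \<omega>) z) = (\<Sum>i<numN A \<omega>. ennreal (c \<bullet> (A \<omega> i *v z i)))"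
          by (simp add: branch_sum_def numN_eq_seqN inner_sum_right sum_ennreal)
      qed
    qed
  qed
  finally show ?thesis using nn_integral_branch_total[of "\<lambda>x. ennreal (c \<bullet> x)"] by simp
qed

text \<open>The law of a product of \<open>k\<close> independent matrices of law \<open>mu\<close>;
  the new factor stands on the right, as in \<open>semigrp\<close>.\<close>

primrec muK :: "nat \<Rightarrow> (real^'d^'d) measure" where
  "muK 0 = return borel (mat 1)"
| "muK (Suc k) = distr (muK k \<Otimes>\<^sub>M mu) borel (\<lambda>p. fst p ** snd p)"

lemma measurable_matrix_mult [measurable (raw)]:
  fixes f g :: "'a \<Rightarrow> real^'d^'d"
  assumes "f \<in> borel_measurable N" "g \<in> borel_measurable N"
  shows "(\<lambda>x. f x ** g x) \<in> borel_measurable N"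
proof (rule borel_measurable_continuous_Pair[OF assms])
  show "continuous_on UNIV (\<lambda>x :: (real^'d^'d) \<times> (real^'d^'d). fst x ** snd x)" by (intro continuous_intros)
qed

lemma sets_muK [simp, measurable_cong]: "sets (muK k) = sets borel"
  by (cases k) auto

lemma space_muK [simp]: "space (muK k) = UNIV"
  using sets_eq_imp_space_eq[OF sets_muK] by simp

lemma matrix_mult_measurable_pair: "(\<lambda>p. fst p ** snd p) \<in> borel_measurable (muK k \<Otimes>\<^sub>M mu)"
  by measurable

lemma prob_space_muK: "prob_space (muK k)"
proof (induction k)
  case 0
  show ?case by (simp add: prob_space_return)
next
  case (Suc k)
  interpret K: prob_space "muK k" by (rule Suc)
  interpret P: pair_prob_space "muK k" mu ..
  show ?case unfolding muK.simps by (rule P.prob_space_distr) (rule matrix_mult_measurable_pair)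
qed

lemma nn_integral_muK_Suc:
  assumes [measurable]: "f \<in> borel_measurable borel"
  shows "(\<integral>\<^sup>+m. f m \<partial>muK (Suc k)) = (\<integral>\<^sup>+m. (\<integral>\<^sup>+a. f (m ** a) \<partial>mu) \<partial>muK k)"
proof -
  have "(\<integral>\<^sup>+m. f m \<partial>muK (Suc k)) = (\<integral>\<^sup>+p. f (fst p ** snd p) \<partial>(muK k \<Otimes>\<^sub>M mu))"
    unfolding muK.simps by (rule nn_integral_distr[OF matrix_mult_measurable_pair]) simp
  also have "\<dots> = (\<integral>\<^sup>+m. (\<integral>\<^sup>+a. f (m ** a) \<partial>mu) \<partial>muK k)"
    by (subst mu.nn_integral_fst[symmetric]) (auto, measurable)
  finally show ?thesis .
qed

lemma nn_integral_zeta_subadditive_muK: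
  assumes [measurable]: "f \<in> borel_measurable borel" and f0: "f 0 = 0" and add: "\<And>x y. f (x + y) \<le> f x + f y"
  shows "(\<integral>\<^sup>+x. f x \<partial>zeta) \<le> EN ^ k * (\<integral>\<^sup>+m. (\<integral>\<^sup>+x. f (m *v x) \<partial>zeta) \<partial>muK k)"
proof (induction k)
  case 0
  show ?case by (simp add: nn_integral_return)
next
  case (Suc k)
  have "(\<integral>\<^sup>+m. (\<integral>\<^sup>+x. f (m *v x) \<partial>zeta) \<partial>muK k) \<le> (\<integral>\<^sup>+m. EN * (\<integral>\<^sup>+a. (\<integral>\<^sup>+x. f (m *v (a *v x)) \<partial>zeta) \<partial>mu) \<partial>muK k)"
    using f0 add by (intro nn_integral_mono nn_integral_zeta_subadditive) (auto simp: matrix_vector_right_distrib)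
  also have "\<dots> = EN * (\<integral>\<^sup>+m. (\<integral>\<^sup>+a. (\<integral>\<^sup>+x. f ((m ** a) *v x) \<partial>zeta) \<partial>mu) \<partial>muK k)"
  proof -
    have "(\<lambda>p. \<integral>\<^sup>+x. f ((fst p ** snd p) *v x) \<partial>zeta) \<in> borel_measurable (muK k \<Otimes>\<^sub>M mu)"
      by (rule measurable_compose[OF matrix_mult_measurable_pair measurable_inner_zeta]) simp
    from mu.borel_measurable_nn_integral_fst[OF this]
    show ?thesis by (subst nn_integral_cmult[symmetric]) (auto simp: matrix_vector_mul_assoc)
  qed
  also have "\<dots> = EN * (\<integral>\<^sup>+m. (\<integral>\<^sup>+x. f (m *v x) \<partial>zeta) \<partial>muK (Suc k))"
    by (subst nn_integral_muK_Suc) (auto intro: measurable_inner_zeta)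
  finally have "EN ^ k * (\<integral>\<^sup>+m. (\<integral>\<^sup>+x. f (m *v x) \<partial>zeta) \<partial>muK k)
      \<le> EN ^ k * (EN * (\<integral>\<^sup>+m. (\<integral>\<^sup>+x. f (m *v x) \<partial>zeta) \<partial>muK (Suc k)))" by (rule mult_left_mono) simp
  with Suc show ?case by (auto simp: mult_ac intro: order.trans)
qed

text \<open>The last factor stands next to \<open>e\<close>. Fubini moves its integral outside, and
  the induction hypothesis is applied to \<open>a *v e\<close>.\<close>

lemma nn_integral_muK_left_harmonic:
  assumes phi: "\<And>e. 0 \<le> e \<Longrightarrow> EN * (\<integral>\<^sup>+a. ennreal (phi \<bullet> (a *v e)) \<partial>mu) = ennreal (phi \<bullet> e)" and e: "0 \<le> e"
  shows "EN ^ k * (\<integral>\<^sup>+m. ennreal (phi \<bullet> (m *v e)) \<partial>muK k) = ennreal (phi \<bullet> e)"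
  using e
proof (induction k arbitrary: e)
  case 0
  then show ?case by (simp add: nn_integral_return)
next
  case (Suc k)
  interpret K: prob_space "muK k" by (rule prob_space_muK)
  interpret P: pair_sigma_finite "muK k" mu ..
  have "(\<integral>\<^sup>+m. ennreal (phi \<bullet> (m *v e)) \<partial>muK (Suc k)) = (\<integral>\<^sup>+m. (\<integral>\<^sup>+a. ennreal (phi \<bullet> ((m ** a) *v e)) \<partial>mu) \<partial>muK k)"
    by (rule nn_integral_muK_Suc) measurable
  also have "\<dots> = (\<integral>\<^sup>+a. (\<integral>\<^sup>+m. ennreal (phi \<bullet> (m *v (a *v e))) \<partial>muK k) \<partial>mu)"
    by (subst P.Fubini'[symmetric]) (auto simp: matrix_vector_mul_assoc, measurable)
  finally have "EN ^ Suc k * (\<integral>\<^sup>+m. ennreal (phi \<bullet> (m *v e)) \<partial>muK (Suc k))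
      = EN * (\<integral>\<^sup>+a. EN ^ k * (\<integral>\<^sup>+m. ennreal (phi \<bullet> (m *v (a *v e))) \<partial>muK k) \<partial>mu)"
  proof -
    assume *: "(\<integral>\<^sup>+m. ennreal (phi \<bullet> (m *v e)) \<partial>muK (Suc k)) = (\<integral>\<^sup>+a. (\<integral>\<^sup>+m. ennreal (phi \<bullet> (m *v (a *v e))) \<partial>muK k) \<partial>mu)"
    have "(\<lambda>p. ennreal (phi \<bullet> (snd p *v (fst p *v e)))) \<in> borel_measurable (mu \<Otimes>\<^sub>M muK k)" by measurable
    from K.borel_measurable_nn_integral_fst[OF this]
    show ?thesis unfolding * by (subst nn_integral_cmult) (auto simp: mult_ac)
  qed
  also have "\<dots> = EN * (\<integral>\<^sup>+a. ennreal (phi \<bullet> (a *v e)) \<partial>mu)"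
  proof -
    have "AE a in mu. nonneg_mat a"
      using AE_supp_measure[OF sets_mu] by eventually_elim (rule supp_mu_nonneg)
    then show ?thesis
      using Suc.IH[OF nonneg_mat_vec[OF _ Suc.prems]] by (intro arg_cong[of _ _ "(*) EN"] nn_integral_cong_AE) (auto elim!: eventually_mono)
  qed
  also have "\<dots> = ennreal (phi \<bullet> e)" by (rule phi[OF Suc.prems])
  finally show ?case .
qed

lemma AE_muK_good: "AE m in muK k. nonneg_mat m \<and> (\<forall>h\<in>cone.K. m *v h \<in> cone.K)"
proof -
  define C where "C = {m :: real^'d^'d. nonneg_mat m \<and> (\<forall>h\<in>cone.K. m *v h \<in> cone.K)}"
  have "C = {m. nonneg_mat m} \<inter> (\<Inter>h\<in>cone.K. (\<lambda>m. m *v h) -` cone.K)" by (auto simp: C_def)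
  moreover have "closed {m :: real^'d^'d. nonneg_mat m}"
    unfolding nonneg_mat_def by (intro closed_Collect_all closed_Collect_le continuous_intros)
  ultimately have closedC: "closed C"
    by (auto intro!: closed_Int closed_INT closed_vimage cone.closed_K continuous_intros)
  have "AE m in muK k. m \<in> C"
  proof (induction k)
    case 0
    have "Measurable.pred borel (\<lambda>m. m \<in> C)" using closedC by (simp add: pred_def)
    then show ?case unfolding muK.simps by (subst AE_return) (auto simp: C_def)
  next
    case (Suc k)
    interpret K: prob_space "muK k" by (rule prob_space_muK)
    interpret P: pair_sigma_finite "muK k" mu ..
    have mem: "{p \<in> space (muK k \<Otimes>\<^sub>M mu). fst p ** snd p \<in> C} \<in> sets (muK k \<Otimes>\<^sub>M mu)"
      using measurable_sets[OF matrix_mult_measurable_pair, of C k] closedC by (simp add: vimage_def Int_def conj_commute)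
    have "AE p in muK k \<Otimes>\<^sub>M mu. fst p ** snd p \<in> C"
    proof (rule P.AE_pair_measure[OF mem])
      show "AE m in muK k. AE a in mu. fst (m, a) ** snd (m, a) \<in> C"
        using Suc.IH
      proof eventually_elim
        fix m assume m: "m \<in> C"
        show "AE a in mu. fst (m, a) ** snd (m, a) \<in> C"
          using AE_supp_measure[OF sets_mu]
        proof eventually_elim
          fix a assume a: "a \<in> supp_measure mu"
          have "(m ** a) *v h \<in> cone.K" if "h \<in> cone.K" for h
            using m[unfolded C_def] Gamma_cone[OF supp_mu_Gamma[OF a] that] by (simp add: matrix_vector_mul_assoc[symmetric])
          then show "fst (m, a) ** snd (m, a) \<in> C"
            using m supp_mu_nonneg[OF a] by (auto simp: C_def intro: nonneg_mat_mult)
        qed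
      qed
    qed
    then show ?case
      unfolding muK.simps using closedC by (subst AE_distr_iff[OF matrix_mult_measurable_pair]) auto
  qed
  then show ?thesis by (simp add: C_def)
qed

text \<open>By continuity of the product, a neighbourhood of \<open>a ** b\<close> contains the
  image of a rectangle, whose measure is a product of two positive numbers. Thus products come close
  to any given element of \<open>\<Gamma>\<close> with positive probability.\<close>

lemma Gamma_supp_muK:
  assumes "g \<in> \<Gamma>"
  obtains k where "g \<in> supp_measure (muK k)"
proof -
  have "\<exists>k. g \<in> supp_measure (muK k)"
    using assms unfolding \<Gamma>_def
  proof (induction rule: semigrp.induct)
    case one
    have "mat 1 \<in> supp_measure (muK 0)" by (auto simp: supp_measure_def emeasure_return)
    then show ?case by blast
  next
    case (mult a b)
    then obtain k where k: "a \<in> supp_measure (muK k)" by blast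
    interpret K: prob_space "muK k" by (rule prob_space_muK)
    have "a ** b \<in> supp_measure (muK (Suc k))"
      unfolding supp_measure_def
    proof (intro CollectI allI impI)
      fix T :: "(real^'d^'d) set" assume T: "open T" "a ** b \<in> T"
      have cont: "continuous_on UNIV (\<lambda>p :: (real^'d^'d) \<times> (real^'d^'d). fst p ** snd p)" by (intro continuous_intros)
      have "open ((\<lambda>p :: (real^'d^'d) \<times> (real^'d^'d). fst p ** snd p) -` T)" using T(1) cont by (rule open_vimage)
      moreover have "(a, b) \<in> (\<lambda>p. fst p ** snd p) -` T" using T(2) by simp
      ultimately obtain X Y where XY: "open X" "open Y" "(a, b) \<in> X \<times> Y" "X \<times> Y \<subseteq> (\<lambda>p. fst p ** snd p) -` T"
        by (rule open_prod_elim)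
      have "0 < emeasure (muK k) X * emeasure mu Y"
        using k mult.hyps XY by (auto simp: supp_measure_def ennreal_zero_less_mult_iff)
      also have "\<dots> = emeasure (muK k \<Otimes>\<^sub>M mu) (X \<times> Y)"
        using XY by (subst mu.emeasure_pair_measure_Times) auto
      also have "\<dots> \<le> emeasure (muK k \<Otimes>\<^sub>M mu) ((\<lambda>p. fst p ** snd p) -` T \<inter> space (muK k \<Otimes>\<^sub>M mu))"
        using XY T by (intro emeasure_mono measurable_sets[OF matrix_mult_measurable_pair]) (auto simp: space_pair_measure)
      also have "\<dots> = emeasure (muK (Suc k)) T"
        unfolding muK.simps using T by (subst emeasure_distr[OF matrix_mult_measurable_pair]) auto
      finally show "0 < emeasure (muK (Suc k)) T" .
    qed
    then show ?case by blast
  qed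
  then show ?thesis using that by blast
qed

text \<open>Taking means in the equation shows that the mean vector \<open>w\<close> is a positive
  fixed vector of the mean matrix \<open>B\<close>. Brouwer gives a left eigenvector of
  \<open>B\<close>, and \<open>w\<close> fixes its eigenvalue.\<close>

lemma left_harmonic:
  assumes fin: "(\<integral>\<^sup>+x. ennreal (l1norm x) \<partial>zeta) < \<infinity>"
  obtains phi where "l1norm phi = 1" "\<And>i. 0 < phi $ i"
    "\<And>e. 0 \<le> e \<Longrightarrow> EN * (\<integral>\<^sup>+a. ennreal (phi \<bullet> (a *v e)) \<partial>mu) = ennreal (phi \<bullet> e)"
proof -
  define c where "c = enn2real EN"
  have EN: "EN = ennreal c" "c > 1"
  proof -
    show "EN = ennreal c" using EN_bounds by (simp add: c_def less_top)
    then have "ennreal 1 < ennreal c" using EN_bounds(1) by simp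
    then show "c > 1" by (subst (asm) ennreal_less_iff) auto
  qed
  have intZ: "integrable zeta (\<lambda>x. x $ j)" for j
  proof (rule integrableI_bounded)
    have "(\<integral>\<^sup>+x. ennreal (norm (x $ j)) \<partial>zeta) \<le> (\<integral>\<^sup>+x. ennreal (l1norm x) \<partial>zeta)"
      unfolding l1norm_def by (intro nn_integral_mono ennreal_leI) (auto intro: member_le_sum)
    then show "(\<integral>\<^sup>+x. ennreal (norm (x $ j)) \<partial>zeta) < \<infinity>" using fin by (rule order.strict_trans1)
  qed simp
  define w :: "real^'d" where "w = (\<chi> j. \<integral>x. x $ j \<partial>zeta)"
  have wpos: "0 < w $ j" for j
  proof -
    have "AE x in zeta. 0 < x $ j" using AE_zeta_pos by (auto elim: eventually_mono)
    then show ?thesis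
      using zeta.integral_less_AE_space[OF zeta.integrable_const[of 0] intZ[of j]] by (simp add: w_def)
  qed
  have w: "(\<integral>\<^sup>+x. ennreal (c \<bullet> x) \<partial>zeta) = ennreal (c \<bullet> w)" if "0 \<le> c" for c
  proof -
    have int: "integrable zeta (\<lambda>x. c \<bullet> x)" unfolding inner_vec_def using intZ by simp
    have "AE x in zeta. 0 \<le> c \<bullet> x" using AE_zeta_nonneg by eventually_elim (rule inner_vec_nonneg[OF that])
    then have "(\<integral>\<^sup>+x. ennreal (c \<bullet> x) \<partial>zeta) = ennreal (\<integral>x. c \<bullet> x \<partial>zeta)" by (rule nn_integral_eq_integral[OF int])
    also have "(\<integral>x. c \<bullet> x \<partial>zeta) = c \<bullet> w" unfolding inner_vec_def using intZ by (simp add: w_def)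
    finally show ?thesis .
  qed
  have nn_mu: "AE a in mu. nonneg_mat a"
    using AE_supp_measure[OF sets_mu] by eventually_elim (rule supp_mu_nonneg)
  have harm: "EN * (\<integral>\<^sup>+a. ennreal (psi \<bullet> (a *v w)) \<partial>mu) = ennreal (psi \<bullet> w)" if psi: "0 \<le> psi" for psi
  proof -
    have "(\<integral>\<^sup>+a. ennreal (psi \<bullet> (a *v w)) \<partial>mu) = (\<integral>\<^sup>+a. (\<integral>\<^sup>+x. ennreal (psi \<bullet> (a *v x)) \<partial>zeta) \<partial>mu)"
      using nn_mu
    proof (intro nn_integral_cong_AE, eventually_elim)
      fix a :: "real^'d^'d" assume "nonneg_mat a"
      then show "ennreal (psi \<bullet> (a *v w)) = (\<integral>\<^sup>+x. ennreal (psi \<bullet> (a *v x)) \<partial>zeta)"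
        using w[OF nonneg_mat_vec'[OF _ psi], of a] by (simp add: dot_lmul_matrix)
    qed
    then show ?thesis using nn_integral_zeta_linear[OF psi] w[OF psi] by simp
  qed
  \<comment> \<open>The mean equation has finite value, and \<open>w $ k > 0\<close> lets a single
    entry be extracted from it.\<close>
  have inta: "integrable mu (\<lambda>a. a $ j $ k)" for j k
  proof -
    let ?e = "axis j 1 :: real^'d"
    have e: "0 \<le> ?e" by (simp add: less_eq_vec_def axis_def)
    have "EN * (\<integral>\<^sup>+a. ennreal (?e \<bullet> (a *v w)) \<partial>mu) < \<infinity>" unfolding harm[OF e] by simp
    then have f: "(\<integral>\<^sup>+a. ennreal (?e \<bullet> (a *v w)) \<partial>mu) < \<infinity>"
      using EN_bounds by (auto simp: ennreal_mult_less_top less_top)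
    have "integrable mu (\<lambda>a. w $ k * a $ j $ k)"
    proof (rule integrableI_bounded)
      have "AE a in mu. ennreal (norm (w $ k * a $ j $ k)) \<le> ennreal (?e \<bullet> (a *v w))"
        using nn_mu
      proof eventually_elim
        fix a :: "real^'d^'d" assume a: "nonneg_mat a"
        have "w $ k * a $ j $ k \<le> (\<Sum>k\<in>UNIV. w $ k * a $ j $ k)"
          using a wpos by (intro member_le_sum mult_nonneg_nonneg) (auto simp: nonneg_mat_def less_imp_le)
        also have "\<dots> = ?e \<bullet> (a *v w)" by (simp add: inner_axis' matrix_vector_mult_def mult.commute)
        finally show "ennreal (norm (w $ k * a $ j $ k)) \<le> ennreal (?e \<bullet> (a *v w))"
          using a wpos[of k] by (intro ennreal_leI) (simp add: nonneg_mat_def abs_mult)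
      qed
      then have "(\<integral>\<^sup>+a. ennreal (norm (w $ k * a $ j $ k)) \<partial>mu) \<le> (\<integral>\<^sup>+a. ennreal (?e \<bullet> (a *v w)) \<partial>mu)"
        by (rule nn_integral_mono_AE)
      then show "(\<integral>\<^sup>+a. ennreal (norm (w $ k * a $ j $ k)) \<partial>mu) < \<infinity>" using f by (rule order.strict_trans1)
      have "(\<lambda>a :: real^'d^'d. w $ k * a $ j $ k) \<in> borel_measurable borel"
        by (intro borel_measurable_continuous_onI continuous_intros)
      then show "(\<lambda>a. w $ k * a $ j $ k) \<in> borel_measurable mu"
        by (simp cong: measurable_cong_sets)
    qed
    then show ?thesis using wpos[of k] by simp
  qed
  define B :: "real^'d^'d" where "B = (\<chi> j k. c * (\<integral>a. a $ j $ k \<partial>mu))"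
  have B: "EN * (\<integral>\<^sup>+a. ennreal (psi \<bullet> (a *v e)) \<partial>mu) = ennreal (psi \<bullet> (B *v e))" if psi: "0 \<le> psi" and e: "0 \<le> e" for psi e
  proof -
    have expand: "psi \<bullet> (a *v e) = (\<Sum>j\<in>UNIV. \<Sum>k\<in>UNIV. psi $ j * (a $ j $ k * e $ k))" for a :: "real^'d^'d"
      by (simp add: inner_vec_def matrix_vector_mult_def sum_distrib_left)
    have int: "integrable mu (\<lambda>a. psi \<bullet> (a *v e))" unfolding expand using inta by simp
    have "AE a in mu. 0 \<le> psi \<bullet> (a *v e)"
      using nn_mu by eventually_elim (intro inner_vec_nonneg psi nonneg_mat_vec e)
    then have "(\<integral>\<^sup>+a. ennreal (psi \<bullet> (a *v e)) \<partial>mu) = ennreal (\<integral>a. psi \<bullet> (a *v e) \<partial>mu)"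
      by (rule nn_integral_eq_integral[OF int])
    moreover have "c * (\<integral>a. psi \<bullet> (a *v e) \<partial>mu) = psi \<bullet> (B *v e)"
      unfolding expand using inta by (simp add: B_def sum_distrib_left mult_ac)
    ultimately show ?thesis using EN by (simp add: ennreal_mult'[symmetric])
  qed
  have Bnn: "nonneg_mat B"
  proof -
    have "0 \<le> (\<integral>a. a $ j $ k \<partial>mu)" for j k
      using nn_mu by (intro integral_nonneg_AE) (auto elim!: eventually_mono simp: nonneg_mat_def)
    then show ?thesis using EN(2) by (simp add: B_def nonneg_mat_def)
  qed
  have Bw: "psi \<bullet> (B *v w) = psi \<bullet> w" if psi: "0 \<le> psi" for psi
  proof -
    have w0: "0 \<le> w" using wpos by (simp add: less_eq_vec_def less_imp_le)
    have "ennreal (psi \<bullet> (B *v w)) = ennreal (psi \<bullet> w)" using B[OF psi w0] harm[OF psi] by simp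
    then show ?thesis using psi w0 Bnn by (subst (asm) ennreal_inj) (auto intro: inner_vec_nonneg nonneg_mat_vec)
  qed
  have "nonneg_mat (transpose B)" using Bnn by simp
  moreover have "transpose B *v x \<noteq> 0" if x: "0 \<le> x" "x \<noteq> 0" for x
  proof
    assume "transpose B *v x = 0"
    then have "(x v* B) \<bullet> w = 0" by simp
    then have "x \<bullet> w = 0" using Bw[OF x(1)] by (simp add: dot_lmul_matrix)
    moreover have "0 < x \<bullet> w" using inner_vec_pos_iff[OF x(1) wpos] x(2) by blast
    ultimately show False by simp
  qed
  ultimately obtain phi r where phi: "0 \<le> phi" "l1norm phi = 1" "r > 0" "transpose B *v phi = r *\<^sub>R phi"
    by (rule nonneg_eigenvector)
  have phi0: "phi \<noteq> 0" using phi(2) by auto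
  \<comment> \<open>Pairing with \<open>w\<close>, which \<open>B\<close> fixes, identifies the
    eigenvalue as 1.\<close>
  have "r * (phi \<bullet> w) = (phi v* B) \<bullet> w" using phi(4) by simp
  also have "\<dots> = phi \<bullet> w" using Bw[OF phi(1)] by (simp add: dot_lmul_matrix)
  finally have "r = 1" using inner_vec_pos_iff[OF phi(1) wpos] phi0 by simp
  have harmonic: "EN * (\<integral>\<^sup>+a. ennreal (phi \<bullet> (a *v e)) \<partial>mu) = ennreal (phi \<bullet> e)" if "0 \<le> e" for e
  proof -
    have "phi \<bullet> (B *v e) = (transpose B *v phi) \<bullet> e" by (simp add: dot_lmul_matrix)
    then show ?thesis using B[OF phi(1) that] phi(4) \<open>r = 1\<close> by simp
  qed
  \<comment> \<open>If \<open>phi\<close> vanished at \<open>j\<close>, harmonicity over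
    \<open>k\<close> steps would make \<open>phi \<bullet> (m *v ?e)\<close> vanish almost surely;
    but positive matrices have positive mass under \<open>muK k\<close>.\<close>
  have "0 < phi $ j" for j
  proof (rule ccontr)
    assume "\<not> 0 < phi $ j"
    then have pj: "phi $ j = 0" using phi(1) by (simp add: less_eq_vec_def) (meson not_less order_antisym)
    let ?e = "axis j 1 :: real^'d"
    have e: "0 \<le> ?e" "?e \<noteq> 0" by (auto simp: less_eq_vec_def axis_def vec_eq_iff)
    obtain g where g: "g \<in> \<Gamma>" "pos_mat g" by (rule Gamma_pos')
    obtain k where k: "g \<in> supp_measure (muK k)" using Gamma_supp_muK[OF g(1)] by blast
    have "EN ^ k * (\<integral>\<^sup>+m. ennreal (phi \<bullet> (m *v ?e)) \<partial>muK k) = ennreal (phi \<bullet> ?e)"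
      by (rule nn_integral_muK_left_harmonic[OF harmonic e(1)])
    also have "\<dots> = 0" by (simp add: inner_axis pj)
    finally have "(\<integral>\<^sup>+m. ennreal (phi \<bullet> (m *v ?e)) \<partial>muK k) = 0" using EN_bounds by simp
    then have "AE m in muK k. ennreal (phi \<bullet> (m *v ?e)) = 0" by (subst (asm) nn_integral_0_iff_AE) measurable
    then have "AE m in muK k. \<not> pos_mat m"
    proof eventually_elim
      fix m assume *: "ennreal (phi \<bullet> (m *v ?e)) = 0"
      show "\<not> pos_mat m"
      proof
        assume "pos_mat m"
        then have "0 < phi \<bullet> (m *v ?e)"
          using inner_vec_pos_iff[OF phi(1), of "m *v ?e"] pos_mat_vec[OF _ e] phi0 by blast
        with * show False by (simp add: ennreal_eq_0_iff)
      qed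
    qed
    moreover have op: "open {m :: real^'d^'d. pos_mat m}" by (rule open_pos_mat)
    ultimately have "emeasure (muK k) {m. pos_mat m} = 0"
      by (subst (asm) AE_iff_measurable[of "{m. pos_mat m}"]) auto
    moreover have "0 < emeasure (muK k) {m. pos_mat m}"
      using k g(2) op by (auto simp: supp_measure_def)
    ultimately show False by simp
  qed
  with phi(2) harmonic show ?thesis using that by blast
qed

text \<open>Near a positive matrix of \<open>\<Gamma>\<close> a product sends every nonnegative vector above a multiple of an
  element of \<open>\<Lambda>\<close>, so the expected distance of \<open>Z\<close> from the cone is at most \<open>1 - t\<close> times itself.\<close>

lemma support_subset_cone:
  assumes fin: "(\<integral>\<^sup>+x. ennreal (l1norm x) \<partial>zeta) < \<infinity>"
  shows "S \<subseteq> cone.K"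
proof -
  obtain phi where phi: "l1norm phi = 1" "\<And>i. 0 < phi $ i"
    and harm: "\<And>e. 0 \<le> e \<Longrightarrow> EN * (\<integral>\<^sup>+a. ennreal (phi \<bullet> (a *v e)) \<partial>mu) = ennreal (phi \<bullet> e)"
    using left_harmonic[OF fin] by metis
  have phi0: "0 \<le> phi" using phi(2) by (simp add: less_eq_vec_def less_imp_le)
  have phi_le: "phi \<le> 1"
    unfolding less_eq_vec_def
  proof
    fix i
    have "\<bar>phi $ i\<bar> \<le> l1norm phi" unfolding l1norm_def by (rule member_le_sum) auto
    then show "phi $ i \<le> 1 $ i" using phi(1) by simp
  qed
  obtain g where g: "g \<in> \<Gamma>" "pos_mat g" by (rule Gamma_pos')
  obtain k where k: "g \<in> supp_measure (muK k)" using Gamma_supp_muK[OF g(1)] by blast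
  interpret K: prob_space "muK k" by (rule prob_space_muK)
  define v where "v = perron_vec g"
  have v: "v \<in> \<Lambda>" "0 \<le> v" "l1norm v = 1" "\<And>i. 0 < v $ i"
    using perron_vec_Lambda[OF g] perron_vec_nonneg[OF g(2)] l1norm_perron_vec[OF g(2)] perron_vec_pos[OF g(2)]
    by (auto simp: v_def)
  \<comment> \<open>Half of the smallest entry, so that \<open>g\<close> lies in the open set
    \<open>near\<close>.\<close>
  define d where "d = (MIN p. g $ fst p $ snd p) / 2"
  have "(MIN p. g $ fst p $ snd p) \<in> range (\<lambda>p. g $ fst p $ snd p)" by (rule Min_in) auto
  then have d: "d > 0" using g(2) by (auto simp: d_def pos_mat_def)
  have dg: "d < g $ i $ j" for i j
  proof -
    have "(MIN p. g $ fst p $ snd p) \<le> g $ i $ j" by (rule Min_le) (auto intro!: image_eqI[of _ _ "(i, j)"])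
    then show ?thesis using d d_def by linarith
  qed
  define near where "near = {m :: real^'d^'d. \<forall>i j. d < m $ i $ j}"
  have open_near: "open near"
  proof -
    have "near = (\<Inter>i. \<Inter>j. {m. d < m $ i $ j})" by (auto simp: near_def)
    then show ?thesis by (auto intro!: open_INT open_Collect_less continuous_intros)
  qed
  then have [measurable]: "near \<in> sets borel" by simp
  have prob_near: "0 < emeasure (muK k) near" using k open_near dg by (auto simp: supp_measure_def near_def)
  \<comment> \<open>For \<open>m\<close> in \<open>near\<close>, a correction \<open>e\<close> is
    mapped above \<open>d * (1 \<bullet> e)\<close> times the cone vector \<open>v\<close>;
    \<open>q\<close> is this saving per unit of \<open>1 \<bullet> e\<close>, measured by
    \<open>phi\<close>.\<close>
  define q where "q = d * (phi \<bullet> v)"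
  have "v \<noteq> 0" using v(3) by (metis l1norm_0 zero_neq_one)
  then have q: "q > 0" using d inner_vec_pos[OF phi(2) v(2)] by (simp add: q_def)
  \<comment> \<open>The cap \<open>1 / 2\<close> keeps \<open>1 - t\<close> positive, so that it can
    be inverted.\<close>
  define t where "t = min (K.prob near * q) (1 / 2)"
  have t: "0 < t" "t \<le> 1 / 2" "t \<le> K.prob near * q"
    using prob_near q by (auto simp: t_def K.emeasure_eq_measure)
  let ?D = "excess phi cone.K"
  have D_meas [measurable]: "?D \<in> borel_measurable borel" by (rule excess_measurable[OF phi(2) cone.closed_K])
  have contract: "EN ^ k * (\<integral>\<^sup>+m. ?D (m *v x) \<partial>muK k) \<le> ennreal (1 - t) * ?D x" for x
  proof -
    let ?X = "EN ^ k * (\<integral>\<^sup>+m. ?D (m *v x) \<partial>muK k)"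
    have step: "?X \<le> ennreal (1 - t) * ennreal (phi \<bullet> e)" if e: "0 \<le> e" "x - e \<in> cone.K" for e
    proof -
      let ?u = "1 \<bullet> e"
      have u: "0 \<le> ?u" "phi \<bullet> e \<le> ?u" "0 \<le> phi \<bullet> e"
        using e(1) inner_vec_mono[OF e(1) phi_le] inner_vec_nonneg[OF phi0 e(1)]
        by (auto simp: inner_commute l1norm_eq_inner[symmetric])
      have "AE m in muK k. ?D (m *v x) + ennreal (q * ?u) * indicator near m \<le> ennreal (phi \<bullet> (m *v e))"
        using AE_muK_good
      proof eventually_elim
        fix m assume m: "nonneg_mat m \<and> (\<forall>h\<in>cone.K. m *v h \<in> cone.K)"
        have mx: "m *v x - m *v e \<in> cone.K" using m e(2) by (simp add: matrix_vector_mult_diff_distrib[symmetric])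
        have me: "0 \<le> m *v e" using m e(1) by (auto intro: nonneg_mat_vec)
        show "?D (m *v x) + ennreal (q * ?u) * indicator near m \<le> ennreal (phi \<bullet> (m *v e))"
        proof (cases "m \<in> near")
          case False
          then show ?thesis using excess_le[OF me mx, of phi] by simp
        next
          case True
          \<comment> \<open>Every row of \<open>m\<close> yields at least \<open>d * ?u\<close>, and
            the coordinates of \<open>v\<close> are at most 1. This part of the correction can be
            moved into the cone.\<close>
          have le: "(d * ?u) *\<^sub>R v \<le> m *v e"
            unfolding less_eq_vec_def
          proof
            fix i
            have "v $ i \<le> 1"
            proof -
              have "\<bar>v $ i\<bar> \<le> l1norm v" unfolding l1norm_def by (rule member_le_sum) auto
              then show ?thesis using v(3) by simp
            qed
            then have "(d * ?u) * v $ i \<le> (d * ?u) * 1" using d u by (intro mult_left_mono) auto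
            also have "\<dots> = (\<Sum>j\<in>UNIV. d * e $ j)" by (simp add: inner_vec_def sum_distrib_left)
            also have "\<dots> \<le> (\<Sum>j\<in>UNIV. m $ i $ j * e $ j)"
              using True e(1) by (intro sum_mono mult_right_mono) (auto simp: near_def less_eq_vec_def less_imp_le)
            finally show "((d * ?u) *\<^sub>R v) $ i \<le> (m *v e) $ i" by (simp add: matrix_vector_mult_def)
          qed
          have "(m *v x - m *v e) + (d * ?u) *\<^sub>R v \<in> cone.K"
            using v(1) cone.L_subset_K d u(1)
            by (intro convex_conic_add[OF cone.convex_K cone.conic_K mx] conicD[OF cone.conic_K]) auto
          then have "m *v x - (m *v e - (d * ?u) *\<^sub>R v) \<in> cone.K" by (simp add: algebra_simps)
          then have "?D (m *v x) \<le> ennreal (phi \<bullet> (m *v e - (d * ?u) *\<^sub>R v))"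
            using le by (intro excess_le) auto
          also have "phi \<bullet> (m *v e - (d * ?u) *\<^sub>R v) = phi \<bullet> (m *v e) - q * ?u"
            by (simp add: inner_diff_right q_def mult_ac)
          finally have "?D (m *v x) + ennreal (q * ?u) \<le> ennreal (phi \<bullet> (m *v e) - q * ?u) + ennreal (q * ?u)"
            by (rule add_right_mono)
          also have "\<dots> = ennreal (phi \<bullet> (m *v e))"
          proof (subst ennreal_plus[symmetric])
            have "phi \<bullet> ((d * ?u) *\<^sub>R v) \<le> phi \<bullet> (m *v e)" by (rule inner_vec_mono[OF phi0 le])
            then show "0 \<le> phi \<bullet> (m *v e) - q * ?u" by (simp add: q_def mult_ac)
            show "0 \<le> q * ?u" using q u(1) by simp
          qed simp
          finally show ?thesis using True by simp
        qed
      qed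
      then have "(\<integral>\<^sup>+m. ?D (m *v x) + ennreal (q * ?u) * indicator near m \<partial>muK k) \<le> (\<integral>\<^sup>+m. ennreal (phi \<bullet> (m *v e)) \<partial>muK k)"
        by (rule nn_integral_mono_AE)
      moreover have "(\<integral>\<^sup>+m. ?D (m *v x) + ennreal (q * ?u) * indicator near m \<partial>muK k)
          = (\<integral>\<^sup>+m. ?D (m *v x) \<partial>muK k) + ennreal (q * ?u) * emeasure (muK k) near"
        by (subst nn_integral_add) (auto simp: nn_integral_cmult_indicator)
      ultimately have "(\<integral>\<^sup>+m. ?D (m *v x) \<partial>muK k) + ennreal (q * ?u * K.prob near) \<le> (\<integral>\<^sup>+m. ennreal (phi \<bullet> (m *v e)) \<partial>muK k)"
        using q u by (simp add: K.emeasure_eq_measure ennreal_mult)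
      then have "EN ^ k * ((\<integral>\<^sup>+m. ?D (m *v x) \<partial>muK k) + ennreal (q * ?u * K.prob near)) \<le> EN ^ k * (\<integral>\<^sup>+m. ennreal (phi \<bullet> (m *v e)) \<partial>muK k)"
        by (rule mult_left_mono) simp
      also have "\<dots> = ennreal (phi \<bullet> e)" by (rule nn_integral_muK_left_harmonic[OF harm e(1)])
      finally have *: "?X + EN ^ k * ennreal (q * ?u * K.prob near) \<le> ennreal (phi \<bullet> e)" by (simp add: distrib_left)
      \<comment> \<open>\<open>phi \<bullet> e \<le> ?u\<close> turns the saving into a fixed share
        of \<open>phi \<bullet> e\<close>; the factor \<open>EN ^ k \<ge> 1\<close> only increases
        it.\<close>
      have "ennreal (t * (phi \<bullet> e)) \<le> 1 * ennreal (q * ?u * K.prob near)"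
      proof -
        have "t * (phi \<bullet> e) \<le> (K.prob near * q) * ?u" using t u q by (intro mult_mono) auto
        then show ?thesis by (simp add: ennreal_leI mult_ac)
      qed
      also have "\<dots> \<le> EN ^ k * ennreal (q * ?u * K.prob near)"
        using EN_bounds(1) by (intro mult_right_mono one_le_power) auto
      finally have "?X + ennreal (t * (phi \<bullet> e)) \<le> ?X + EN ^ k * ennreal (q * ?u * K.prob near)" by (rule add_left_mono)
      also note *
      also have "ennreal (phi \<bullet> e) = ennreal ((1 - t) * (phi \<bullet> e)) + ennreal (t * (phi \<bullet> e))"
      proof (subst ennreal_plus[symmetric])
        show "0 \<le> (1 - t) * (phi \<bullet> e)" "0 \<le> t * (phi \<bullet> e)" using t u by auto
      qed (simp add: algebra_simps)
      finally have "ennreal (t * (phi \<bullet> e)) + ?X \<le> ennreal (t * (phi \<bullet> e)) + ennreal ((1 - t) * (phi \<bullet> e))"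
        by (simp only: add.commute)
      then have "?X \<le> ennreal ((1 - t) * (phi \<bullet> e))" unfolding ennreal_add_left_cancel_le by simp
      also have "\<dots> = ennreal (1 - t) * ennreal (phi \<bullet> e)" using t u by (simp add: ennreal_mult)
      finally show ?thesis .
    qed
    have inv: "ennreal (1 / (1 - t)) * ennreal (1 - t) = 1" using t by (simp add: ennreal_mult[symmetric])
    \<comment> \<open>The inverse factor is moved to the left so that the infimum defining
      \<open>?D x\<close> stands alone on the right.\<close>
    have "ennreal (1 / (1 - t)) * ?X \<le> ?D x"
      unfolding excess_def[of phi cone.K x]
    proof (rule INF_greatest)
      fix e assume "e \<in> {e. 0 \<le> e \<and> x - e \<in> cone.K}"
      then have "?X \<le> ennreal (1 - t) * ennreal (phi \<bullet> e)" using step by blast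
      then have "ennreal (1 / (1 - t)) * ?X \<le> ennreal (1 / (1 - t)) * (ennreal (1 - t) * ennreal (phi \<bullet> e))"
        by (rule mult_left_mono) simp
      also have "\<dots> = ennreal (phi \<bullet> e)" unfolding mult.assoc[symmetric] inv by simp
      finally show "ennreal (1 / (1 - t)) * ?X \<le> ennreal (phi \<bullet> e)" .
    qed
    then have le: "ennreal (1 - t) * (ennreal (1 / (1 - t)) * ?X) \<le> ennreal (1 - t) * ?D x" by (rule mult_left_mono) simp
    have "?X = ennreal (1 - t) * (ennreal (1 / (1 - t)) * ?X)"
      using inv by (subst mult.assoc[symmetric]) (simp only: mult.commute[of "ennreal (1 - t)"] mult_1_left)
    also note le
    finally show ?thesis .
  qed
  interpret P: pair_sigma_finite "muK k" zeta ..
  have "(\<integral>\<^sup>+x. ?D x \<partial>zeta) \<le> EN ^ k * (\<integral>\<^sup>+m. (\<integral>\<^sup>+x. ?D (m *v x) \<partial>zeta) \<partial>muK k)"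
    by (intro nn_integral_zeta_subadditive_muK excess_0 excess_add cone.convex_K cone.conic_K phi0 cone.zero_K D_meas)
  also have "\<dots> = EN ^ k * (\<integral>\<^sup>+x. (\<integral>\<^sup>+m. ?D (m *v x) \<partial>muK k) \<partial>zeta)"
    by (subst P.Fubini') (auto, measurable)
  also have "\<dots> = (\<integral>\<^sup>+x. EN ^ k * (\<integral>\<^sup>+m. ?D (m *v x) \<partial>muK k) \<partial>zeta)"
  proof -
    have "(\<lambda>p. ?D (snd p *v fst p)) \<in> borel_measurable (zeta \<Otimes>\<^sub>M muK k)" by measurable
    from K.borel_measurable_nn_integral_fst[OF this] show ?thesis by (subst nn_integral_cmult) auto
  qed
  also have "\<dots> \<le> (\<integral>\<^sup>+x. ennreal (1 - t) * ?D x \<partial>zeta)" by (intro nn_integral_mono contract)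
  also have "\<dots> = ennreal (1 - t) * (\<integral>\<^sup>+x. ?D x \<partial>zeta)" by (rule nn_integral_cmult) measurable
  finally have le: "(\<integral>\<^sup>+x. ?D x \<partial>zeta) \<le> ennreal (1 - t) * (\<integral>\<^sup>+x. ?D x \<partial>zeta)" .
  have "(\<integral>\<^sup>+x. ?D x \<partial>zeta) \<le> (\<integral>\<^sup>+x. ennreal (l1norm x) \<partial>zeta)"
  proof (rule nn_integral_mono_AE)
    show "AE x in zeta. ?D x \<le> ennreal (l1norm x)"
      using AE_zeta_nonneg
    proof eventually_elim
      fix x :: "real^'d" assume x: "0 \<le> x"
      have "?D x \<le> ennreal (phi \<bullet> x)" using cone.zero_K by (intro excess_le x) simp
      also have "\<dots> \<le> ennreal (l1norm x)"
        using inner_vec_mono[OF x phi_le] by (intro ennreal_leI) (simp add: l1norm_eq_inner[OF x] inner_commute)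
      finally show "?D x \<le> ennreal (l1norm x)" .
    qed
  qed
  then have "(\<integral>\<^sup>+x. ?D x \<partial>zeta) < \<infinity>" using fin by (rule order.strict_trans1)
  then obtain s where s: "(\<integral>\<^sup>+x. ?D x \<partial>zeta) = ennreal s" "0 \<le> s"
    by (cases "\<integral>\<^sup>+x. ?D x \<partial>zeta") auto
  \<comment> \<open>The finite mean has made \<open>s\<close> a real number, for which a strict
    contraction leaves only the value 0.\<close>
  have "s \<le> (1 - t) * s" using le t s(2) unfolding s(1) by (simp add: ennreal_mult[symmetric])
  then have "t * s \<le> 0" by (simp add: algebra_simps)
  then have "s = 0" using t(1) s(2) by (simp add: mult_le_0_iff)
  then have "AE x in zeta. ?D x = 0" using s(1) by (subst nn_integral_0_iff_AE[symmetric]) auto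
  then have "AE x in zeta. x \<in> cone.K"
    by eventually_elim (rule excess_eq_0_imp[OF phi(2) cone.closed_K])
  then show ?thesis by (rule S_subset[OF cone.closed_K])
qed

end

theorem theorem1p2:
  fixes M :: "'w measure"
    and A :: "'w \<Rightarrow> nat \<Rightarrow> real^'d^'d"
    and Z :: "'w \<Rightarrow> real^'d"
    and Zs :: "'w \<Rightarrow> nat \<Rightarrow> real^'d"
  assumes prob: "prob_space M"
    and A_meas: "A \<in> borel_measurable M"
    and A_struct: "AE \<omega> in M. finite {i. A \<omega> i \<noteq> 0}
                      \<and> (\<forall>i. A \<omega> i \<noteq> 0 \<longleftrightarrow> i < numN A \<omega>)"
    and N_ge1: "AE \<omega> in M. numN A \<omega> \<ge> 1"
    and A_nonneg: "AE \<omega> in M. \<forall>i. nonneg_mat (A \<omega> i)"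
    and EN_gt1: "1 < (\<integral>\<^sup>+\<omega>. of_nat (numN A \<omega>) \<partial>M)"
    and EN_fin: "(\<integral>\<^sup>+\<omega>. of_nat (numN A \<omega>) \<partial>M) < \<infinity>"
    and Gamma_rows_cols: "\<forall>a\<in>semigrp (supp_measure (mu_meas M A)).
                (\<forall>i. \<exists>j. a $ i $ j > 0) \<and> (\<forall>j. \<exists>i. a $ i $ j > 0)"
    and Gamma_pos: "\<exists>a\<in>semigrp (supp_measure (mu_meas M A)). pos_mat a"
    and cond_iii: "\<exists>U1 U2 a1 a2.
                cover_set U1 \<and> finite_level U1 \<and> cover_set U2 \<and> finite_level U2
              \<and> (\<forall>v. a1 v \<in> supp_measure (distr M borel A))
              \<and> (\<forall>v. a2 v \<in> supp_measure (distr M borel A))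
              \<and> weight a1 summable_on U1 \<and> weight a2 summable_on U2
              \<and> pos_mat (gsum a1 U1) \<and> pos_mat (gsum a2 U2)
              \<and> spec_rad (gsum a1 U1) < 1 \<and> 1 < spec_rad (gsum a2 U2)"
    and Z_meas: "Z \<in> borel_measurable M"
    and Z_nonneg: "\<forall>\<omega>. nonneg_vec (Z \<omega>)"
    and Zs_meas: "Zs \<in> borel_measurable M"
    and Zs_indep: "prob_space.indep_vars M (\<lambda>_. borel) (\<lambda>i \<omega>. Zs \<omega> i) UNIV"
    and Zs_distr: "\<forall>i. distr M borel (\<lambda>\<omega>. Zs \<omega> i) = distr M borel Z"
    and A_Zs_indep: "prob_space.indep_set M
                 {A -` S \<inter> space M | S. S \<in> sets borel}
                 {Zs -` S \<inter> space M | S. S \<in> sets borel}"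
    and fixed_point: "distr M borel Z
                 = distr M borel (\<lambda>\<omega>. \<Sum>i<numN A \<omega>. A \<omega> i *v Zs \<omega> i)"
    and Z_nonzero: "measure M {\<omega>\<in>space M. Z \<omega> = 0} = 0"
  shows "(\<forall>U a. cover_set U \<and> finite_level U
              \<and> (\<forall>v. a v \<in> supp_measure (distr M borel A)) \<longrightarrow>
            cone_sum {perron_vec (gsum a V) | V. V \<subseteq> U \<and> weight a summable_on V
                                                \<and> pos_mat (gsum a V)}
              \<subseteq> supp_measure (distr M borel Z))
       \<and> ((1::real) \<in> interior (I_mu (mu_meas M A))
           \<and> (let m = (\<lambda>s. (\<integral>\<omega>. real (numN A \<omega>) \<partial>M) * kappa (mu_meas M A) s)
              in m 1 = 1 \<and> (\<exists>D. (m has_real_derivative D) (at 1) \<and> D < 0))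
           \<and> (\<integral>\<^sup>+\<omega>. ennreal (l1norm (Z \<omega>)) \<partial>M) < \<infinity>
          \<longrightarrow> supp_measure (distr M borel Z) \<subseteq> H_set (Lambda_set (semigrp (supp_measure (mu_meas M A))))
            \<and> H_set (Lambda_set (semigrp (supp_measure (mu_meas M A))))
              = Hd_set (Lambda_set (semigrp (supp_measure (mu_meas M A)))))"
proof -
  interpret smoothing M A Z Zs
    by (intro smoothing.intro smoothing_axioms.intro assms)
  have S_eq: "supp_measure (distr M borel Z) = S" by (simp add: S_def zeta_def)
  have G_eq: "semigrp (supp_measure (mu_meas M A)) = \<Gamma>" by (simp add: \<Gamma>_def mu_def)
  obtain U1 U2 a1 a2 where *:
    "cover_set U1 \<and> finite_level U1 \<and> cover_set U2 \<and> finite_level U2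
      \<and> (\<forall>v. a1 v \<in> suppA) \<and> (\<forall>v. a2 v \<in> suppA)
      \<and> weight a1 summable_on U1 \<and> weight a2 summable_on U2
      \<and> pos_mat (gsum a1 U1) \<and> pos_mat (gsum a2 U2)
      \<and> spec_rad (gsum a1 U1) < 1 \<and> 1 < spec_rad (gsum a2 U2)"
    using cond_iii by blast
  show ?thesis
    unfolding S_eq G_eq
  proof (intro conjI allI impI)
    fix U and a :: "nat list \<Rightarrow> nat \<Rightarrow> real^'d^'d"
    assume "cover_set U \<and> finite_level U \<and> (\<forall>v. a v \<in> suppA)"
    then show "cone_sum {perron_vec (gsum a V) | V. V \<subseteq> U \<and> weight a summable_on V \<and> pos_mat (gsum a V)} \<subseteq> S"
      using * by (intro cone_sum_subset_support[of U1 a1 U2 a2]) auto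
  next
    assume "(1::real) \<in> interior (I_mu (mu_meas M A))
      \<and> (let m = (\<lambda>s. (\<integral>\<omega>. real (numN A \<omega>) \<partial>M) * kappa (mu_meas M A) s)
         in m 1 = 1 \<and> (\<exists>D. (m has_real_derivative D) (at 1) \<and> D < 0))
      \<and> (\<integral>\<^sup>+\<omega>. ennreal (l1norm (Z \<omega>)) \<partial>M) < \<infinity>"
    then have "(\<integral>\<^sup>+\<omega>. ennreal (l1norm (Z \<omega>)) \<partial>M) < \<infinity>" by simp
    moreover have "(l1norm :: real^'d \<Rightarrow> real) \<in> borel_measurable borel"
      by (intro borel_measurable_continuous_onI continuous_on_l1norm continuous_on_id)
    ultimately have "(\<integral>\<^sup>+x. ennreal (l1norm x) \<partial>zeta) < \<infinity>"
      by (simp add: zeta_def nn_integral_distr)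
    from support_subset_cone[OF this] show "S \<subseteq> H_set \<Lambda>" by (simp only: cone.H_set_eq)
    show "H_set \<Lambda> = Hd_set \<Lambda>" by (simp only: cone.H_set_eq cone.Hd_set_eq)
  qed
qed

end
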